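(* For every choice of constants $0<b_2<b_1<1$, the $(b_1,b_2)$-approximate similarity search problem under Braun-Blanquet similarity on a collection $P$ of $n$ sets can be solved with query time $O(|q|n^{\rho}\log n)$ and space usage $O(n^{1+\rho}\log n+\sum_{x\in P}|x|)$, where $\rho=\log(1/b_1)/\log(1/b_2)$.
   Context: Vectors $x\in\{0,1\}^d$ are identified with subsets $\{i: x_i=1\}$ of $\{1,\dots,d\}$. Braun-Blanquet similarity: $B(x,y)=|x\cap y|/\max(|x|,|y|)$. The $(s_1,s_2)$-similarity search problem (with $s_1>s_2$) for $P\subseteq\{0,1\}^d$: build a data structure that, given a query $q\in\{0,1\}^d$ for which some $x\in P$ has $B(x,q)\ge s_1$, returns $x'\in P$ with $B(x',q)>s_2$; queries succeed with probability at least $1/2$. Model: word RAM with word size $\Theta(\log n)$, augmented with an instruction generating a uniformly random word in constant time. *)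

theory Defs
  imports "HOL-Probability.Probability_Mass_Function"
begin

definition braun_blanquet :: "nat set \<Rightarrow> nat set \<Rightarrow> real" where
  "braun_blanquet x y = real (card (x \<inter> y)) / real (max (card x) (card y))"

text \<open>
  The word RAM with word size \<open>w\<close>. A word is a natural number below \<open>2 ^ w\<close>; memory is addressed
  by words. Besides the memory there are registers (a program names only finitely many of them)
  and a read-only, randomly accessible input array.
\<close>

datatype binop = Plus | Minus | Times | Div | Mod | And | Or | Xor | Shl | Shr | Less | Equal

fun binop_val :: "nat \<Rightarrow> binop \<Rightarrow> nat \<Rightarrow> nat \<Rightarrow> nat" where
  "binop_val w Plus a b = (a + b) mod 2 ^ w"
| "binop_val w Minus a b = (a + 2 ^ w - b) mod 2 ^ w"
| "binop_val w Times a b = (a * b) mod 2 ^ w"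
| "binop_val w Div a b = a div b"
| "binop_val w Mod a b = a mod b"
| "binop_val w And a b = semiring_bit_operations_class.and a b"
| "binop_val w Or a b = semiring_bit_operations_class.or a b"
| "binop_val w Xor a b = semiring_bit_operations_class.xor a b"
| "binop_val w Shl a b = push_bit b a mod 2 ^ w"
| "binop_val w Shr a b = drop_bit b a"
| "binop_val w Less a b = of_bool (a < b)"
| "binop_val w Equal a b = of_bool (a = b)"

datatype exp = Const nat | Reg nat | Mem exp | Inp exp | Bin binop exp exp

datatype com =
    Assign nat exp
  | Store exp exp
  | Rand nat
  | Seq com com
  | If exp com com
  | While exp com

record store =
  regs :: "nat \<Rightarrow> nat"
  mem :: "nat \<Rightarrow> nat"

fun eval :: "nat \<Rightarrow> nat list \<Rightarrow> store \<Rightarrow> exp \<Rightarrow> nat" where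
  "eval w inp s (Const c) = c mod 2 ^ w"
| "eval w inp s (Reg r) = regs s r"
| "eval w inp s (Mem e) = mem s (eval w inp s e)"
| "eval w inp s (Inp e) = (let i = eval w inp s e in if i < length inp then inp ! i else 0)"
| "eval w inp s (Bin f e1 e2) = binop_val w f (eval w inp s e1) (eval w inp s e2)"

text \<open>
  A configuration is a stack of commands still to be executed together with a store; it has halted
  when the stack is empty. Expressions are part of the program and hence of constant size, so one
  step stands for a constant number of elementary RAM instructions.
\<close>

type_synonym config = "com list \<times> store"

fun step :: "nat \<Rightarrow> nat list \<Rightarrow> config \<Rightarrow> config pmf" where
  "step w inp ([], s) = return_pmf ([], s)"
| "step w inp (Assign r e # k, s) =
     return_pmf (k, s\<lparr>regs := (regs s)(r := eval w inp s e)\<rparr>)"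
| "step w inp (Store e1 e2 # k, s) =
     return_pmf (k, s\<lparr>mem := (mem s)(eval w inp s e1 := eval w inp s e2)\<rparr>)"
| "step w inp (Rand r # k, s) =
     map_pmf (\<lambda>u. (k, s\<lparr>regs := (regs s)(r := u)\<rparr>)) (pmf_of_set {0..<2 ^ w})"
| "step w inp (Seq c1 c2 # k, s) = return_pmf (c1 # c2 # k, s)"
| "step w inp (If e c1 c2 # k, s) =
     return_pmf ((if eval w inp s e \<noteq> 0 then c1 else c2) # k, s)"
| "step w inp (While e c # k, s) =
     return_pmf (if eval w inp s e \<noteq> 0 then c # While e c # k else k, s)"

primrec run :: "nat \<Rightarrow> nat list \<Rightarrow> nat \<Rightarrow> config \<Rightarrow> config pmf" where
  "run w inp 0 cfg = return_pmf cfg"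
| "run w inp (Suc t) cfg = bind_pmf (step w inp cfg) (run w inp t)"

definition init :: "(nat \<Rightarrow> nat) \<Rightarrow> store" where
  "init m = \<lparr>regs = (\<lambda>_. 0), mem = m\<rparr>"

definition halts_within :: "nat \<Rightarrow> nat list \<Rightarrow> com \<Rightarrow> (nat \<Rightarrow> nat) \<Rightarrow> nat \<Rightarrow> bool" where
  "halts_within w inp c m t \<longleftrightarrow> (\<forall>cfg \<in> set_pmf (run w inp t ([c], init m)). fst cfg = [])"

text \<open>
  The distribution of the store after \<open>t\<close> steps. Halted configurations are fixed points of
  \<^const>\<open>step\<close>, so under \<^const>\<open>halts_within\<close> this is the distribution of the final store.
\<close>

definition result :: "nat \<Rightarrow> nat list \<Rightarrow> com \<Rightarrow> (nat \<Rightarrow> nat) \<Rightarrow> nat \<Rightarrow> store pmf" where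
  "result w inp c m t = map_pmf snd (run w inp t ([c], init m))"

definition encode_set :: "nat set \<Rightarrow> nat list" where
  "encode_set x = card x # sorted_list_of_set x"

definition fixed_point :: "nat \<Rightarrow> real \<Rightarrow> nat" where
  "fixed_point w r = nat \<lfloor>r * 2 ^ w\<rfloor>"

text \<open>
  The collection is presented as a list in arbitrary order. The real parameters \<open>s1\<close>, \<open>s2\<close> are
  supplied rounded to word precision, since a finite program cannot contain an arbitrary real.
\<close>

definition encode_instance :: "nat \<Rightarrow> nat \<Rightarrow> real \<Rightarrow> real \<Rightarrow> nat set list \<Rightarrow> nat list" where
  "encode_instance w d s1 s2 ps =
     [length ps, d, fixed_point w s1, fixed_point w s2] @ concat (map encode_set ps)"

text \<open>A query returns a set by leaving in register 0 the address of its encoding in memory.\<close>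

definition returns :: "store \<Rightarrow> nat set \<Rightarrow> bool" where
  "returns s x \<longleftrightarrow>
     (\<forall>i < length (encode_set x). mem s (regs s 0 + i) = encode_set x ! i)"

text \<open>
  The programs \<open>build\<close> and \<open>query\<close> solve the \<open>(s1, s2)\<close>-similarity search problem for the
  collection \<open>ps\<close> of subsets of \<open>{1..d}\<close>: \<open>build\<close> halts on every sequence of random words and
  leaves a data structure in the memory cells below \<open>cells\<close>; with this memory, \<open>query\<close> halts on
  every \<open>q\<close> within \<open>qtime (card q)\<close> steps, again for all random words. The success probability,
  for each fixed \<open>q\<close>, is over the random words of both programs.
\<close>

definition solves_similarity_search ::
  "nat \<Rightarrow> nat \<Rightarrow> real \<Rightarrow> real \<Rightarrow> nat set list \<Rightarrow> com \<Rightarrow> com \<Rightarrow> nat \<Rightarrow> (nat \<Rightarrow> nat) \<Rightarrow> bool" where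
  "solves_similarity_search w d s1 s2 ps build query cells qtime \<longleftrightarrow>
     (\<exists>T D. halts_within w (encode_instance w d s1 s2 ps) build (\<lambda>_. 0) T \<and>
        D = map_pmf mem (result w (encode_instance w d s1 s2 ps) build (\<lambda>_. 0) T) \<and>
        (\<forall>m \<in> set_pmf D. \<forall>a \<ge> cells. m a = 0) \<and>
        (\<forall>q \<subseteq> {1..d}.
           (\<forall>m \<in> set_pmf D. halts_within w (encode_set q) query m (qtime (card q))) \<and>
           ((\<exists>x \<in> set ps. braun_blanquet x q \<ge> s1) \<longrightarrow>
              measure_pmf.prob
                (bind_pmf D (\<lambda>m. result w (encode_set q) query m (qtime (card q))))
                {s. \<exists>x \<in> set ps. braun_blanquet x q > s2 \<and> returns s x} \<ge> 1 / 2)))"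

end

theory Submission
  imports Defs
begin

text \<open>
  The data structure is the Chosen Path filter. Every set \<open>x\<close> grows a random tree of paths: a path with
  identifier \<open>v\<close> is extended by those \<open>i \<in> x\<close> whose hash value \<open>h (v, i)\<close> falls below a threshold of
  relative size \<open>1 / (b1 * |x|)\<close>, so the expected branching factor is \<open>1 / b1\<close>; the hash value is the
  identifier of the new path. At depth \<open>k\<close>, about \<open>ln n / ln (1 / b2)\<close>, there are
  \<open>(1 / b1) ^ k = O(n powr \<rho>)\<close> paths per set. The paths shared by two sets of similarity at least \<open>b1\<close>
  form a process with branching factor at least 1, which by the second moment method survives to depth \<open>k\<close>
  with probability at least \<open>1 / (2 * k + 2)\<close>; hence \<open>O(log n)\<close> independent repetitions suffice. For two
  sets of similarity at most \<open>b2\<close> the factor is \<open>b2 / b1\<close>, so \<open>n\<close> such sets together share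
  \<open>n * (b2 / b1) ^ k\<close>, about \<open>(1 / b1) ^ k\<close>, paths with the query. The paths of all sets are kept in a chained
  hash table. Queues and candidate lists are truncated at a constant times their expected length, which turns
  the expected bounds on time and space into worst-case ones and costs, by Markov's inequality, a constant
  failure probability.
\<close>

subsection \<open>Expectations over random words\<close>

definition random_words :: "nat \<Rightarrow> nat \<Rightarrow> nat list pmf" where
  "random_words w n = replicate_pmf n (pmf_of_set {0..<2 ^ w})"

abbreviation expect :: "nat \<Rightarrow> nat \<Rightarrow> (nat list \<Rightarrow> real) \<Rightarrow> real" where
  "expect w n \<equiv> measure_pmf.expectation (random_words w n)"

lemma random_words_0 [simp]: "random_words w 0 = return_pmf []"
  by (simp add: random_words_def)

lemma random_words_Suc:
  "random_words w (Suc n) = bind_pmf (pmf_of_set {0..<2 ^ w}) (\<lambda>u. map_pmf ((#) u) (random_words w n))"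
  by (simp add: random_words_def map_pmf_def)

lemma set_random_words: "set_pmf (random_words w n) = {ws. length ws = n \<and> set ws \<subseteq> {..<2 ^ w}}"
  by (auto simp: random_words_def set_replicate_pmf)

lemma finite_random_words: "finite (set_pmf (random_words w n))"
  using finite_lists_length_eq[of "{..<(2::nat) ^ w}" n] by (simp add: set_random_words conj_commute)

lemma integrable_random_words [simp]: "integrable (random_words w n) (f :: nat list \<Rightarrow> real)"
  by (intro integrable_measure_pmf_finite finite_random_words)

lemma expect_mono:
  assumes "\<And>ws. length ws = n \<Longrightarrow> set ws \<subseteq> {..<2 ^ w} \<Longrightarrow> f ws \<le> g ws"
  shows "expect w n f \<le> expect w n g"
  using assms by (intro integral_mono_AE) (auto simp: AE_measure_pmf_iff set_random_words)

lemma expect_cong: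
  assumes "\<And>ws. length ws = n \<Longrightarrow> set ws \<subseteq> {..<2 ^ w} \<Longrightarrow> f ws = g ws"
  shows "expect w n f = expect w n g"
  using assms by (intro antisym expect_mono) auto

lemma integral_sum_list:
  fixes f :: "'a \<Rightarrow> 'b \<Rightarrow> real"
  assumes "\<And>x. x \<in> set xs \<Longrightarrow> integrable M (f x)"
  shows "(\<integral>\<omega>. (\<Sum>x\<leftarrow>xs. f x \<omega>) \<partial>M) = (\<Sum>x\<leftarrow>xs. \<integral>\<omega>. f x \<omega> \<partial>M)"
proof -
  have "integrable M (\<lambda>\<omega>. \<Sum>x\<leftarrow>xs. f x \<omega>) \<and> ?thesis"
    using assms by (induction xs) auto
  then show ?thesis ..
qed

lemma expectation_bind_pmf_finite:
  fixes h :: "'b \<Rightarrow> real"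
  assumes "finite (set_pmf p)" "\<And>x. x \<in> set_pmf p \<Longrightarrow> finite (set_pmf (q x))"
  shows "measure_pmf.expectation (bind_pmf p q) h =
    measure_pmf.expectation p (\<lambda>x. measure_pmf.expectation (q x) h)"
  using assms by (simp add: pmf_expectation_bind[of "set_pmf p"] integral_measure_pmf[of "set_pmf p"])

lemma expect_append: "expect w (m + n) f = expect w m (\<lambda>xs. expect w n (\<lambda>ys. f (xs @ ys)))"
proof -
  have "random_words w (m + n) =
    bind_pmf (random_words w m) (\<lambda>xs. map_pmf ((@) xs) (random_words w n))"
    by (simp add: random_words_def replicate_pmf_distrib map_pmf_def)
  then show ?thesis
    by (simp add: expectation_bind_pmf_finite finite_random_words)
qed

lemma expect_block:
  "expect w (p + m + q) (\<lambda>ws. f (take m (drop p ws))) = expect w m f"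
proof -
  have "expect w (p + m + q) (\<lambda>ws. f (take m (drop p ws))) =
    expect w p (\<lambda>xs. expect w m (\<lambda>ys. expect w q (\<lambda>zs. f (take m (drop p ((xs @ ys) @ zs))))))"
    by (simp only: expect_append)
  also have "\<dots> = expect w p (\<lambda>xs. expect w m (\<lambda>ys. expect w q (\<lambda>zs. f ys)))"
    by (intro expect_cong) simp
  finally show ?thesis by simp
qed

lemma expect_prod_blocks:
  "expect w (L * B) (\<lambda>ws. \<Prod>r<L. f (take B (drop (r * B) ws))) = expect w B f ^ L"
proof (induction L)
  case (Suc L)
  have "expect w (Suc L * B) (\<lambda>ws. \<Prod>r<Suc L. f (take B (drop (r * B) ws))) =
    expect w B (\<lambda>xs. expect w (L * B) (\<lambda>ys. \<Prod>r<Suc L. f (take B (drop (r * B) (xs @ ys)))))"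
    by (simp only: expect_append mult_Suc)
  also have "\<dots> = expect w B (\<lambda>xs. expect w (L * B) (\<lambda>ys. f xs * (\<Prod>r<L. f (take B (drop (r * B) ys)))))"
    by (intro expect_cong) (simp add: prod.lessThan_Suc_shift del: prod.lessThan_Suc)
  finally show ?case by (simp add: Suc.IH)
qed simp

lemma (in prob_space) second_moment_method:
  fixes X :: "'a \<Rightarrow> real"
  assumes int: "integrable M X" "integrable M (\<lambda>\<omega>. (X \<omega>)\<^sup>2)"
    and mean: "m \<le> expectation X" "0 < m"
    and square: "expectation (\<lambda>\<omega>. (X \<omega>)\<^sup>2) \<le> b * m\<^sup>2" "0 < b"
  shows "1 / b \<le> expectation (\<lambda>\<omega>. of_bool (X \<omega> \<noteq> 0))"
proof -
  have [measurable]: "X \<in> borel_measurable M" using int(1) by (rule borel_measurable_integrable)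
  have int_nonzero: "integrable M (\<lambda>\<omega>. of_bool (X \<omega> \<noteq> 0) :: real)"
    unfolding of_bool_def by (intro integrable_const_bound[where B = 1]) auto
  define \<theta> where "\<theta> = 1 / (b * m)"
  have \<theta>: "0 < \<theta>" using mean square by (simp add: \<theta>_def)
  \<comment> \<open>The bound is optimal for this \<open>\<theta>\<close>.\<close>
  have "2 * \<theta> * X \<omega> - \<theta>\<^sup>2 * (X \<omega>)\<^sup>2 \<le> of_bool (X \<omega> \<noteq> 0)" for \<omega>
    using zero_le_power2[of "1 - \<theta> * X \<omega>"] by (auto simp: power2_eq_square algebra_simps)
  then have "expectation (\<lambda>\<omega>. 2 * \<theta> * X \<omega> - \<theta>\<^sup>2 * (X \<omega>)\<^sup>2) \<le> expectation (\<lambda>\<omega>. of_bool (X \<omega> \<noteq> 0))"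
    using int int_nonzero by (intro integral_mono) auto
  then have "2 * \<theta> * expectation X - \<theta>\<^sup>2 * expectation (\<lambda>\<omega>. (X \<omega>)\<^sup>2) \<le> expectation (\<lambda>\<omega>. of_bool (X \<omega> \<noteq> 0))"
    using int by simp
  moreover have "2 * \<theta> * m \<le> 2 * \<theta> * expectation X"
    using \<theta> mean by simp
  moreover have "\<theta>\<^sup>2 * expectation (\<lambda>\<omega>. (X \<omega>)\<^sup>2) \<le> \<theta>\<^sup>2 * (b * m\<^sup>2)"
    using square by (intro mult_left_mono) auto
  moreover have "2 * \<theta> * m - \<theta>\<^sup>2 * (b * m\<^sup>2) = 1 / b"
    using assms by (simp add: \<theta>_def field_simps power2_eq_square)
  ultimately show ?thesis by linarith
qed

subsection \<open>Multiply-shift hashing\<close>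

definition hash :: "nat \<Rightarrow> nat \<Rightarrow> nat \<Rightarrow> nat \<Rightarrow> nat \<Rightarrow> nat" where
  "hash w z a c key = ((a * key + c) mod 2 ^ w) div 2 ^ (w - z)"

lemma hash_less: "z \<le> w \<Longrightarrow> hash w z a c x < 2 ^ z"
  by (simp add: hash_def less_mult_imp_div_less flip: power_add)

lemma sum_lessThan_mult: "(\<Sum>a<n * k. f a) = (\<Sum>m<n. \<Sum>i<k. f (m * k + i :: nat) :: real)"
proof -
  have "(\<Sum>i<k. f (m * k + i)) = sum f {m * k..<m * k + k}" for m
    using sum.shift_bounds_nat_ivl[of f 0 "m * k" k] by (simp add: lessThan_atLeast0 add.commute)
  then show ?thesis by (simp add: sum.nat_group)
qed

lemma sum_mod_reindex:
  assumes "inj_on (\<lambda>a. g a mod W) {..<W}" "W > (0::nat)"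
  shows "(\<Sum>a<W. f (g a mod W)) = (\<Sum>a<W. f a :: real)"
proof -
  have "(\<lambda>a. g a mod W) ` {..<W} = {..<W}"
    using assms by (intro endo_inj_surj) auto
  then show ?thesis using sum.reindex[OF assms(1), of f] by (simp add: o_def)
qed

lemma sum_mod_shift:
  assumes "W > (0::nat)"
  shows "(\<Sum>a<W. f ((a + c) mod W)) = (\<Sum>a<W. f a :: real)"
proof (rule sum_mod_reindex)
  have "a = b" if "(a + c) mod W = (b + c) mod W" "a < W" "b < W" "a \<le> b" for a b
  proof -
    have "W dvd b - a" using that mod_eq_dvd_iff_nat[of "a + c" "b + c" W] by auto
    then show ?thesis using that by (auto dest: dvd_imp_le)
  qed
  then show "inj_on (\<lambda>a. (a + c) mod W) {..<W}"
    by (intro inj_onI) (metis lessThan_iff nat_le_linear)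
qed fact

lemma sum_mod_odd:
  assumes "odd (e :: nat)"
  shows "(\<Sum>a<2 ^ w. f ((a * e) mod 2 ^ w)) = (\<Sum>a<2 ^ w. f a :: real)"
proof (rule sum_mod_reindex)
  have "a = b" if "(a * e) mod 2 ^ w = (b * e) mod 2 ^ w" "a < 2 ^ w" "b < 2 ^ w" "a \<le> b" for a b :: nat
  proof -
    have "2 ^ w dvd b * e - a * e" using that mod_eq_dvd_iff_nat[of "a * e" "b * e" "2 ^ w"] by auto
    then have "2 ^ w dvd (b - a) * e" by (simp add: diff_mult_distrib)
    moreover have "coprime (2 ^ w) e" using assms by simp
    ultimately have "2 ^ w dvd b - a" by (simp add: coprime_dvd_mult_left_iff)
    then show ?thesis using that by (auto dest: dvd_imp_le)
  qed
  then show "inj_on (\<lambda>a. (a * e) mod 2 ^ w) {..<2 ^ w}"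
    by (intro inj_onI) (metis lessThan_iff nat_le_linear)
qed simp

lemma sum_mod_periodic: "(\<Sum>a<m * p. f ((c + a) mod p)) = real m * (\<Sum>a<p. f a :: real)"
proof (cases "p = 0")
  case False
  have "(c + (i * p + a)) mod p = (a + c) mod p" for i a
    using mod_mult_self1[of "a + c" i p] by (simp only: add_ac)
  then show ?thesis using False by (simp add: sum_lessThan_mult sum_mod_shift)
qed simp

lemma sum_div_pow:
  fixes f :: "nat \<Rightarrow> real"
  assumes "z \<le> w"
  shows "(\<Sum>c<2 ^ w. f (c div 2 ^ (w - z))) = 2 ^ (w - z) * (\<Sum>\<alpha><2 ^ z. f \<alpha>)"
proof -
  have "(2::nat) ^ w = 2 ^ z * 2 ^ (w - z)" using assms by (simp flip: power_add)
  then show ?thesis by (simp add: sum_lessThan_mult sum_distrib_left)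
qed

lemma mod_pow2_div_pow2: "z \<le> w \<Longrightarrow> (x mod 2 ^ w) div 2 ^ (w - z) = (x div 2 ^ (w - z)) mod (2 ^ z :: nat)"
  using drop_bit_take_bit[of "w - z" w x] by (simp add: drop_bit_eq_div take_bit_eq_mod)

lemma high_bits_add_mult_pow2:
  fixes a c :: nat
  assumes "z \<le> u"
  shows "((c + a * 2 ^ y) mod 2 ^ (y + u)) div 2 ^ (y + u - z) = ((c div 2 ^ y + a) mod 2 ^ u) div 2 ^ (u - z)"
proof -
  have "((c + a * 2 ^ y) mod 2 ^ (y + u)) div 2 ^ (y + u - z) = ((c + a * 2 ^ y) div 2 ^ (y + (u - z))) mod 2 ^ z"
    using assms by (subst mod_pow2_div_pow2) auto
  also have "(c + a * 2 ^ y) div 2 ^ (y + (u - z)) = (c div 2 ^ y + a) div 2 ^ (u - z)"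
    by (simp add: power_add div_mult2_eq add.commute)
  finally show ?thesis using assms by (simp add: mod_pow2_div_pow2)
qed

text \<open>Writing \<open>\<delta> = 2 ^ y * e\<close> with \<open>e\<close> odd, the products \<open>a * \<delta>\<close> run evenly through the multiples of
  \<open>2 ^ y\<close>, and \<open>2 ^ y\<close> divides the length \<open>2 ^ (w - z)\<close> of the intervals on which the hash is constant.\<close>

lemma sum_hash_multiples:
  fixes f :: "nat \<Rightarrow> real"
  assumes "0 < \<delta>" "\<delta> * 2 ^ z \<le> 2 ^ w"
  shows "(\<Sum>a<2 ^ w. f (((c + a * \<delta>) mod 2 ^ w) div 2 ^ (w - z))) = 2 ^ (w - z) * (\<Sum>\<alpha><2 ^ z. f \<alpha>)"
proof -
  define y where "y = multiplicity 2 \<delta>"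
  obtain e where \<delta>: "\<delta> = 2 ^ y * e" and "odd e"
    unfolding y_def using multiplicity_decompose'[of \<delta> 2] assms(1) by auto
  have "(2::nat) ^ (y + z) \<le> \<delta> * 2 ^ z"
    using \<delta> assms(1) by (cases e) (auto simp: power_add)
  then have bits: "y + z \<le> w"
    using assms(2) by (meson le_trans one_less_numeral_iff power_le_imp_le_exp semiring_norm(76))
  define u where "u = w - y"
  have w: "w = y + u" and z_le: "z \<le> u" using bits by (auto simp: u_def)
  define g where "g x = f (((c + x * 2 ^ y) mod 2 ^ w) div 2 ^ (w - z))" for x
  have "(a * \<delta>) mod 2 ^ w = (((a * e) mod 2 ^ w) * 2 ^ y) mod 2 ^ w" for a
    unfolding mod_mult_left_eq by (simp add: \<delta> mult_ac)
  then have "(c + a * \<delta>) mod 2 ^ w = (c + ((a * e) mod 2 ^ w) * 2 ^ y) mod 2 ^ w" for a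
    by (rule mod_add_cong[OF refl])
  then have "(\<Sum>a<2 ^ w. f (((c + a * \<delta>) mod 2 ^ w) div 2 ^ (w - z))) = (\<Sum>a<2 ^ w. g ((a * e) mod 2 ^ w))"
    by (simp add: g_def)
  also have "\<dots> = (\<Sum>a<2 ^ w. g a)"
    using \<open>odd e\<close> by (rule sum_mod_odd)
  also have "\<dots> = (\<Sum>a<2 ^ y * 2 ^ u. f (((c div 2 ^ y + a) mod 2 ^ u) div 2 ^ (u - z)))"
    using high_bits_add_mult_pow2[OF z_le] by (simp add: g_def w power_add)
  also have "\<dots> = 2 ^ y * (\<Sum>a<2 ^ u. f (a div 2 ^ (u - z)))"
    using sum_mod_periodic[of "\<lambda>x. f (x div 2 ^ (u - z))" _ "2 ^ u" "2 ^ y"] by simp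
  also have "\<dots> = 2 ^ (w - z) * (\<Sum>\<alpha><2 ^ z. f \<alpha>)"
    using z_le by (simp add: sum_div_pow w flip: power_add)
  finally show ?thesis .
qed

lemma sum_hash_pair_less:
  assumes "y < x" "x * 2 ^ z \<le> 2 ^ w" "z \<le> w"
  shows "(\<Sum>a<2 ^ w. \<Sum>c<2 ^ w. f (hash w z a c x) (hash w z a c y)) =
    (2 ^ (w - z))\<^sup>2 * (\<Sum>\<alpha><2 ^ z. \<Sum>\<beta><2 ^ z. f \<alpha> \<beta> :: real)"
proof -
  define \<delta> where "\<delta> = x - y"
  have x: "x = y + \<delta>" using assms by (simp add: \<delta>_def)
  have \<delta>: "0 < \<delta>" "\<delta> * 2 ^ z \<le> 2 ^ w" using assms by (auto simp: \<delta>_def intro: le_trans[rotated])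
  define g where "g a u = f (((u + a * \<delta>) mod 2 ^ w) div 2 ^ (w - z)) (u div 2 ^ (w - z))" for a u
  have "(a * x + c) mod 2 ^ w = ((c + a * y) mod 2 ^ w + a * \<delta>) mod 2 ^ w" for a c
    unfolding x by (simp add: mod_simps algebra_simps)
  then have "(\<Sum>a<2 ^ w. \<Sum>c<2 ^ w. f (hash w z a c x) (hash w z a c y)) =
    (\<Sum>a<2 ^ w. \<Sum>c<2 ^ w. g a ((c + a * y) mod 2 ^ w))"
    by (simp add: hash_def g_def add.commute)
  also have "\<dots> = (\<Sum>a<2 ^ w. \<Sum>c<2 ^ w. g a c)"
    by (intro sum.cong refl sum_mod_shift) simp
  also have "\<dots> = (\<Sum>c<2 ^ w. \<Sum>a<2 ^ w. g a c)"
    by (rule sum.swap)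
  also have "\<dots> = (\<Sum>c<2 ^ w. 2 ^ (w - z) * (\<Sum>\<alpha><2 ^ z. f \<alpha> (c div 2 ^ (w - z))))"
    unfolding g_def using \<delta> by (intro sum.cong refl sum_hash_multiples)
  also have "\<dots> = 2 ^ (w - z) * (2 ^ (w - z) * (\<Sum>\<beta><2 ^ z. \<Sum>\<alpha><2 ^ z. f \<alpha> \<beta>))"
    using assms(3) by (simp add: sum_distrib_left[symmetric] sum_div_pow[of z w "\<lambda>b. \<Sum>\<alpha><2 ^ z. f \<alpha> b"])
  finally show ?thesis by (subst sum.swap) (simp add: power2_eq_square)
qed

lemma expect_2: "expect w 2 f = (\<Sum>a<2 ^ w. \<Sum>c<2 ^ w. f [a, c]) / (2 ^ w)\<^sup>2"
proof -
  have expect_Suc: "expect w (Suc n) f = (\<Sum>u<2 ^ w. expect w n (\<lambda>ws. f (u # ws))) / 2 ^ w" for n f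
    by (simp add: random_words_Suc expectation_bind_pmf_finite finite_random_words integral_pmf_of_set
        lessThan_atLeast0)
  show ?thesis
    by (simp add: expect_Suc numeral_2_eq_2 sum_divide_distrib power2_eq_square)
qed

lemma expect_hash_pair:
  assumes "x \<noteq> y" "x * 2 ^ z \<le> 2 ^ w" "y * 2 ^ z \<le> 2 ^ w" "z \<le> w"
  shows "expect w 2 (\<lambda>ws. f (hash w z (ws ! 0) (ws ! 1) x) (hash w z (ws ! 0) (ws ! 1) y)) =
    (\<Sum>\<alpha><2 ^ z. \<Sum>\<beta><2 ^ z. f \<alpha> \<beta>) / (2 ^ z)\<^sup>2"
proof -
  have "(\<Sum>a<2 ^ w. \<Sum>c<2 ^ w. f (hash w z a c x) (hash w z a c y)) =
    (2 ^ (w - z))\<^sup>2 * (\<Sum>\<alpha><2 ^ z. \<Sum>\<beta><2 ^ z. f \<alpha> \<beta>)"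
  proof (cases "y < x")
    case False
    then have "x < y" using assms(1) by simp
    from sum_hash_pair_less[OF this assms(3,4), of "\<lambda>a b. f b a"] show ?thesis
      using sum.swap[of f "{..<2 ^ z}" "{..<2 ^ z}"] by simp
  qed (use sum_hash_pair_less assms in auto)
  moreover have "((2::real) ^ w)\<^sup>2 = (2 ^ (w - z))\<^sup>2 * (2 ^ z)\<^sup>2"
    using assms(4) by (simp flip: power_mult_distrib power_add)
  ultimately show ?thesis by (simp add: expect_2)
qed

lemma expect_hash:
  fixes f :: "nat \<Rightarrow> real"
  assumes "z \<le> w"
  shows "expect w 2 (\<lambda>ws. f (hash w z (ws ! 0) (ws ! 1) x)) = (\<Sum>\<alpha><2 ^ z. f \<alpha>) / 2 ^ z"
proof -
  have "(\<Sum>c<2 ^ w. f (hash w z a c x)) = 2 ^ (w - z) * (\<Sum>\<alpha><2 ^ z. f \<alpha>)" for a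
    using sum_mod_shift[of "2 ^ w" "\<lambda>u. f (u div 2 ^ (w - z))" "a * x"] sum_div_pow[OF assms, of f]
    by (simp add: hash_def add.commute)
  moreover have "((2::real) ^ w) = 2 ^ (w - z) * 2 ^ z" using assms by (simp flip: power_add)
  ultimately show ?thesis by (simp add: expect_2 power2_eq_square)
qed

definition pass_prob :: "nat \<Rightarrow> nat \<Rightarrow> real" where
  "pass_prob z \<tau> = real (min \<tau> (2 ^ z)) / 2 ^ z"

lemma pass_prob_nonneg: "0 \<le> pass_prob z \<tau>"
  by (simp add: pass_prob_def)

lemma pass_prob_le_1: "pass_prob z \<tau> \<le> 1"
  by (simp add: pass_prob_def)

lemma sum_of_bool_less: "(\<Sum>\<alpha><2 ^ z. of_bool (\<alpha> < \<tau>)) = pass_prob z \<tau> * 2 ^ z"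
proof -
  have "{..<2 ^ z} \<inter> {\<alpha>. \<alpha> < \<tau>} = {..<min \<tau> (2 ^ z)}" by auto
  then show ?thesis by (simp add: of_bool_def sum.If_cases pass_prob_def)
qed

lemma expect_hash_less:
  assumes "z \<le> w"
  shows "expect w 2 (\<lambda>ws. of_bool (hash w z (ws ! 0) (ws ! 1) x < \<tau>)) = pass_prob z \<tau>"
  using expect_hash[OF assms, of "\<lambda>\<alpha>. of_bool (\<alpha> < \<tau>)" x] by (simp add: sum_of_bool_less)

lemma expect_hash_both_less:
  assumes "x * 2 ^ z \<le> 2 ^ w" "y * 2 ^ z \<le> 2 ^ w" "z \<le> w"
  shows "expect w 2 (\<lambda>ws. of_bool (hash w z (ws ! 0) (ws ! 1) x < \<tau>) *
      of_bool (hash w z (ws ! 0) (ws ! 1) y < \<tau>')) \<le>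
    of_bool (x = y) * pass_prob z (min \<tau> \<tau>') + pass_prob z \<tau> * pass_prob z \<tau>'"
proof (cases "x = y")
  case True
  have "(\<lambda>ws. of_bool (hash w z (ws ! 0) (ws ! 1) y < \<tau>) * of_bool (hash w z (ws ! 0) (ws ! 1) y < \<tau>')) =
    (\<lambda>ws. of_bool (hash w z (ws ! 0) (ws ! 1) y < min \<tau> \<tau>') :: real)" by auto
  with True show ?thesis
    using expect_hash_less[OF assms(3), of y "min \<tau> \<tau>'"] by (simp add: pass_prob_nonneg)
next
  case False
  have "expect w 2 (\<lambda>ws. of_bool (hash w z (ws ! 0) (ws ! 1) x < \<tau>) *
      of_bool (hash w z (ws ! 0) (ws ! 1) y < \<tau>')) =
    (\<Sum>\<alpha><2 ^ z. \<Sum>\<beta><2 ^ z. of_bool (\<alpha> < \<tau>) * of_bool (\<beta> < \<tau>')) / (2 ^ z)\<^sup>2"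
    by (rule expect_hash_pair[OF False assms, of "\<lambda>\<alpha> \<beta>. of_bool (\<alpha> < \<tau>) * of_bool (\<beta> < \<tau>')"])
  also have "\<dots> = pass_prob z \<tau> * pass_prob z \<tau>'"
    by (simp only: sum_product[symmetric] sum_of_bool_less) (simp add: power2_eq_square)
  finally show ?thesis using False by simp
qed

lemma expect_hash_eq_less:
  assumes "x * 2 ^ z \<le> 2 ^ w" "y * 2 ^ z \<le> 2 ^ w" "z \<le> w"
  shows "expect w 2 (\<lambda>ws. of_bool (hash w z (ws ! 0) (ws ! 1) x = hash w z (ws ! 0) (ws ! 1) y \<and>
      hash w z (ws ! 0) (ws ! 1) x < \<tau>)) \<le>
    of_bool (x = y) * pass_prob z \<tau> + pass_prob z \<tau> / 2 ^ z"
proof (cases "x = y")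
  case True
  then show ?thesis
    using expect_hash_less[OF assms(3), of y \<tau>] by (simp add: pass_prob_nonneg)
next
  case False
  have diagonal: "(\<Sum>\<beta><2 ^ z. of_bool (\<alpha> = \<beta> \<and> \<alpha> < \<tau>)) = (of_bool (\<alpha> < \<tau>) :: real)" if "\<alpha> < 2 ^ z" for \<alpha>
  proof -
    have "(\<Sum>\<beta><2 ^ z. of_bool (\<alpha> = \<beta> \<and> \<alpha> < \<tau>) :: real) = (\<Sum>\<beta><2 ^ z. if \<alpha> = \<beta> then of_bool (\<alpha> < \<tau>) else 0)"
      by (intro sum.cong) auto
    then show ?thesis using that by simp
  qed
  have "expect w 2 (\<lambda>ws. of_bool (hash w z (ws ! 0) (ws ! 1) x = hash w z (ws ! 0) (ws ! 1) y \<and>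
      hash w z (ws ! 0) (ws ! 1) x < \<tau>)) =
    (\<Sum>\<alpha><2 ^ z. \<Sum>\<beta><2 ^ z. of_bool (\<alpha> = \<beta> \<and> \<alpha> < \<tau>)) / (2 ^ z)\<^sup>2"
    by (rule expect_hash_pair[OF False assms, of "\<lambda>\<alpha> \<beta>. of_bool (\<alpha> = \<beta> \<and> \<alpha> < \<tau>)"])
  also have "(\<Sum>\<alpha><2 ^ z. \<Sum>\<beta><2 ^ z. of_bool (\<alpha> = \<beta> \<and> \<alpha> < \<tau>)) = (\<Sum>\<alpha><2 ^ z. of_bool (\<alpha> < \<tau>) :: real)"
    by (intro sum.cong refl diagonal) simp
  also have "\<dots> / (2 ^ z)\<^sup>2 = pass_prob z \<tau> / 2 ^ z"
    by (simp add: sum_of_bool_less power2_eq_square)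
  finally show ?thesis using False by simp
qed

subsection \<open>The branching process\<close>

text \<open>Levels are lists of identifiers with repetitions, one entry per path, so that expected lengths are
  computed exactly even when identifiers collide; \<open>coll\<close> counts pairs of paths with equal identifiers.\<close>

definition coll :: "'a list \<Rightarrow> 'a list \<Rightarrow> real" where
  "coll A B = (\<Sum>x\<leftarrow>A. \<Sum>y\<leftarrow>B. of_bool (x = y))"

definition keys :: "nat \<Rightarrow> nat list \<Rightarrow> nat list \<Rightarrow> nat list" where
  "keys z vs xs = concat (map (\<lambda>v. map (\<lambda>i. v * 2 ^ z + i) xs) vs)"

definition next_level :: "nat \<Rightarrow> nat \<Rightarrow> nat \<Rightarrow> nat list \<Rightarrow> nat \<Rightarrow> nat \<Rightarrow> nat list \<Rightarrow> nat list" where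
  "next_level w z \<tau> xs a c vs = filter (\<lambda>u. u < \<tau>) (map (hash w z a c) (keys z vs xs))"

fun grow :: "nat \<Rightarrow> nat \<Rightarrow> nat \<Rightarrow> nat list \<Rightarrow> nat list \<Rightarrow> nat list \<Rightarrow> nat list" where
  "grow w z \<tau> xs vs (a # c # ws) = grow w z \<tau> xs (next_level w z \<tau> xs a c vs) ws"
| "grow w z \<tau> xs vs _ = vs"

lemma sum_list_swap:
  "(\<Sum>x\<leftarrow>xs. \<Sum>y\<leftarrow>ys. f x y :: 'c :: comm_monoid_add) = (\<Sum>y\<leftarrow>ys. \<Sum>x\<leftarrow>xs. f x y)"
  by (induction xs) (auto simp: sum_list_addf)

lemma sum_list_concat: "(\<Sum>x\<leftarrow>concat xss. f x :: 'b :: monoid_add) = (\<Sum>xs\<leftarrow>xss. \<Sum>x\<leftarrow>xs. f x)"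
  by (induction xss) auto

lemma coll_conv_count_list: "coll A B = (\<Sum>x\<leftarrow>A. real (count_list B x))"
proof -
  have "(\<Sum>y\<leftarrow>B. of_bool (x = y)) = real (count_list B x)" for x
    by (induction B) auto
  then show ?thesis by (simp add: coll_def)
qed

lemma coll_nonneg: "0 \<le> coll A B"
  unfolding coll_conv_count_list by (rule sum_list_nonneg) auto

lemma coll_le: "coll A B \<le> real (length A) * real (length B)"
proof -
  have "coll A B \<le> (\<Sum>x\<leftarrow>A. real (length B))"
    unfolding coll_conv_count_list by (intro sum_list_mono) (simp add: count_le_length)
  then show ?thesis by (simp add: sum_list_triv)
qed

lemma coll_distinct: "distinct A \<Longrightarrow> distinct B \<Longrightarrow> coll A B = real (card (set A \<inter> set B))"
proof (induction A)
  case (Cons x A)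
  have "count_list B x = of_bool (x \<in> set B)"
    using Cons.prems(2) by (induction B) auto
  then show ?case using Cons by (auto simp: coll_conv_count_list Int_insert_left)
qed (simp add: coll_conv_count_list)

lemma coll_self_distinct: "distinct A \<Longrightarrow> coll A A = real (length A)"
  by (simp add: coll_distinct distinct_card)

lemma coll_singleton [simp]: "coll [x] [x] = 1"
  by (simp add: coll_def)

lemma length_keys [simp]: "length (keys z vs xs) = length vs * length xs"
  by (induction vs) (auto simp: keys_def)

lemma key_eq_iff:
  fixes i i' :: nat
  assumes "i < 2 ^ z" "i' < 2 ^ z"
  shows "v * 2 ^ z + i = v' * 2 ^ z + i' \<longleftrightarrow> v = v' \<and> i = i'"
proof
  assume eq: "v * 2 ^ z + i = v' * 2 ^ z + i'"
  from arg_cong[OF eq, of "\<lambda>x. x div 2 ^ z"] arg_cong[OF eq, of "\<lambda>x. x mod 2 ^ z"]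
  show "v = v' \<and> i = i'" using assms by simp
qed simp

lemma sum_list_keys: "(\<Sum>x\<leftarrow>keys z vs xs. f x :: real) = (\<Sum>v\<leftarrow>vs. \<Sum>i\<leftarrow>xs. f (v * 2 ^ z + i))"
  by (simp add: keys_def sum_list_concat o_def)

lemma coll_keys:
  assumes "set xs \<subseteq> {..<2 ^ z}" "set xs' \<subseteq> {..<2 ^ z}"
  shows "coll (keys z vs xs) (keys z vs' xs') = coll vs vs' * coll xs xs'"
proof -
  have inner: "(\<Sum>i\<leftarrow>xs. \<Sum>i'\<leftarrow>xs'. of_bool (v * 2 ^ z + i = v' * 2 ^ z + i')) =
    of_bool (v = v') * coll xs xs'" for v v'
  proof -
    have "(\<Sum>i\<leftarrow>xs. \<Sum>i'\<leftarrow>xs'. of_bool (v * 2 ^ z + i = v' * 2 ^ z + i') :: real) =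
      (\<Sum>i\<leftarrow>xs. \<Sum>i'\<leftarrow>xs'. of_bool (v = v') * of_bool (i = i'))"
      using assms by (intro arg_cong[where f = sum_list] map_cong refl) (subst key_eq_iff, auto)
    then show ?thesis by (simp add: coll_def sum_list_const_mult)
  qed
  have "coll (keys z vs xs) (keys z vs' xs') =
    (\<Sum>v\<leftarrow>vs. \<Sum>i\<leftarrow>xs. \<Sum>v'\<leftarrow>vs'. \<Sum>i'\<leftarrow>xs'. of_bool (v * 2 ^ z + i = v' * 2 ^ z + i'))"
    by (simp only: coll_def sum_list_keys)
  also have "\<dots> = (\<Sum>v\<leftarrow>vs. \<Sum>v'\<leftarrow>vs'. \<Sum>i\<leftarrow>xs. \<Sum>i'\<leftarrow>xs'. of_bool (v * 2 ^ z + i = v' * 2 ^ z + i'))"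
    by (subst sum_list_swap[of _ _ xs]) simp
  also have "\<dots> = coll vs vs' * coll xs xs'"
    by (simp add: inner coll_def[of vs vs'] sum_list_mult_const)
  finally show ?thesis .
qed

lemma key_mult_le:
  assumes "v < 2 ^ z" "i < 2 ^ z" "3 * z \<le> w"
  shows "(v * 2 ^ z + i) * 2 ^ z \<le> (2 ^ w :: nat)"
proof -
  have "v * 2 ^ z + i < (v + 1) * 2 ^ z" using assms by simp
  also have "\<dots> \<le> 2 ^ z * 2 ^ z" using assms by (intro mult_right_mono) auto
  finally have "(v * 2 ^ z + i) * 2 ^ z \<le> (2 ^ z * 2 ^ z) * 2 ^ z" by (intro mult_right_mono) auto
  also have "\<dots> = 2 ^ (3 * z)" by (simp flip: power_add)
  also have "\<dots> \<le> 2 ^ w" using assms(3) by (intro power_increasing) auto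
  finally show ?thesis .
qed

lemma set_keys_mult_le:
  assumes "set vs \<subseteq> {..<2 ^ z}" "set xs \<subseteq> {..<2 ^ z}" "3 * z \<le> w" "x \<in> set (keys z vs xs)"
  shows "x * 2 ^ z \<le> 2 ^ w"
  using assms by (auto simp: keys_def intro!: key_mult_le)

lemma set_next_level_less: "z \<le> w \<Longrightarrow> set (next_level w z \<tau> xs a c vs) \<subseteq> {..<2 ^ z}"
  by (auto simp: next_level_def hash_less)

lemma length_next_level:
  "real (length (next_level w z \<tau> xs a c vs)) = (\<Sum>x\<leftarrow>keys z vs xs. of_bool (hash w z a c x < \<tau>))"
proof -
  have "real (length (filter (\<lambda>u. u < \<tau>) (map h A))) = (\<Sum>x\<leftarrow>A. of_bool (h x < \<tau>))" for h :: "nat \<Rightarrow> nat" and A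
    by (induction A) auto
  then show ?thesis by (simp add: next_level_def)
qed

lemma coll_next_level:
  "coll (next_level w z \<tau> xs a c vs) (next_level w z \<tau>' xs' a c vs') =
    (\<Sum>x\<leftarrow>keys z vs xs. \<Sum>y\<leftarrow>keys z vs' xs'.
      of_bool (hash w z a c x = hash w z a c y \<and> hash w z a c x < min \<tau> \<tau>'))"
proof -
  have inner: "(\<Sum>y\<leftarrow>filter (\<lambda>u. u < \<tau>') (map h B). of_bool (u = y) :: real) =
    (\<Sum>y\<leftarrow>B. of_bool (u = h y \<and> u < \<tau>'))" for u and h :: "nat \<Rightarrow> nat" and B
    by (induction B) auto
  have "coll (filter (\<lambda>u. u < \<tau>) (map h A)) (filter (\<lambda>u. u < \<tau>') (map h B)) =
    (\<Sum>x\<leftarrow>A. \<Sum>y\<leftarrow>B. of_bool (h x = h y \<and> h x < min \<tau> \<tau>'))" for h :: "nat \<Rightarrow> nat" and A B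
    unfolding coll_def inner by (induction A) (auto simp: of_bool_def)
  then show ?thesis by (simp add: next_level_def)
qed

lemma sum_list_pairs:
  "(\<Sum>x\<leftarrow>A. \<Sum>y\<leftarrow>B. of_bool (x = y) * p + q) = coll A B * p + real (length A) * real (length B) * q"
proof -
  have "(\<Sum>y\<leftarrow>B. of_bool (x = y) * p + q) = (\<Sum>y\<leftarrow>B. of_bool (x = y)) * p + real (length B) * q" for x
    by (induction B) (auto simp: algebra_simps)
  then show ?thesis unfolding coll_def by (induction A) (auto simp: algebra_simps)
qed

lemma expect_length_next_level:
  assumes "z \<le> w"
  shows "expect w 2 (\<lambda>ws. real (length (next_level w z \<tau> xs (ws ! 0) (ws ! 1) vs))) =
    real (length xs) * pass_prob z \<tau> * real (length vs)"
  by (simp add: length_next_level integral_sum_list expect_hash_less[OF assms] sum_list_triv del: One_nat_def)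

lemma expect_length_next_level_pair:
  assumes "set vs \<subseteq> {..<2 ^ z}" "set vs' \<subseteq> {..<2 ^ z}" "set xs \<subseteq> {..<2 ^ z}" "set xs' \<subseteq> {..<2 ^ z}"
    and zw: "3 * z \<le> w"
  shows "expect w 2 (\<lambda>ws. real (length (next_level w z \<tau> xs (ws ! 0) (ws ! 1) vs)) *
      real (length (next_level w z \<tau>' xs' (ws ! 0) (ws ! 1) vs'))) \<le>
    (real (length xs) * pass_prob z \<tau>) * (real (length xs') * pass_prob z \<tau>') *
      (real (length vs) * real (length vs')) +
    (coll xs xs' * pass_prob z (min \<tau> \<tau>')) * coll vs vs'"
proof -
  have product: "(\<Sum>x\<leftarrow>A. f x) * (\<Sum>y\<leftarrow>B. g y) = (\<Sum>x\<leftarrow>A. \<Sum>y\<leftarrow>B. f x * g y :: real)"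
    for A B :: "nat list" and f g
    by (simp add: sum_list_const_mult sum_list_mult_const)
  have "expect w 2 (\<lambda>ws. real (length (next_level w z \<tau> xs (ws ! 0) (ws ! 1) vs)) *
      real (length (next_level w z \<tau>' xs' (ws ! 0) (ws ! 1) vs'))) =
    (\<Sum>x\<leftarrow>keys z vs xs. \<Sum>y\<leftarrow>keys z vs' xs'. expect w 2 (\<lambda>ws.
      of_bool (hash w z (ws ! 0) (ws ! 1) x < \<tau>) * of_bool (hash w z (ws ! 0) (ws ! 1) y < \<tau>')))"
    unfolding length_next_level product by (simp add: integral_sum_list)
  also have "\<dots> \<le> (\<Sum>x\<leftarrow>keys z vs xs. \<Sum>y\<leftarrow>keys z vs' xs'.
      of_bool (x = y) * pass_prob z (min \<tau> \<tau>') + pass_prob z \<tau> * pass_prob z \<tau>')"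
    using assms set_keys_mult_le[OF assms(1,3) zw] set_keys_mult_le[OF assms(2,4) zw]
    by (intro sum_list_mono expect_hash_both_less) auto
  finally show ?thesis using assms by (simp add: sum_list_pairs coll_keys mult_ac)
qed

lemma expect_coll_next_level:
  assumes "set vs \<subseteq> {..<2 ^ z}" "set vs' \<subseteq> {..<2 ^ z}" "set xs \<subseteq> {..<2 ^ z}" "set xs' \<subseteq> {..<2 ^ z}"
    and zw: "3 * z \<le> w"
  shows "expect w 2 (\<lambda>ws. coll (next_level w z \<tau> xs (ws ! 0) (ws ! 1) vs)
      (next_level w z \<tau>' xs' (ws ! 0) (ws ! 1) vs')) \<le>
    (coll xs xs' * pass_prob z (min \<tau> \<tau>')) * coll vs vs' +
    (real (length xs) * real (length xs') * pass_prob z (min \<tau> \<tau>') / 2 ^ z) *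
      (real (length vs) * real (length vs'))"
proof -
  have "expect w 2 (\<lambda>ws. coll (next_level w z \<tau> xs (ws ! 0) (ws ! 1) vs)
      (next_level w z \<tau>' xs' (ws ! 0) (ws ! 1) vs')) =
    (\<Sum>x\<leftarrow>keys z vs xs. \<Sum>y\<leftarrow>keys z vs' xs'. expect w 2 (\<lambda>ws.
      of_bool (hash w z (ws ! 0) (ws ! 1) x = hash w z (ws ! 0) (ws ! 1) y \<and>
        hash w z (ws ! 0) (ws ! 1) x < min \<tau> \<tau>')))"
    unfolding coll_next_level by (simp add: integral_sum_list)
  also have "\<dots> \<le> (\<Sum>x\<leftarrow>keys z vs xs. \<Sum>y\<leftarrow>keys z vs' xs'.
      of_bool (x = y) * pass_prob z (min \<tau> \<tau>') + pass_prob z (min \<tau> \<tau>') / 2 ^ z)"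
    using assms set_keys_mult_le[OF assms(1,3) zw] set_keys_mult_le[OF assms(2,4) zw]
    by (intro sum_list_mono expect_hash_eq_less) auto
  also have "\<dots> = coll vs vs' * coll xs xs' * pass_prob z (min \<tau> \<tau>') +
      (real (length vs) * real (length xs)) * (real (length vs') * real (length xs')) *
        (pass_prob z (min \<tau> \<tau>') / 2 ^ z)"
    using assms by (simp only: sum_list_pairs coll_keys) simp
  finally show ?thesis by (simp add: mult_ac)
qed

lemma expect_grow_Suc:
  "expect w (2 * Suc k) (\<lambda>ws. f (grow w z \<tau> xs vs ws) (grow w z \<tau>' xs' vs' ws)) =
    expect w 2 (\<lambda>h. expect w (2 * k) (\<lambda>ws. f (grow w z \<tau> xs (next_level w z \<tau> xs (h ! 0) (h ! 1) vs) ws)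
      (grow w z \<tau>' xs' (next_level w z \<tau>' xs' (h ! 0) (h ! 1) vs') ws)))"
proof -
  have two_words: "\<exists>a c. h = [a, c]" if "length h = 2" for h :: "nat list"
    using that by (auto simp: length_Suc_conv numeral_2_eq_2)
  have "expect w (2 + 2 * k) (\<lambda>ws. f (grow w z \<tau> xs vs ws) (grow w z \<tau>' xs' vs' ws)) =
    expect w 2 (\<lambda>h. expect w (2 * k) (\<lambda>ws. f (grow w z \<tau> xs vs (h @ ws)) (grow w z \<tau>' xs' vs' (h @ ws))))"
    by (rule expect_append)
  also have "\<dots> =
      expect w 2 (\<lambda>h. expect w (2 * k) (\<lambda>ws. f (grow w z \<tau> xs (next_level w z \<tau> xs (h ! 0) (h ! 1) vs) ws)
      (grow w z \<tau>' xs' (next_level w z \<tau>' xs' (h ! 0) (h ! 1) vs') ws)))"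
    by (intro expect_cong) (auto dest!: two_words)
  finally show ?thesis by simp
qed

lemma expect_length_grow:
  assumes "z \<le> w"
  shows "expect w (2 * k) (\<lambda>ws. real (length (grow w z \<tau> xs vs ws))) =
    (real (length xs) * pass_prob z \<tau>) ^ k * real (length vs)"
proof (induction k arbitrary: vs)
  case (Suc k)
  show ?case
    unfolding expect_grow_Suc[where f = "\<lambda>a b. real (length a)"] Suc.IH
    by (simp add: expect_length_next_level[OF assms] mult_ac del: One_nat_def)
qed simp

lemma second_moment_recurrence:
  fixes \<mu> \<epsilon> N C :: real
  assumes "1 \<le> \<mu>" "0 \<le> \<epsilon>" "\<epsilon> * (real k)\<^sup>2 \<le> 1" "0 \<le> N" "0 \<le> C"
  shows "(1 + \<epsilon> * (real k)\<^sup>2) * (\<mu>\<^sup>2 * N + \<mu> * C) + 2 * real k * (\<mu> * C + \<mu>\<^sup>2 * \<epsilon> * N) \<le>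
    \<mu>\<^sup>2 * ((1 + \<epsilon> * (real (Suc k))\<^sup>2) * N + 2 * real (Suc k) * C)"
proof -
  have "\<mu> * C \<le> \<mu>\<^sup>2 * C" using assms by (intro mult_right_mono) (auto simp: power2_eq_square)
  then have "(1 + \<epsilon> * (real k)\<^sup>2) * (\<mu>\<^sup>2 * N + \<mu> * C) + 2 * real k * (\<mu> * C + \<mu>\<^sup>2 * \<epsilon> * N) \<le>
    (1 + \<epsilon> * (real k)\<^sup>2) * (\<mu>\<^sup>2 * N + \<mu>\<^sup>2 * C) + 2 * real k * (\<mu>\<^sup>2 * C + \<mu>\<^sup>2 * \<epsilon> * N)"
    using assms by (intro add_mono mult_left_mono) auto
  also have "\<dots> = \<mu>\<^sup>2 * ((1 + \<epsilon> * (real k)\<^sup>2 + 2 * real k * \<epsilon>) * N + (1 + \<epsilon> * (real k)\<^sup>2 + 2 * real k) * C)"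
    by (simp add: algebra_simps)
  also have "\<dots> \<le> \<mu>\<^sup>2 * ((1 + \<epsilon> * (real (Suc k))\<^sup>2) * N + 2 * real (Suc k) * C)"
    using assms by (intro mult_left_mono[OF add_mono[OF mult_right_mono mult_right_mono]])
      (auto simp: power2_eq_square algebra_simps)
  finally show ?thesis .
qed

lemma expect_length_grow_squared:
  assumes "set vs \<subseteq> {..<2 ^ z}" and xs: "set xs \<subseteq> {..<2 ^ z}" "distinct xs" and zw: "3 * z \<le> w"
    and \<mu>: "\<mu> = real (length xs) * pass_prob z \<tau>" "\<mu> \<ge> 1"
    and \<epsilon>: "\<epsilon> \<ge> 0" "real (length xs) * real (length xs) * pass_prob z \<tau> / 2 ^ z \<le> \<mu>\<^sup>2 * \<epsilon>" "\<epsilon> * (real k)\<^sup>2 \<le> 1"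
  shows "expect w (2 * k) (\<lambda>ws. (real (length (grow w z \<tau> xs vs ws)))\<^sup>2) \<le>
    \<mu> ^ (2 * k) * ((1 + \<epsilon> * (real k)\<^sup>2) * (real (length vs))\<^sup>2 + 2 * real k * coll vs vs)"
  using assms(1) \<epsilon>(3)
proof (induction k arbitrary: vs)
  case (Suc k)
  have "\<epsilon> * (real k)\<^sup>2 \<le> \<epsilon> * (real (Suc k))\<^sup>2" using \<epsilon>(1) by (intro mult_left_mono power_mono) auto
  then have \<epsilon>k: "\<epsilon> * (real k)\<^sup>2 \<le> 1" using Suc.prems by linarith
  let ?next = "\<lambda>h. next_level w z \<tau> xs (h ! 0) (h ! 1) vs"
  define N where "N = (\<lambda>h. (real (length (?next h)))\<^sup>2)"
  define C where "C = (\<lambda>h. coll (?next h) (?next h))"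
  have expect_N: "expect w 2 N \<le> \<mu>\<^sup>2 * (real (length vs))\<^sup>2 + \<mu> * coll vs vs"
    using expect_length_next_level_pair[OF Suc.prems(1,1) xs(1,1) zw, of \<tau> \<tau>]
    by (simp add: N_def \<mu>(1) coll_self_distinct[OF xs(2)] power2_eq_square)
  have "expect w 2 C \<le>
      \<mu> * coll vs vs + (real (length xs) * real (length xs) * pass_prob z \<tau> / 2 ^ z) * (real (length vs))\<^sup>2"
    using expect_coll_next_level[OF Suc.prems(1,1) xs(1,1) zw, of \<tau> \<tau>]
    by (simp add: C_def \<mu>(1) coll_self_distinct[OF xs(2)] power2_eq_square)
  also have "\<dots> \<le> \<mu> * coll vs vs + \<mu>\<^sup>2 * \<epsilon> * (real (length vs))\<^sup>2"
    using \<epsilon>(2) by (intro add_left_mono mult_right_mono) auto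
  finally have expect_C: "expect w 2 C \<le> \<mu> * coll vs vs + \<mu>\<^sup>2 * \<epsilon> * (real (length vs))\<^sup>2" .
  have "expect w (2 * Suc k) (\<lambda>ws. (real (length (grow w z \<tau> xs vs ws)))\<^sup>2) \<le>
    expect w 2 (\<lambda>h. \<mu> ^ (2 * k) * ((1 + \<epsilon> * (real k)\<^sup>2) * N h + 2 * real k * C h))"
    unfolding expect_grow_Suc[where f = "\<lambda>a b. (real (length a))\<^sup>2"] N_def C_def
    using zw by (intro expect_mono Suc.IH set_next_level_less \<epsilon>k) auto
  also have "\<dots> = \<mu> ^ (2 * k) * ((1 + \<epsilon> * (real k)\<^sup>2) * expect w 2 N + 2 * real k * expect w 2 C)"
    by simp
  also have "\<dots> \<le> \<mu> ^ (2 * k) * ((1 + \<epsilon> * (real k)\<^sup>2) * (\<mu>\<^sup>2 * (real (length vs))\<^sup>2 + \<mu> * coll vs vs) +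
      2 * real k * (\<mu> * coll vs vs + \<mu>\<^sup>2 * \<epsilon> * (real (length vs))\<^sup>2))"
    using expect_N expect_C \<mu>(2) \<epsilon>(1) by (intro mult_left_mono add_mono) auto
  also have "\<dots> \<le>
      \<mu> ^ (2 * k) * (\<mu>\<^sup>2 * ((1 + \<epsilon> * (real (Suc k))\<^sup>2) * (real (length vs))\<^sup>2 + 2 * real (Suc k) * coll vs vs))"
    using \<mu>(2) \<epsilon>(1) \<epsilon>k by (intro mult_left_mono second_moment_recurrence) (auto simp: coll_nonneg)
  finally show ?case by (simp add: power2_eq_square mult_ac)
qed simp

lemma grow_survives:
  assumes xs: "set xs \<subseteq> {..<2 ^ z}" "distinct xs" "3 * z \<le> w"
    and mean: "real (length xs) * pass_prob z \<tau> \<ge> 1"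
    and \<epsilon>: "\<epsilon> \<ge> 0" "1 \<le> pass_prob z \<tau> * 2 ^ z * \<epsilon>" "\<epsilon> * (real k)\<^sup>2 \<le> 1"
  shows "1 / (2 * real k + 2) \<le> expect w (2 * k) (\<lambda>ws. of_bool (grow w z \<tau> xs [0] ws \<noteq> []))"
proof -
  define \<mu> where "\<mu> = real (length xs) * pass_prob z \<tau>"
  define N where "N = (\<lambda>ws. real (length (grow w z \<tau> xs [0] ws)))"
  have "(real (length xs))\<^sup>2 * pass_prob z \<tau> * 1 / 2 ^ z \<le>
    (real (length xs))\<^sup>2 * pass_prob z \<tau> * (pass_prob z \<tau> * 2 ^ z * \<epsilon>) / 2 ^ z"
    using \<epsilon> by (intro divide_right_mono mult_left_mono) (auto simp: pass_prob_nonneg)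
  then have "real (length xs) * real (length xs) * pass_prob z \<tau> / 2 ^ z \<le> \<mu>\<^sup>2 * \<epsilon>"
    by (simp add: \<mu>_def power2_eq_square mult_ac)
  then have "expect w (2 * k) (\<lambda>ws. (N ws)\<^sup>2) \<le>
    \<mu> ^ (2 * k) * ((1 + \<epsilon> * (real k)\<^sup>2) * (real (length [0::nat]))\<^sup>2 + 2 * real k * coll [0::nat] [0])"
    unfolding N_def using xs mean \<epsilon> by (intro expect_length_grow_squared) (auto simp: \<mu>_def)
  also have "\<dots> \<le> \<mu> ^ (2 * k) * (2 * real k + 2)"
    using \<epsilon> mean by (intro mult_left_mono) (auto simp: \<mu>_def)
  finally have "expect w (2 * k) (\<lambda>ws. (N ws)\<^sup>2) \<le> (2 * real k + 2) * (\<mu> ^ k)\<^sup>2"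
    by (simp add: power_mult power2_eq_square mult_ac power_mult_distrib)
  moreover have "expect w (2 * k) N = \<mu> ^ k"
    using xs(3) by (simp add: N_def expect_length_grow \<mu>_def)
  ultimately have "1 / (2 * real k + 2) \<le> expect w (2 * k) (\<lambda>ws. of_bool (N ws \<noteq> 0))"
    using mean by (intro measure_pmf.second_moment_method[where m = "\<mu> ^ k"]) (auto simp: \<mu>_def)
  then show ?thesis by (simp add: N_def)
qed

lemma expect_coll_grow:
  assumes "set vs \<subseteq> {..<2 ^ z}" "set vs' \<subseteq> {..<2 ^ z}"
    and xs: "set xs \<subseteq> {..<2 ^ z}" "set xs' \<subseteq> {..<2 ^ z}" and zw: "3 * z \<le> w"
    and \<eta>: "coll xs xs' * pass_prob z (min \<tau> \<tau>') \<le> \<eta>"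
    and D: "real (length xs) * real (length xs') * pass_prob z (min \<tau> \<tau>') / 2 ^ z \<le> D"
    and \<Gamma>: "(real (length xs) * pass_prob z \<tau>) * (real (length xs') * pass_prob z \<tau>') + \<eta> \<le> \<Gamma>" "1 \<le> \<Gamma>" "\<eta> \<le> \<Gamma>"
  shows "expect w (2 * k) (\<lambda>ws. coll (grow w z \<tau> xs vs ws) (grow w z \<tau>' xs' vs' ws)) \<le>
    \<eta> ^ k * coll vs vs' + real k * \<Gamma> ^ k * D * (real (length vs) * real (length vs'))"
  using assms(1,2)
proof (induction k arbitrary: vs vs')
  case (Suc k)
  have \<eta>_nonneg: "0 \<le> \<eta>" by (rule order_trans[OF _ \<eta>]) (simp add: coll_nonneg pass_prob_nonneg)
  have D_nonneg: "0 \<le> D" by (rule order_trans[OF _ D]) (simp add: pass_prob_nonneg)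
  let ?next = "\<lambda>h. next_level w z \<tau> xs (h ! 0) (h ! 1) vs"
  let ?next' = "\<lambda>h. next_level w z \<tau>' xs' (h ! 0) (h ! 1) vs'"
  define size_next where "size_next = (\<lambda>h. real (length (?next h)) * real (length (?next' h)))"
  define coll_next where "coll_next = (\<lambda>h. coll (?next h) (?next' h))"
  define size0 coll0 where "size0 = real (length vs) * real (length vs')" and "coll0 = coll vs vs'"
  have size0: "0 \<le> size0" and coll0: "0 \<le> coll0" "coll0 \<le> size0"
    by (auto simp: size0_def coll0_def coll_nonneg coll_le)
  have "expect w 2 size_next \<le> (real (length xs) * pass_prob z \<tau>) * (real (length xs') * pass_prob z \<tau>') * size0 +
    (coll xs xs' * pass_prob z (min \<tau> \<tau>')) * coll0"
    unfolding size_next_def size0_def coll0_def by (intro expect_length_next_level_pair Suc.prems xs zw)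
  also have "\<dots> \<le> (real (length xs) * pass_prob z \<tau>) * (real (length xs') * pass_prob z \<tau>') * size0 + \<eta> * size0"
    using \<eta> coll0 \<eta>_nonneg by (intro add_left_mono mult_mono) auto
  also have "\<dots> \<le> \<Gamma> * size0"
    using \<Gamma> size0 by (simp only: distrib_right[symmetric]) (intro mult_right_mono, auto)
  finally have expect_size: "expect w 2 size_next \<le> \<Gamma> * size0" .
  have "expect w 2 coll_next \<le> (coll xs xs' * pass_prob z (min \<tau> \<tau>')) * coll0 +
    (real (length xs) * real (length xs') * pass_prob z (min \<tau> \<tau>') / 2 ^ z) * size0"
    unfolding coll_next_def size0_def coll0_def by (intro expect_coll_next_level Suc.prems xs zw)
  also have "\<dots> \<le> \<eta> * coll0 + D * size0" using \<eta> D size0 coll0 by (intro add_mono mult_right_mono)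
  finally have expect_coll: "expect w 2 coll_next \<le> \<eta> * coll0 + D * size0" .
  have "expect w (2 * Suc k) (\<lambda>ws. coll (grow w z \<tau> xs vs ws) (grow w z \<tau>' xs' vs' ws)) \<le>
    expect w 2 (\<lambda>h. \<eta> ^ k * coll_next h + real k * \<Gamma> ^ k * D * size_next h)"
    unfolding expect_grow_Suc[where f = coll] size_next_def coll_next_def
    using zw by (intro expect_mono Suc.IH set_next_level_less) auto
  also have "\<dots> \<le> \<eta> ^ k * (\<eta> * coll0 + D * size0) + real k * \<Gamma> ^ k * D * (\<Gamma> * size0)"
    using expect_size expect_coll \<eta>_nonneg D_nonneg \<Gamma> by (simp, intro add_mono mult_left_mono) auto
  also have "\<dots> = \<eta> ^ Suc k * coll0 + (\<eta> ^ k * D * size0 + real k * \<Gamma> ^ Suc k * D * size0)"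
    by (simp add: algebra_simps)
  also have "\<eta> ^ k * D * size0 \<le> \<Gamma> ^ Suc k * D * size0"
    using power_mono[OF \<Gamma>(3) \<eta>_nonneg, of k] power_increasing[OF le_SucI[OF le_refl] \<Gamma>(2), of k] D_nonneg size0
    by (intro mult_right_mono) linarith+
  finally show ?case by (simp add: size0_def coll0_def algebra_simps)
qed simp

lemma set_grow_mono:
  assumes "set xs \<subseteq> set xs'" "\<tau> \<le> \<tau>'" "set vs \<subseteq> set vs'"
  shows "set (grow w z \<tau> xs vs ws) \<subseteq> set (grow w z \<tau>' xs' vs' ws)"
  using assms
proof (induction w z \<tau> xs vs ws arbitrary: vs' rule: grow.induct)
  case (1 w z \<tau> xs vs a c ws)
  have "set (next_level w z \<tau> xs a c vs) \<subseteq> set (next_level w z \<tau>' xs' a c vs')"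
    using 1(2-4) by (fastforce simp: next_level_def keys_def)
  then show ?case using 1 by simp
qed auto

subsection \<open>A program logic with running times\<close>

definition exec :: "nat \<Rightarrow> nat list \<Rightarrow> com \<Rightarrow> store \<Rightarrow> nat \<Rightarrow> store \<Rightarrow> bool" where
  "exec w inp c s t s' \<longleftrightarrow> (\<forall>k. run w inp t (c # k, s) = return_pmf (k, s'))"

definition wp :: "nat \<Rightarrow> nat list \<Rightarrow> com \<Rightarrow> (nat \<Rightarrow> store \<Rightarrow> bool) \<Rightarrow> store \<Rightarrow> bool" where
  "wp w inp c Q s \<longleftrightarrow> (\<exists>t s'. exec w inp c s t s' \<and> Q t s')"

definition modifies :: "nat set \<Rightarrow> nat set \<Rightarrow> store \<Rightarrow> store \<Rightarrow> bool" where
  "modifies R A s s' \<longleftrightarrow> (\<forall>r. r \<notin> R \<longrightarrow> regs s' r = regs s r) \<and> (\<forall>a. a \<notin> A \<longrightarrow> mem s' a = mem s a)"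

lemma modifies_refl [simp]: "modifies R A s s"
  by (simp add: modifies_def)

lemma modifies_trans:
  "modifies R A s s' \<Longrightarrow> modifies R' A' s' s'' \<Longrightarrow> R \<union> R' \<subseteq> R'' \<Longrightarrow> A \<union> A' \<subseteq> A'' \<Longrightarrow> modifies R'' A'' s s''"
  unfolding modifies_def by (metis UnCI subsetD)

lemma modifies_regs: "modifies R A s s' \<Longrightarrow> r \<notin> R \<Longrightarrow> regs s' r = regs s r"
  by (simp add: modifies_def)

lemma modifies_mem_empty: "modifies R {} s s' \<Longrightarrow> mem s' = mem s"
  by (auto simp: modifies_def)

lemma modifies_update_regs [simp]:
  "\<forall>r. r \<notin> R \<longrightarrow> f r = regs s' r \<Longrightarrow> modifies R A s (s'\<lparr>regs := f\<rparr>) = modifies R A s s'"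
  by (simp add: modifies_def)

lemma run_add: "run w inp (t + t') cfg = bind_pmf (run w inp t cfg) (run w inp t')"
proof (induction t arbitrary: cfg)
  case (Suc t)
  have "run w inp (t + t') = (\<lambda>x. bind_pmf (run w inp t x) (run w inp t'))"
    using Suc by blast
  then show ?case by (simp add: bind_assoc_pmf)
qed (simp add: bind_return_pmf)

lemma run_halted: "run w inp t ([], s) = return_pmf ([], s)"
  by (induction t) (simp_all add: bind_return_pmf)

lemma run_halted_le:
  assumes "run w inp t cfg = return_pmf ([], s)" "t \<le> T"
  shows "run w inp T cfg = return_pmf ([], s)"
  using run_add[of w inp t "T - t" cfg] assms by (simp add: bind_return_pmf run_halted)

lemma wp_conseq:
  assumes "wp w inp c Q s" "\<And>t s'. Q t s' \<Longrightarrow> Q' t s'"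
  shows "wp w inp c Q' s"
  using assms unfolding wp_def by blast

lemma wp_assign: "Q 1 (s\<lparr>regs := (regs s)(r := eval w inp s e)\<rparr>) \<Longrightarrow> wp w inp (Assign r e) Q s"
  unfolding wp_def exec_def by (intro exI conjI, rule allI) (auto simp: bind_return_pmf)

lemma wp_store: "Q 1 (s\<lparr>mem := (mem s)(eval w inp s e1 := eval w inp s e2)\<rparr>) \<Longrightarrow> wp w inp (Store e1 e2) Q s"
  unfolding wp_def exec_def by (intro exI conjI, rule allI) (auto simp: bind_return_pmf)

lemma exec_Suc:
  assumes "\<And>k. step w inp (c # k, s) = return_pmf (c1 # k, s)" "exec w inp c1 s t s'"
  shows "exec w inp c s (Suc t) s'"
  using assms by (simp add: exec_def bind_return_pmf)

lemma wp_seq: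
  assumes "wp w inp c1 (\<lambda>t1 s1. wp w inp c2 (\<lambda>t2 s2. Q (Suc (t1 + t2)) s2) s1) s"
  shows "wp w inp (Seq c1 c2) Q s"
proof -
  obtain t1 s1 t2 s2 where c1: "exec w inp c1 s t1 s1" and c2: "exec w inp c2 s1 t2 s2"
    and Q: "Q (Suc (t1 + t2)) s2"
    using assms unfolding wp_def by blast
  from c1 c2 have "exec w inp (Seq c1 c2) s (Suc (t1 + t2)) s2"
    by (simp add: exec_def bind_return_pmf run_add)
  with Q show ?thesis unfolding wp_def by blast
qed

lemma wp_seq_assign:
  assumes "eval w inp s e = v" "s' = s\<lparr>regs := (regs s)(r := v)\<rparr>" "wp w inp c (\<lambda>T. Q (Suc (1 + T))) s'"
  shows "wp w inp (Seq (Assign r e) c) Q s"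
  using assms by (intro wp_seq wp_assign) simp

lemma wp_if:
  assumes "eval w inp s e \<noteq> 0 \<Longrightarrow> wp w inp c1 (\<lambda>t. Q (Suc t)) s"
    and "eval w inp s e = 0 \<Longrightarrow> wp w inp c2 (\<lambda>t. Q (Suc t)) s"
  shows "wp w inp (If e c1 c2) Q s"
proof (cases "eval w inp s e = 0")
  case True
  then obtain t s' where "exec w inp c2 s t s'" "Q (Suc t) s'" using assms unfolding wp_def by blast
  moreover from this True have "exec w inp (If e c1 c2) s (Suc t) s'" by (intro exec_Suc) auto
  ultimately show ?thesis unfolding wp_def by blast
next
  case False
  then obtain t s' where "exec w inp c1 s t s'" "Q (Suc t) s'" using assms unfolding wp_def by blast
  moreover from this False have "exec w inp (If e c1 c2) s (Suc t) s'" by (intro exec_Suc) auto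
  ultimately show ?thesis unfolding wp_def by blast
qed

lemma wp_while_elapsed:
  fixes V :: "store \<Rightarrow> nat"
  assumes init: "I 0 s"
    and step: "\<And>t s. I t s \<Longrightarrow> eval w inp s e \<noteq> 0 \<Longrightarrow> wp w inp c (\<lambda>t' s'. I (t + Suc t') s' \<and> V s' < V s) s"
    and post: "\<And>t s'. I t s' \<Longrightarrow> eval w inp s' e = 0 \<Longrightarrow> Q (Suc t) s'"
  shows "wp w inp (While e c) Q s"
proof -
  have "\<exists>t' s'. exec w inp (While e c) s (Suc t') s' \<and> I (t + t') s' \<and> eval w inp s' e = 0" if "I t s" for t s
    using that
  proof (induction "V s" arbitrary: t s rule: less_induct)
    case less
    show ?case
    proof (cases "eval w inp s e = 0")
      case True
      then have "exec w inp (While e c) s (Suc 0) s" by (simp add: exec_def bind_return_pmf)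
      then show ?thesis using True less.prems by (intro exI[of _ 0] exI[of _ s]) simp
    next
      case False
      obtain t1 s1 where body: "exec w inp c s t1 s1" "I (t + Suc t1) s1" "V s1 < V s"
        using step[OF less.prems False] unfolding wp_def by blast
      obtain t2 s2 where rest: "exec w inp (While e c) s1 (Suc t2) s2" "I (t + Suc t1 + t2) s2"
        "eval w inp s2 e = 0"
        using less.hyps[OF body(3,2)] by blast
      have "exec w inp (While e c) s (Suc (t1 + Suc t2)) s2"
        using body(1) rest(1) False unfolding exec_def
        by (simp only: run.simps step.simps bind_return_pmf run_add if_True simp_thms)
      then show ?thesis using rest by (intro exI[of _ "t1 + Suc t2"] exI[of _ s2]) (simp add: add.assoc)
    qed
  qed
  from this[OF init] show ?thesis using post unfolding wp_def by fastforce
qed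

text \<open>The variant \<open>V\<close> is a potential: it pays for the running time of the remaining iterations.\<close>

lemma wp_while:
  fixes V :: "store \<Rightarrow> nat"
  assumes "I s"
    and "\<And>s. I s \<Longrightarrow> eval w inp s e \<noteq> 0 \<Longrightarrow> wp w inp c (\<lambda>t s'. I s' \<and> Suc t + V s' \<le> V s) s"
    and "\<And>t s'. I s' \<Longrightarrow> eval w inp s' e = 0 \<Longrightarrow> t + V s' \<le> Suc (V s) \<Longrightarrow> Q t s'"
  shows "wp w inp (While e c) Q s"
proof (rule wp_while_elapsed[where I = "\<lambda>t s'. I s' \<and> t + V s' \<le> V s" and V = V])
  show "wp w inp c (\<lambda>t' s2. (I s2 \<and> t + Suc t' + V s2 \<le> V s) \<and> V s2 < V s1) s1"
    if "I s1 \<and> t + V s1 \<le> V s" "eval w inp s1 e \<noteq> 0" for t s1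
    by (rule wp_conseq[OF assms(2)]) (use that in auto)
qed (use assms in auto)

lemma wp_while_measure:
  fixes V :: "store \<Rightarrow> nat"
  assumes "I s"
    and "\<And>s. I s \<Longrightarrow> eval w inp s e \<noteq> 0 \<Longrightarrow> wp w inp c (\<lambda>t s'. I s' \<and> V s' < V s) s"
    and "\<And>t s'. I s' \<Longrightarrow> eval w inp s' e = 0 \<Longrightarrow> Q t s'"
  shows "wp w inp (While e c) Q s"
  by (rule wp_while_elapsed[where I = "\<lambda>_. I" and V = V]) (use assms in auto)

lemma wp_run:
  assumes "wp w inp c (\<lambda>t s'. t \<le> T \<and> Q s') s"
  shows "\<exists>s'. run w inp T ([c], s) = return_pmf ([], s') \<and> Q s'"
  using assms run_halted_le unfolding wp_def exec_def by blast

notation Seq (infixr ";;" 55)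
notation Assign ("_ ::= _" [61, 61] 60)

abbreviation plus_exp (infixl "+\<^sub>e" 65) where "a +\<^sub>e b \<equiv> Bin Plus a b"
abbreviation minus_exp (infixl "-\<^sub>e" 65) where "a -\<^sub>e b \<equiv> Bin Minus a b"
abbreviation times_exp (infixl "*\<^sub>e" 70) where "a *\<^sub>e b \<equiv> Bin Times a b"
abbreviation div_exp (infixl "div\<^sub>e" 70) where "a div\<^sub>e b \<equiv> Bin Div a b"
abbreviation mod_exp (infixl "mod\<^sub>e" 70) where "a mod\<^sub>e b \<equiv> Bin Mod a b"
abbreviation less_exp (infix "<\<^sub>e" 50) where "a <\<^sub>e b \<equiv> Bin Less a b"
abbreviation eq_exp (infix "=\<^sub>e" 50) where "a =\<^sub>e b \<equiv> Bin Equal a b"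
abbreviation and_exp (infixr "\<and>\<^sub>e" 35) where "a \<and>\<^sub>e b \<equiv> Bin And a b"

lemma and_of_bool_nat [simp]: "semiring_bit_operations_class.and (of_bool a) (of_bool b :: nat) = of_bool (a \<and> b)"
  by (cases a; cases b) simp_all

subsection \<open>Registers\<close>

text \<open>The parameters of the data structure live in registers 1 to 13 and are also stored at the memory
  addresses 1 to 13.\<close>

abbreviation (input) "r_result \<equiv> 0 :: nat"
abbreviation (input) "r_scale \<equiv> 1 :: nat"
abbreviation (input) "r_divisor \<equiv> 2 :: nat"
abbreviation (input) "r_B1 \<equiv> 3 :: nat"
abbreviation (input) "r_B2 \<equiv> 4 :: nat"
abbreviation (input) "r_depth \<equiv> 5 :: nat"
abbreviation (input) "r_cap \<equiv> 6 :: nat"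
abbreviation (input) "r_buckets \<equiv> 7 :: nat"
abbreviation (input) "r_reps \<equiv> 8 :: nat"
abbreviation (input) "r_n \<equiv> 9 :: nat"
abbreviation (input) "r_queue \<equiv> 10 :: nat"
abbreviation (input) "r_heads \<equiv> 11 :: nat"
abbreviation (input) "r_entries \<equiv> 12 :: nat"
abbreviation (input) "r_sets \<equiv> 13 :: nat"
abbreviation (input) "r_dest \<equiv> 14 :: nat"
abbreviation (input) "r_word \<equiv> 15 :: nat"
abbreviation (input) "r_pos \<equiv> 16 :: nat"
abbreviation (input) "r_set \<equiv> 17 :: nat"
abbreviation (input) "r_last \<equiv> 18 :: nat"
abbreviation (input) "r_size \<equiv> 20 :: nat"
abbreviation (input) "r_elems \<equiv> 21 :: nat"
abbreviation (input) "r_threshold \<equiv> 22 :: nat"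
abbreviation (input) "r_len \<equiv> 23 :: nat"
abbreviation (input) "r_node \<equiv> 24 :: nat"
abbreviation (input) "r_tag \<equiv> 25 :: nat"
abbreviation (input) "r_id \<equiv> 26 :: nat"
abbreviation (input) "r_i \<equiv> 27 :: nat"
abbreviation (input) "r_hash \<equiv> 28 :: nat"
abbreviation (input) "r_void \<equiv> 29 :: nat"
abbreviation (input) "r_bucket \<equiv> 30 :: nat"
abbreviation (input) "r_entry \<equiv> 31 :: nat"
abbreviation (input) "r_count \<equiv> 32 :: nat"
abbreviation (input) "r_cand \<equiv> 33 :: nat"
abbreviation (input) "r_cand_size \<equiv> 34 :: nat"
abbreviation (input) "r_j \<equiv> 35 :: nat"
abbreviation (input) "r_x \<equiv> 36 :: nat"
abbreviation (input) "r_y \<equiv> 37 :: nat"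
abbreviation (input) "r_common \<equiv> 38 :: nat"
abbreviation (input) "r_quotient \<equiv> 39 :: nat"
abbreviation (input) "r_pow1 \<equiv> 40 :: nat"
abbreviation (input) "r_pow2 \<equiv> 41 :: nat"

definition skip :: com where "skip = (r_void ::= Const 0)"

definition draw_words :: com where
  "draw_words =
    While (Reg r_dest <\<^sub>e Reg r_queue)
      (Rand r_word ;; Store (Reg r_dest) (Reg r_word) ;; (r_dest ::= Reg r_dest +\<^sub>e Const 1))"

fun put_words :: "store \<Rightarrow> nat list \<Rightarrow> store" where
  "put_words s [] = s"
| "put_words s (u # us) =
    put_words (s\<lparr>mem := (mem s)(regs s r_dest := u),
      regs := (regs s)(r_word := u, r_dest := regs s r_dest + 1)\<rparr>) us"

lemma regs_put_words: "r \<notin> {r_dest, r_word} \<Longrightarrow> regs (put_words s ws) r = regs s r"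
  by (induction s ws rule: put_words.induct) auto

lemma mem_put_words_outside:
  "a < regs s r_dest \<or> regs s r_dest + length ws \<le> a \<Longrightarrow> mem (put_words s ws) a = mem s a"
  by (induction s ws rule: put_words.induct) auto

lemma mem_put_words_inside: "i < length ws \<Longrightarrow> mem (put_words s ws) (regs s r_dest + i) = ws ! i"
proof (induction s ws arbitrary: i rule: put_words.induct)
  case (2 s u us)
  then show ?case
    by (cases i) (auto simp: mem_put_words_outside dest: "2.IH")
qed simp

lemma run_draw_words:
  assumes "regs s r_dest + N = regs s r_queue" "regs s r_queue < 2 ^ w"
  shows "run w inp (6 * N + 1) (draw_words # k, s) = map_pmf (\<lambda>ws. (k, put_words s ws)) (random_words w N)"
  using assms
proof (induction N arbitrary: s)
  case 0
  then show ?case by (simp add: draw_words_def bind_return_pmf)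
next
  case (Suc N)
  define U where "U = pmf_of_set {0..<(2::nat) ^ w}"
  define put where "put u =
      s\<lparr>mem := (mem s)(regs s r_dest := u), regs := (regs s)(r_word := u, r_dest := regs s r_dest + 1)\<rparr>" for u
  have "Suc (regs s r_dest) < 2 ^ w" using Suc.prems by simp
  moreover from this have "0 < w" by (cases w) auto
  ultimately have iteration: "run w inp 6 (draw_words # k, s) = map_pmf (\<lambda>u. (draw_words # k, put u)) U"
    using Suc.prems
    by (simp add: draw_words_def bind_return_pmf map_pmf_def bind_assoc_pmf put_def U_def numeral_eq_Suc)
  have "run w inp (6 + (6 * N + 1)) (draw_words # k, s) =
    bind_pmf U (\<lambda>u. run w inp (6 * N + 1) (draw_words # k, put u))"
    unfolding run_add iteration by (simp only: bind_map_pmf)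
  also have "\<dots> = bind_pmf U (\<lambda>u. map_pmf (\<lambda>ws. (k, put_words (put u) ws)) (random_words w N))"
    using Suc.prems by (intro bind_pmf_cong refl Suc.IH) (auto simp: put_def)
  also have "\<dots> = map_pmf (\<lambda>ws. (k, put_words s ws)) (random_words w (Suc N))"
    by (simp add: random_words_Suc map_bind_pmf map_pmf_comp U_def put_def)
  finally have "run w inp (6 + (6 * N + 1)) (draw_words # k, s) = \<dots>" .
  moreover have "6 * Suc N + 1 = 6 + (6 * N + 1)" by simp
  ultimately show ?case by (simp only:)
qed

subsection \<open>Growing the tree of paths\<close>

definition hash_of :: "exp \<Rightarrow> exp \<Rightarrow> exp \<Rightarrow> exp" where
  "hash_of A B K = (Mem A *\<^sub>e K +\<^sub>e Mem B) div\<^sub>e Reg r_divisor"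

lemma eval_hash_of:
  "regs s r_divisor = 2 ^ (w - z) \<Longrightarrow> eval w inp s (hash_of A B K) =
    hash w z (mem s (eval w inp s A)) (mem s (eval w inp s B)) (eval w inp s K)"
  by (simp add: hash_of_def hash_def mod_add_left_eq)

definition push_node :: "exp \<Rightarrow> exp \<Rightarrow> com" where
  "push_node T V =
    Store (Reg r_queue +\<^sub>e Const 2 *\<^sub>e Reg r_len) T ;;
    Store (Reg r_queue +\<^sub>e Const 2 *\<^sub>e Reg r_len +\<^sub>e Const 1) V ;;
    (r_len ::= Reg r_len +\<^sub>e Const 1)"

definition push_roots :: com where
  "push_roots =
    (r_len ::= Const 0) ;;
    While (Reg r_len <\<^sub>e Reg r_reps) (push_node (Reg r_len *\<^sub>e (Reg r_depth +\<^sub>e Const 1)) (Const 0))"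

definition child_hash :: exp where
  "child_hash = hash_of (Const 32 +\<^sub>e Const 2 *\<^sub>e Reg r_tag) (Const 33 +\<^sub>e Const 2 *\<^sub>e Reg r_tag)
    (Reg r_id *\<^sub>e Reg r_scale +\<^sub>e Inp (Reg r_elems +\<^sub>e Reg r_i))"

definition try_child :: com where
  "try_child =
    (r_hash ::= child_hash) ;;
    If (Reg r_hash <\<^sub>e Reg r_threshold \<and>\<^sub>e Reg r_len <\<^sub>e Reg r_cap)
      (push_node (Reg r_tag +\<^sub>e Const 1) (Reg r_hash))
      skip ;;
    (r_i ::= Reg r_i +\<^sub>e Const 1)"

definition expand_node :: com where
  "expand_node = (r_i ::= Const 0) ;; While (Reg r_i <\<^sub>e Reg r_size) try_child"

definition load_node :: com where
  "load_node =
    (r_tag ::= Mem (Reg r_queue +\<^sub>e Const 2 *\<^sub>e Reg r_node)) ;;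
    (r_id ::= Mem (Reg r_queue +\<^sub>e Const 2 *\<^sub>e Reg r_node +\<^sub>e Const 1))"

definition for_nodes :: "com \<Rightarrow> com \<Rightarrow> com" where
  "for_nodes at_inner at_leaf =
    (r_node ::= Const 0) ;;
    While (Reg r_node <\<^sub>e Reg r_len)
      (load_node ;;
       If (Reg r_tag mod\<^sub>e (Reg r_depth +\<^sub>e Const 1) <\<^sub>e Reg r_depth) at_inner at_leaf ;;
       (r_node ::= Reg r_node +\<^sub>e Const 1))"

definition generate :: com where
  "generate =
    (r_threshold ::= Reg r_scale *\<^sub>e Reg r_scale div\<^sub>e (Reg r_B1 *\<^sub>e Reg r_size) +\<^sub>e Const 1) ;;
    push_roots ;; for_nodes expand_node skip"

text \<open>A node \<open>(t, v)\<close> is a path with identifier \<open>v\<close> on level \<open>t mod Suc k\<close> of repetition \<open>t div Suc k\<close>; level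
  \<open>t\<close> has its own seed, the words \<open>2 * t\<close> and \<open>2 * t + 1\<close>.\<close>

type_synonym node = "nat \<times> nat"

definition child_id :: "nat \<Rightarrow> nat \<Rightarrow> nat list \<Rightarrow> node \<Rightarrow> nat \<Rightarrow> nat" where
  "child_id w z sd p i = hash w z (sd ! (2 * fst p)) (sd ! (2 * fst p + 1)) (snd p * 2 ^ z + i)"

definition kids :: "nat \<Rightarrow> nat \<Rightarrow> nat \<Rightarrow> nat list \<Rightarrow> nat list \<Rightarrow> node \<Rightarrow> node list" where
  "kids w z \<tau> sd xs p = map (Pair (Suc (fst p))) (filter (\<lambda>u. u < \<tau>) (map (child_id w z sd p) xs))"

lemma kids_snoc:
  "kids w z \<tau> sd (xs @ [x]) p =
    kids w z \<tau> sd xs p @ (if child_id w z sd p x < \<tau> then [(Suc (fst p), child_id w z sd p x)] else [])"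
  by (simp add: kids_def)

text \<open>The truncated queue after its first \<open>h\<close> nodes have been expanded.\<close>

fun bfs :: "nat \<Rightarrow> (node \<Rightarrow> node list) \<Rightarrow> node list \<Rightarrow> nat \<Rightarrow> node list" where
  "bfs cap ch roots 0 = roots"
| "bfs cap ch roots (Suc h) =
    (let Q = bfs cap ch roots h in if h < length Q then take cap (Q @ ch (Q ! h)) else Q)"

lemma bfs_stable: "h \<le> h' \<Longrightarrow> length (bfs cap ch roots h) \<le> h \<Longrightarrow> bfs cap ch roots h' = bfs cap ch roots h"
  by (induction h' rule: dec_induct) (auto simp: Let_def)

lemma length_bfs: "length roots \<le> cap \<Longrightarrow> length (bfs cap ch roots h) \<le> cap"
  by (induction h) (auto simp: Let_def)

lemma bfs_invariant:
  assumes "\<And>p. p \<in> set roots \<Longrightarrow> P p" "\<And>p p'. P p \<Longrightarrow> p' \<in> set (ch p) \<Longrightarrow> P p'"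
  shows "p \<in> set (bfs cap ch roots h) \<Longrightarrow> P p"
proof (induction h arbitrary: p)
  case (Suc h)
  show ?case
  proof (cases "h < length (bfs cap ch roots h)")
    case True
    then have "p \<in> set (bfs cap ch roots h) \<or> p \<in> set (ch (bfs cap ch roots h ! h))"
      using Suc.prems by (auto simp: Let_def dest!: in_set_takeD)
    then show ?thesis using Suc.IH assms(2)[OF Suc.IH[OF nth_mem[OF True]]] by blast
  next
    case False
    then show ?thesis using Suc by (simp add: Let_def)
  qed
qed (use assms in auto)

lemma wp_skip: "Q 1 (s\<lparr>regs := (regs s)(r_void := 0)\<rparr>) \<Longrightarrow> wp w inp skip Q s"
  unfolding skip_def by (rule wp_assign) simp

text \<open>The scale \<open>Z\<close> is at once the range of the hash functions, the precision of \<open>b1\<close> and \<open>b2\<close>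
  (\<open>B1 / Z\<close> and \<open>B2 / Z\<close> approximate them) and a bound on all addresses. There are \<open>L\<close> repetitions of depth
  \<open>k\<close>, queues have room for \<open>cap\<close> nodes, and the input consists of \<open>N\<close> words.\<close>

locale layout =
  fixes w z Z B1 B2 k L cap n N :: nat
  assumes Z_def: "Z = 2 ^ z" and zw: "8 * z \<le> w"
    and B1: "0 < B1" "B1 \<le> Z" and B2: "0 < B2" "B2 \<le> Z"
    and L: "0 < L" "L \<le> cap" and n: "0 < n"
    and fit: "36 + 2 * (L * Suc k) + 2 * cap + 3 * (n * cap) + N \<le> Z" "40 * cap \<le> Z"
begin

text \<open>The memory consists of the parameters, the random words (from address 32; the last two are the seed of
  the bucket hash), the queue, the heads of the bucket chains, the chain entries and the sets.\<close>

definition "n_seeds = 2 * (L * Suc k)"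
definition "queue_at = 34 + n_seeds"
definition "heads_at = queue_at + 2 * cap"
definition "buckets = n * cap"
definition "entries_at = heads_at + buckets"
definition "sets_at = entries_at + 2 * buckets + 2"

definition tau :: "nat \<Rightarrow> nat" where
  "tau m = Z * Z div (B1 * m) + 1"

definition params :: "(nat \<Rightarrow> nat) \<Rightarrow> bool" where
  "params f \<longleftrightarrow> f r_scale = Z \<and> f r_divisor = 2 ^ (w - z) \<and> f r_B1 = B1 \<and> f r_B2 = B2 \<and> f r_depth = k \<and>
    f r_cap = cap \<and> f r_buckets = buckets \<and> f r_reps = L \<and> f r_n = n \<and> f r_queue = queue_at \<and>
    f r_heads = heads_at \<and> f r_entries = entries_at \<and> f r_sets = sets_at"

lemma params_cong: "params f \<Longrightarrow> (\<And>r. 1 \<le> r \<Longrightarrow> r \<le> 13 \<Longrightarrow> g r = f r) \<Longrightarrow> params g"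
  by (auto simp: params_def)

lemma params_modifies:
  assumes "params (regs s)" "modifies R A s s'" "R \<inter> {1..13} = {}"
  shows "params (regs s')"
  using assms(1) by (rule params_cong) (use assms(2,3) in \<open>auto simp: modifies_def\<close>)

lemma memory_bounds:
  "queue_at + 2 * cap = heads_at" "heads_at + buckets = entries_at" "entries_at + 2 * buckets + 2 = sets_at"
  "sets_at + N \<le> Z" "34 + 2 * (L * Suc k) = queue_at" "40 * cap \<le> Z" "L \<le> L * Suc k" "k \<le> L * Suc k"
  "cap \<le> buckets" "n \<le> buckets" "0 < buckets" "0 < cap"
proof -
  show "queue_at + 2 * cap = heads_at" "heads_at + buckets = entries_at" "entries_at + 2 * buckets + 2 = sets_at"
    "34 + 2 * (L * Suc k) = queue_at" "40 * cap \<le> Z"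
    using fit by (auto simp: heads_at_def entries_at_def sets_at_def queue_at_def n_seeds_def)
  show "sets_at + N \<le> Z"
    using fit by (simp add: heads_at_def entries_at_def sets_at_def queue_at_def n_seeds_def buckets_def
      mult.commute[of cap])
  show "L \<le> L * Suc k" "cap \<le> buckets" "n \<le> buckets" "0 < buckets" "0 < cap"
    using L n by (auto simp: buckets_def)
  have "1 * k \<le> L * Suc k" using L by (intro mult_mono) auto
  then show "k \<le> L * Suc k" by simp
qed

lemma z_ge: "5 \<le> z"
proof (rule ccontr)
  assume "\<not> 5 \<le> z"
  then have "(2::nat) ^ z \<le> 2 ^ 4" by (intro power_increasing) auto
  then show False using fit by (simp add: Z_def)
qed

lemma Z_ge: "32 \<le> Z"
  using power_increasing[OF z_ge, of "2::nat"] by (simp add: Z_def)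

lemma w_ge: "40 \<le> w" and z_le: "z \<le> w"
  using z_ge zw by auto

lemma no_overflow: "Z * Z * Z < 2 ^ w" "Z * Z \<le> Z * Z * Z" "1000 * Z < 2 ^ w" "2 * (Z * Z) < 2 ^ w"
proof -
  have "Z * Z * Z * Z = 2 ^ (4 * z)" by (simp add: Z_def flip: power_add)
  also have "\<dots> < 2 ^ w" using z_ge zw by (intro power_strict_increasing) auto
  finally have fourth: "Z * Z * Z * Z < 2 ^ w" .
  have "Z * Z * Z * 1 \<le> Z * Z * Z * Z" using Z_ge by (intro mult_left_mono) auto
  then show third: "Z * Z * Z < 2 ^ w" using fourth by linarith
  show "Z * Z \<le> Z * Z * Z" using Z_ge by simp
  have "1000 \<le> 32 * (32::nat)" by simp
  also have "\<dots> \<le> Z * Z" using Z_ge by (intro mult_mono) auto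
  finally have "1000 * Z \<le> Z * Z * Z" by (intro mult_right_mono) auto
  then show "1000 * Z < 2 ^ w" using third by linarith
  have "2 * (Z * Z) \<le> Z * (Z * Z)" using Z_ge by (intro mult_right_mono) auto
  also have "\<dots> = Z * Z * Z" by simp
  finally show "2 * (Z * Z) < 2 ^ w" using third by linarith
qed

lemma w_pos: "0 < w"
  using w_ge by simp

lemma const_mod: "c \<le> 1000 * Z \<Longrightarrow> c mod 2 ^ w = c"
  using no_overflow by simp

definition seeds_in :: "(nat \<Rightarrow> nat) \<Rightarrow> nat list \<Rightarrow> bool" where
  "seeds_in m sd \<longleftrightarrow> length sd = n_seeds \<and> (\<forall>i<length sd. m (32 + i) = sd ! i)"

lemma seeds_in_cong: "seeds_in m sd \<Longrightarrow> (\<And>a. a < queue_at \<Longrightarrow> m' a = m a) \<Longrightarrow> seeds_in m' sd"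
  by (auto simp: seeds_in_def queue_at_def)

definition reads :: "nat list \<Rightarrow> nat \<Rightarrow> nat list \<Rightarrow> bool" where
  "reads inp b xs \<longleftrightarrow> set xs \<subseteq> {..<Z} \<and> b + length xs \<le> Z \<and> b + length xs \<le> length inp \<and>
    (\<forall>j<length xs. inp ! (b + j) = xs ! j)"

definition queued :: "store \<Rightarrow> node list \<Rightarrow> bool" where
  "queued s Q \<longleftrightarrow> regs s r_len = length Q \<and> length Q \<le> cap \<and>
    (\<forall>i<length Q. mem s (queue_at + 2 * i) = fst (Q ! i) \<and> mem s (queue_at + 2 * i + 1) = snd (Q ! i))"

lemma queued_modifies:
  assumes "queued s Q" "modifies R A s s'" "r_len \<notin> R" "A \<inter> {queue_at..<heads_at} = {}"
  shows "queued s' Q"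
proof -
  have "mem s' a = mem s a" if "queue_at \<le> a" "a < heads_at" for a
    using assms(2,4) that by (auto simp: modifies_def)
  then show ?thesis
    using assms(1-3) memory_bounds(1) by (auto simp: queued_def modifies_def)
qed

lemma queued_update_regs [simp]: "f r_len = regs s r_len \<Longrightarrow> queued (s\<lparr>regs := f\<rparr>) Q = queued s Q"
  by (simp add: queued_def)

lemma wp_push_node:
  assumes params: "params (regs s)" and queue: "queued s Q" "length Q < cap"
    and T: "eval w inp s T = t" and V: "\<And>m. eval w inp (s\<lparr>mem := m\<rparr>) V = v"
  shows "wp w inp (push_node T V) (\<lambda>t' s'. t' = 5 \<and> modifies {r_len} {queue_at..<heads_at} s s' \<and>
    queued s' (Q @ [(t, v)])) s"
proof -
  let ?m = "(mem s)(queue_at + 2 * length Q := t, queue_at + 2 * length Q + 1 := v)"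
  have pushed: "queued (s\<lparr>mem := ?m, regs := (regs s)(r_len := length Q + 1)\<rparr>) (Q @ [(t, v)])"
    using queue by (auto simp: queued_def nth_append less_Suc_eq)
  have small: "queue_at + 2 * length Q + 1 < 2 ^ w" "2 < (2 :: nat) ^ w"
    using queue memory_bounds no_overflow Z_ge by auto
  have "modifies {r_len} {queue_at..<heads_at} s (s\<lparr>mem := ?m, regs := (regs s)(r_len := length Q + 1)\<rparr>)"
    using queue(2) memory_bounds(1) by (auto simp: modifies_def)
  moreover have "regs s r_len = length Q" "regs s r_queue = queue_at"
    using params queue(1) by (auto simp: params_def queued_def)
  ultimately show ?thesis
    unfolding push_node_def using T V small pushed w_pos
    by (intro wp_seq wp_store wp_assign) simp
qed

definition roots :: "node list" where
  "roots = map (\<lambda>r. (r * Suc k, 0)) [0..<L]"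

lemma length_roots [simp]: "length roots = L"
  by (simp add: roots_def)

lemma wp_push_roots:
  assumes params: "params (regs s)"
  shows "wp w inp push_roots (\<lambda>T s'. T \<le> 10 * cap + 10 \<and> modifies {r_len} {queue_at..<heads_at} s s' \<and>
      queued s' roots) s"
proof -
  define I where "I s' \<longleftrightarrow> modifies {r_len} {queue_at..<heads_at} s s' \<and> regs s' r_len \<le> L \<and>
    queued s' (take (regs s' r_len) roots)" for s'
  show ?thesis unfolding push_roots_def
  proof (intro wp_seq wp_assign, rule wp_while[where I = I and V = "\<lambda>s'. 10 * (L - regs s' r_len)"],
      goal_cases init step exit)
    case init
    show ?case by (simp add: I_def queued_def)
  next
    case (step s1)
    define j where "j = regs s1 r_len"
    have inv: "modifies {r_len} {queue_at..<heads_at} s s1" "queued s1 (take j roots)"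
      using step(1) by (auto simp: I_def j_def)
    have params_s1: "params (regs s1)" by (rule params_modifies[OF params inv(1)]) simp
    have j_less: "j < L" using step(2) params_s1 by (simp add: params_def j_def)
    have "j * Suc k \<le> L * Suc k" using j_less by (intro mult_right_mono) auto
    then have "eval w inp s1 (Reg r_len *\<^sub>e (Reg r_depth +\<^sub>e Const 1)) = j * Suc k"
      using params_s1 j_less memory_bounds no_overflow w_pos by (simp add: params_def j_def const_mod)
    moreover have "take (Suc j) roots = take j roots @ [(j * Suc k, 0)]"
      using j_less by (auto simp: roots_def take_map take_Suc_conv_app_nth)
    ultimately have push: "wp w inp (push_node (Reg r_len *\<^sub>e (Reg r_depth +\<^sub>e Const 1)) (Const 0))
      (\<lambda>t' s'. t' = 5 \<and>
        modifies {r_len} {queue_at..<heads_at} s1 s' \<and> queued s' (take (Suc j) roots)) s1"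
      using wp_push_node[OF params_s1 inv(2), where v = 0] j_less L by simp
    show ?case
    proof (rule wp_conseq[OF push], elim conjE, goal_cases after)
      case (after t' s')
      then have "regs s' r_len = Suc j" using j_less by (simp add: queued_def)
      then show ?case using after inv(1) j_less by (auto simp: I_def j_def intro: modifies_trans)
    qed
  next
    case (exit T s')
    have "params (regs s')" by (rule params_modifies[OF params]) (use exit(1) in \<open>auto simp: I_def\<close>)
    then show ?case using exit L by (auto simp: I_def params_def modifies_def)
  qed
qed

lemma eval_child_hash:
  assumes params: "params (regs s)" and seeds: "seeds_in (mem s) sd"
    and elems: "reads inp (regs s r_elems) xs" "regs s r_i < length xs"
    and node: "regs s r_tag < L * Suc k" "regs s r_id < Z"
  shows "eval w inp s child_hash = child_id w z sd (regs s r_tag, regs s r_id) (xs ! regs s r_i)"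
proof -
  define t v where "t = regs s r_tag" and "v = regs s r_id"
  have t_less: "2 * t + 1 < 2 * (L * Suc k)" using node by (simp add: t_def)
  have addresses: "eval w inp s (Const 32 +\<^sub>e Const 2 *\<^sub>e Reg r_tag) = 32 + 2 * t"
    "eval w inp s (Const 33 +\<^sub>e Const 2 *\<^sub>e Reg r_tag) = 32 + (2 * t + 1)"
    using t_less memory_bounds no_overflow by (simp_all add: t_def const_mod)
  have seed_words: "mem s (32 + 2 * t) = sd ! (2 * t)" "mem s (32 + (2 * t + 1)) = sd ! (2 * t + 1)"
    using seeds t_less by (auto simp: seeds_in_def n_seeds_def)
  have "xs ! regs s r_i < Z" using elems nth_mem unfolding reads_def by blast
  moreover have "v * Z + Z \<le> Z * Z" using node mult_right_mono[of "Suc v" Z Z] by (simp add: v_def)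
  ultimately have key: "eval w inp s (Reg r_id *\<^sub>e Reg r_scale +\<^sub>e Inp (Reg r_elems +\<^sub>e Reg r_i)) =
    v * 2 ^ z + xs ! regs s r_i"
    using params elems no_overflow by (simp add: v_def[symmetric] reads_def Let_def Z_def[symmetric] params_def)
  have "regs s r_divisor = 2 ^ (w - z)" using params by (simp add: params_def)
  then show ?thesis
    unfolding child_hash_def child_id_def
    by (simp only: eval_hash_of addresses seed_words key fst_conv snd_conv flip: t_def v_def)
qed

lemma wp_try_child:
  assumes params: "params (regs s)" and seeds: "seeds_in (mem s) sd"
    and elems: "reads inp (regs s r_elems) xs" "regs s r_i < length xs"
    and node: "regs s r_tag < L * Suc k" "regs s r_id < Z" and queue: "queued s Q"
    and u: "u = child_id w z sd (regs s r_tag, regs s r_id) (xs ! regs s r_i)"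
  shows "wp w inp try_child (\<lambda>T s'. T \<le> 15 \<and>
      modifies {r_len, r_i, r_hash, r_void} {queue_at..<heads_at} s s' \<and> regs s' r_i = Suc (regs s r_i) \<and>
      queued s' (take cap (Q @ (if u < regs s r_threshold then [(Suc (regs s r_tag), u)] else [])))) s"
proof -
  define s1 where "s1 = s\<lparr>regs := (regs s)(r_hash := u)\<rparr>"
  have hashed: "eval w inp s child_hash = u" unfolding u by (rule eval_child_hash[OF params seeds elems node])
  have state_s1: "modifies {r_len, r_i, r_hash, r_void} {queue_at..<heads_at} s s1" "regs s1 r_hash = u"
    "regs s1 r_threshold = regs s r_threshold" "regs s1 r_tag = regs s r_tag" "regs s1 r_i = regs s r_i"
    by (simp_all add: s1_def)
  have params_s1: "params (regs s1)" using params by (rule params_modifies[OF _ state_s1(1)]) simp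
  have queue_s1: "queued s1 Q" using queue by (simp add: queued_def s1_def)
  have small: "regs s r_tag + 1 < 2 ^ w" "regs s r_i + 1 < 2 ^ w"
    using node elems memory_bounds no_overflow by (auto simp: reads_def)
  then have "eval w inp s1 (Reg r_tag +\<^sub>e Const 1) = Suc (regs s r_tag)" using w_pos by (simp add: state_s1)
  note push = wp_push_node[OF params_s1 queue_s1 _ this, where V = "Reg r_hash" and v = u]
  have test: "eval w inp s1 (Reg r_hash <\<^sub>e Reg r_threshold \<and>\<^sub>e Reg r_len <\<^sub>e Reg r_cap) =
    of_bool (u < regs s r_threshold \<and> length Q < cap)"
    using params_s1 queue_s1 state_s1 by (simp add: params_def queued_def)
  show ?thesis unfolding try_child_def
  proof (rule wp_seq_assign[OF hashed s1_def], rule wp_seq, rule wp_if, unfold test, goal_cases holds fails)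
    case holds
    then have "u < regs s r_threshold" "length Q < cap" by auto
    then have pushed: "take cap (Q @ (if u < regs s r_threshold then [(Suc (regs s r_tag), u)] else [])) =
      Q @ [(Suc (regs s r_tag), u)]"
      by simp
    show ?case
    proof (rule wp_conseq[OF push], goal_cases room tag after)
      case (after t' s')
      then have "modifies {r_len, r_i, r_hash, r_void} {queue_at..<heads_at} s s'" "regs s' r_i = regs s r_i"
        using state_s1 by (auto intro: modifies_trans simp: modifies_regs)
      then show ?case using after pushed small w_pos by (intro wp_assign) simp
    qed (use \<open>length Q < cap\<close> in \<open>simp_all add: s1_def\<close>)
  next
    case fails
    then have "take cap (Q @ (if u < regs s r_threshold then [(Suc (regs s r_tag), u)] else [])) = Q"
      using queue by (auto simp: queued_def)
    then show ?case
      using queue_s1 state_s1 small w_pos by (intro wp_skip wp_assign) simp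
  qed
qed

lemma wp_expand_node:
  assumes params: "params (regs s)" and seeds: "seeds_in (mem s) sd"
    and elems: "reads inp (regs s r_elems) xs" "regs s r_size = length xs"
    and node: "regs s r_tag < L * Suc k" "regs s r_id < Z" and queue: "queued s Q"
  shows "wp w inp expand_node (\<lambda>T s'. T \<le> 20 * length xs + 10 \<and>
      modifies {r_len, r_i, r_hash, r_void} {queue_at..<heads_at} s s' \<and>
      queued s' (take cap (Q @ kids w z (regs s r_threshold) sd xs (regs s r_tag, regs s r_id)))) s"
proof -
  define Q_upto where
    "Q_upto j = take cap (Q @ kids w z (regs s r_threshold) sd (take j xs) (regs s r_tag, regs s r_id))" for j
  define I where "I s' \<longleftrightarrow> regs s' r_i \<le> length xs \<and>
    modifies {r_len, r_i, r_hash, r_void} {queue_at..<heads_at} s s' \<and> queued s' (Q_upto (regs s' r_i))" for s'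
  have take_append_take: "take c (take c A @ B) = take c (A @ B)" for c and A B :: "node list"
    by (cases "length A \<le> c") auto
  show ?thesis unfolding expand_node_def
  proof (intro wp_seq wp_assign, rule wp_while[where I = I and V = "\<lambda>s'. 20 * (length xs - regs s' r_i)"],
      goal_cases init step exit)
    case init
    show ?case using queue by (auto simp: I_def Q_upto_def kids_def queued_def)
  next
    case (step s1)
    have frame_s1: "modifies {r_len, r_i, r_hash, r_void} {queue_at..<heads_at} s s1"
      and queue_s1: "queued s1 (Q_upto (regs s1 r_i))"
      using step(1) by (auto simp: I_def)
    have params_s1: "params (regs s1)" by (rule params_modifies[OF params frame_s1]) simp
    have seeds_s1: "seeds_in (mem s1) sd"
      using seeds by (rule seeds_in_cong) (use frame_s1 in \<open>simp add: modifies_def\<close>)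
    have i_less: "regs s1 r_i < length xs" using step elems frame_s1 by (simp add: modifies_def)
    have "Q_upto (Suc j) =
        take cap (Q_upto j @ (if child_id w z sd (regs s r_tag, regs s r_id) (xs ! j) < regs s r_threshold
      then [(Suc (regs s r_tag), child_id w z sd (regs s r_tag, regs s r_id) (xs ! j))] else []))"
        if "j < length xs" for j
      using that by (simp only: Q_upto_def take_Suc_conv_app_nth kids_snoc take_append_take append_assoc fst_conv)
    then show ?case
      using frame_s1 node elems i_less
      by (intro wp_conseq[OF wp_try_child[OF params_s1 seeds_s1 _ _ _ _ queue_s1 refl]])
        (auto simp: I_def modifies_regs intro: modifies_trans)
  next
    case (exit T s')
    then have "regs s' r_i = length xs" using elems by (simp add: I_def modifies_def)
    then show ?case using exit by (auto simp: I_def Q_upto_def)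
  qed
qed

definition is_leaf :: "node \<Rightarrow> bool" where
  "is_leaf p \<longleftrightarrow> \<not> fst p mod Suc k < k"

lemma wp_load_node:
  assumes params: "params (regs s)" and queue: "queued s Q" and node_less: "regs s r_node < length Q"
  shows "wp w inp load_node (\<lambda>T s'. T = 3 \<and> modifies {r_tag, r_id} {} s s' \<and>
    (regs s' r_tag, regs s' r_id) = Q ! regs s r_node) s"
proof -
  have "queue_at + 2 * regs s r_node + 1 < 2 ^ w" "2 * regs s r_node < 2 ^ w" "2 < (2::nat) ^ w"
    using queue node_less memory_bounds no_overflow Z_ge by (auto simp: queued_def)
  then show ?thesis unfolding load_node_def
    by (intro wp_seq wp_assign)
      (use params queue node_less w_pos in \<open>auto simp: queued_def params_def modifies_def\<close>)
qed

lemma eval_leaf_test: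
  assumes "params (regs s)"
  shows "eval w inp s (Reg r_tag mod\<^sub>e (Reg r_depth +\<^sub>e Const 1) <\<^sub>e Reg r_depth) =
    of_bool (\<not> is_leaf (regs s r_tag, regs s r_id))"
proof -
  have "k + 1 < 2 ^ w" using memory_bounds no_overflow by auto
  then show ?thesis using assms w_pos by (simp add: is_leaf_def params_def)
qed

lemma wp_next_node:
  assumes "regs s r_node < cap" "P 1 (s\<lparr>regs := (regs s)(r_node := Suc (regs s r_node))\<rparr>)"
  shows "wp w inp (r_node ::= Reg r_node +\<^sub>e Const 1) P s"
proof -
  have "regs s r_node + 1 < 2 ^ w" using assms(1) memory_bounds no_overflow by auto
  then show ?thesis using assms(2) w_pos by (intro wp_assign) simp
qed

lemma wp_visit_node:
  assumes params: "params (regs s)" and queue: "queued s Q" "regs s r_node < length Q"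
    and visit: "\<And>s'. modifies {r_tag, r_id} {} s s' \<Longrightarrow> (regs s' r_tag, regs s' r_id) = Q ! regs s r_node \<Longrightarrow>
      wp w inp (if is_leaf (Q ! regs s r_node) then at_leaf else at_inner) (\<lambda>t s''.
        regs s'' r_node = regs s r_node \<and>
        P (t + 7) (s''\<lparr>regs := (regs s'')(r_node := Suc (regs s r_node))\<rparr>)) s'"
  shows "wp w inp (load_node ;; If (Reg r_tag mod\<^sub>e (Reg r_depth +\<^sub>e Const 1) <\<^sub>e Reg r_depth) at_inner at_leaf ;;
    (r_node ::= Reg r_node +\<^sub>e Const 1)) P s"
proof (rule wp_seq, rule wp_conseq[OF wp_load_node[OF params queue]], elim conjE, rule wp_seq, goal_cases after)
  case (after t1 s1)
  have params_s1: "params (regs s1)" by (rule params_modifies[OF params after(2)]) auto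
  have node_less: "regs s r_node < cap" using queue by (simp add: queued_def)
  have increment: "wp w inp (r_node ::= Reg r_node +\<^sub>e Const 1) (\<lambda>t3. P (Suc (t1 + Suc (Suc t2 + t3)))) s2"
    if "regs s2 r_node = regs s r_node"
      "P (t2 + 7) (s2\<lparr>regs := (regs s2)(r_node := Suc (regs s r_node))\<rparr>)" for t2 s2
    using that node_less after(1) by (intro wp_next_node) (simp_all add: eval_nat_numeral)
  have visit_s1: "wp w inp (if is_leaf (Q ! regs s r_node) then at_leaf else at_inner)
      (\<lambda>t2. wp w inp (r_node ::= Reg r_node +\<^sub>e Const 1) (\<lambda>t3. P (Suc (t1 + Suc (Suc t2 + t3))))) s1"
    by (rule wp_conseq[OF visit[OF after(2,3)]]) (elim conjE, rule increment)
  show ?case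
    by (rule wp_if, unfold eval_leaf_test[OF params_s1, unfolded after(3)]) (use visit_s1 in auto)
qed

lemma wp_for_nodes:
  fixes I :: "nat \<Rightarrow> nat \<Rightarrow> store \<Rightarrow> bool" and Q :: "nat \<Rightarrow> node list"
  assumes start: "I 0 0 s"
    and frame: "\<And>h t s' s''. I h t s' \<Longrightarrow> modifies {r_node, r_tag, r_id} {} s' s'' \<Longrightarrow> I h t s''"
    and params: "\<And>h t s'. I h t s' \<Longrightarrow> params (regs s')"
    and queued: "\<And>h t s'. I h t s' \<Longrightarrow> h < regs s' r_len \<Longrightarrow> queued s' (Q h)"
    and body: "\<And>h t s'. I h t s' \<Longrightarrow> queued s' (Q h) \<Longrightarrow> h < length (Q h) \<Longrightarrow> regs s' r_node = h \<Longrightarrow>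
      (regs s' r_tag, regs s' r_id) = Q h ! h \<Longrightarrow>
      wp w inp (if is_leaf (Q h ! h) then at_leaf else at_inner)
        (\<lambda>t' s''. I (Suc h) (t + t' + 8) s'' \<and> regs s'' r_node = h) s'"
    and post: "\<And>h t s'. I h t s' \<Longrightarrow> regs s' r_len \<le> h \<Longrightarrow> h \<le> cap \<Longrightarrow> P (t + 3) s'"
  shows "wp w inp (for_nodes at_inner at_leaf) P s"
  unfolding for_nodes_def
proof (rule wp_seq, rule wp_assign, rule wp_while_elapsed[where
      I = "\<lambda>t s'. I (regs s' r_node) t s' \<and> regs s' r_node \<le> cap" and V = "\<lambda>s'. cap - regs s' r_node"],
    goal_cases init step exit)
  case init
  show ?case using frame[OF start] by simp
next
  case (step t s1)
  define h where "h = regs s1 r_node"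
  then have h_eq: "regs s1 r_node = h" by simp
  have inv: "I h t s1" and "h < regs s1 r_len" using step by (auto simp: h_eq)
  note queue_s1 = queued[OF this]
  have h_less: "h < length (Q h)" "length (Q h) \<le> cap"
    using \<open>h < regs s1 r_len\<close> queue_s1 by (auto simp: queued_def)
  show ?case
  proof (rule wp_visit_node[OF params[OF inv] queue_s1], unfold h_eq)
    fix s2
    assume s2: "modifies {r_tag, r_id} {} s1 s2" "(regs s2 r_tag, regs s2 r_id) = Q h ! h"
    have inv_s2: "I h t s2" by (rule frame[OF inv modifies_trans[OF s2(1) modifies_refl]]) auto
    have queue_s2: "queued s2 (Q h)" by (rule queued_modifies[OF queue_s1 s2(1)]) auto
    have node_s2: "regs s2 r_node = h" using s2(1) by (simp add: modifies_regs h_eq)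
    have "I (Suc h) (t + Suc (t' + 7)) (s3\<lparr>regs := (regs s3)(r_node := Suc h)\<rparr>)"
      if "I (Suc h) (t + t' + 8) s3" for t' s3
      using frame[OF that, of "s3\<lparr>regs := (regs s3)(r_node := Suc h)\<rparr>"] by (simp add: eval_nat_numeral)
    then show "wp w inp (if is_leaf (Q h ! h) then at_leaf else at_inner) (\<lambda>t' s3. regs s3 r_node = h \<and>
      (I (regs (s3\<lparr>regs := (regs s3)(r_node := Suc h)\<rparr>) r_node) (t + Suc (t' + 7))
        (s3\<lparr>regs := (regs s3)(r_node := Suc h)\<rparr>) \<and>
        regs (s3\<lparr>regs := (regs s3)(r_node := Suc h)\<rparr>) r_node \<le> cap) \<and>
      cap - regs (s3\<lparr>regs := (regs s3)(r_node := Suc h)\<rparr>) r_node < cap - h) s2"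
      using h_less by (intro wp_conseq[OF body[OF inv_s2 queue_s2 h_less(1) node_s2 s2(2)]]) auto
  qed (use h_less in simp)
next
  case (exit t s')
  then have "P (t + 3) s'" by (intro post) auto
  moreover have "Suc (1 + Suc t) = t + 3" by simp
  ultimately show ?case by (simp only:)
qed

definition children :: "nat list \<Rightarrow> nat list \<Rightarrow> node \<Rightarrow> node list" where
  "children sd xs p = (if is_leaf p then [] else kids w z (tau (length xs)) sd xs p)"

definition queue :: "nat list \<Rightarrow> nat list \<Rightarrow> node list" where
  "queue sd xs = bfs cap (children sd xs) roots cap"

definition good_node :: "node \<Rightarrow> bool" where
  "good_node p \<longleftrightarrow> fst p < L * Suc k \<and> snd p < Z"

lemma good_roots:
  assumes "p \<in> set roots"
  shows "good_node p"
proof -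
  obtain r where r: "r < L" "p = (r * Suc k, 0)" using assms by (auto simp: roots_def)
  have "Suc r * Suc k \<le> L * Suc k" using r by (intro mult_right_mono) auto
  then have "r * Suc k < L * Suc k" by simp
  then show ?thesis using Z_ge by (simp add: r(2) good_node_def)
qed

lemma Suc_not_leaf:
  assumes "t < L * Suc k" "t mod Suc k < k"
  shows "Suc t < L * Suc k"
proof -
  have "t div Suc k < L" using assms(1) by (simp add: less_mult_imp_div_less)
  then have "Suc (t div Suc k) * Suc k \<le> L * Suc k" by (intro mult_right_mono) auto
  moreover have "t = (t div Suc k) * Suc k + t mod Suc k" by (metis div_mult_mod_eq)
  ultimately show ?thesis using assms(2) by simp
qed

lemma child_id_less: "child_id w z sd p i < Z"
  by (simp add: child_id_def Z_def hash_less z_le)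

lemma good_children: "good_node p \<Longrightarrow> p' \<in> set (children sd xs p) \<Longrightarrow> good_node p'"
  using Suc_not_leaf[of "fst p"]
  by (auto simp: children_def is_leaf_def kids_def good_node_def child_id_less split: if_splits)

lemma good_bfs: "p \<in> set (bfs cap (children sd xs) roots h) \<Longrightarrow> good_node p"
  by (rule bfs_invariant[where P = good_node]) (auto intro: good_roots good_children)

lemma good_queue: "p \<in> set (queue sd xs) \<Longrightarrow> good_node p"
  unfolding queue_def by (rule good_bfs)

lemma length_queue: "length (queue sd xs) \<le> cap"
  unfolding queue_def by (rule length_bfs) (simp add: L)

lemma eval_threshold:
  assumes "params (regs s)" "regs s r_size \<le> Z"
  shows "eval w inp s (Reg r_scale *\<^sub>e Reg r_scale div\<^sub>e (Reg r_B1 *\<^sub>e Reg r_size) +\<^sub>e Const 1) =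
      tau (regs s r_size)"
proof -
  have "B1 * regs s r_size \<le> Z * Z" using B1 assms(2) by (intro mult_mono) auto
  moreover have "Suc (Z * Z div (B1 * regs s r_size)) < 2 ^ w"
    using div_le_dividend[of "Z * Z" "B1 * regs s r_size"] no_overflow Z_ge by linarith
  ultimately show ?thesis using assms(1) no_overflow w_pos by (simp add: tau_def params_def)
qed

lemma wp_expand_if_inner:
  assumes params: "params (regs s)" and seeds: "seeds_in (mem s) sd"
    and elems: "reads inp (regs s r_elems) xs" "regs s r_size = length xs" "regs s r_threshold = tau (length xs)"
    and node: "(regs s r_tag, regs s r_id) = q" "good_node q" and queue: "queued s Q"
  shows "wp w inp (if is_leaf q then skip else expand_node) (\<lambda>T s'. T \<le> 20 * length xs + 10 \<and>
      modifies {r_len, r_i, r_hash, r_void} {queue_at..<heads_at} s s' \<and>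
      queued s' (take cap (Q @ children sd xs q))) s"
proof (cases "is_leaf q")
  case True
  then have "take cap (Q @ children sd xs q) = Q" using queue by (simp add: children_def queued_def)
  then show ?thesis using True queue by (auto intro!: wp_skip)
next
  case False
  have "regs s r_tag < L * Suc k" "regs s r_id < Z" using node by (auto simp: good_node_def)
  from wp_expand_node[OF params seeds elems(1,2) this queue] show ?thesis
    using False by (simp add: children_def node(1) elems(3))
qed

lemma wp_expand_all:
  assumes params: "params (regs s)" and seeds: "seeds_in (mem s) sd"
    and elems: "reads inp (regs s r_elems) xs" "regs s r_size = length xs" "regs s r_threshold = tau (length xs)"
    and queue: "queued s roots"
  shows "wp w inp (for_nodes expand_node skip) (\<lambda>T s'. T \<le> cap * (20 * length xs + 40) + 3 \<and>
      modifies {r_len..r_void} {queue_at..<heads_at} s s' \<and> queued s' (queue sd xs)) s"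
proof -
  define Q_after where "Q_after = bfs cap (children sd xs) roots"
  define I where "I h t s' \<longleftrightarrow> t \<le> h * (20 * length xs + 40) \<and> modifies {r_len..r_void} {queue_at..<heads_at} s s' \<and>
    queued s' (Q_after h)" for h t s'
  have Q_after_Suc: "Q_after (Suc h) =
      take cap (Q_after h @ children sd xs (Q_after h ! h))" if "h < length (Q_after h)" for h
    using that by (simp add: Q_after_def Let_def)
  have params_I: "params (regs s')" if "I h t s'" for h t s'
    by (rule params_modifies[OF params]) (use that in \<open>auto simp: I_def\<close>)
  show ?thesis
  proof (rule wp_for_nodes[where I = I and Q = Q_after], goal_cases init frame params queued body exit)
    case init
    show ?case using queue by (simp add: I_def Q_after_def)
  next
    case (frame h t s' s'')
    have "queued s'' (Q_after h)" by (rule queued_modifies[OF _ frame(2)]) (use frame(1) in \<open>auto simp: I_def\<close>)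
    then show ?case using frame by (auto simp: I_def intro: modifies_trans)
  next
    case (body h t s1)
    have frame_s1: "modifies {r_len..r_void} {queue_at..<heads_at} s s1" and time: "t \<le> h * (20 * length xs + 40)"
      using body(1) by (auto simp: I_def)
    have seeds_s1: "seeds_in (mem s1) sd"
      using seeds by (rule seeds_in_cong) (use frame_s1 in \<open>simp add: modifies_def\<close>)
    have elems_s1: "reads inp (regs s1 r_elems) xs" "regs s1 r_size = length xs"
      "regs s1 r_threshold = tau (length xs)"
      using elems frame_s1 by (simp_all add: modifies_def)
    have good: "good_node (Q_after h ! h)" using good_bfs nth_mem[OF body(3)] unfolding Q_after_def by blast
    show ?case
      by (rule wp_conseq[OF wp_expand_if_inner[OF params_I[OF body(1)] seeds_s1 elems_s1 body(5) good body(2)]])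
        (use frame_s1 time body(4) in \<open>auto simp: I_def Q_after_Suc[OF body(3)] modifies_regs
          intro: modifies_trans\<close>)
  next
    case (exit h t s')
    then have "length (Q_after h) \<le> h" by (simp add: I_def queued_def)
    then have "queue sd xs = Q_after h" unfolding queue_def Q_after_def using exit(3) by (intro bfs_stable)
    moreover have "h * (20 * length xs + 40) \<le> cap * (20 * length xs + 40)"
      using exit(3) by (rule mult_right_mono) simp
    ultimately show ?case using exit(1) by (auto simp: I_def intro: le_trans)
  qed (auto intro: params_I simp: I_def)
qed

lemma wp_generate:
  assumes params: "params (regs s)" and seeds: "seeds_in (mem s) sd"
    and elems: "reads inp (regs s r_elems) xs" "regs s r_size = length xs"
  shows "wp w inp generate (\<lambda>T s'. T \<le> cap * (20 * length xs + 100) + 100 \<and>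
      modifies {r_threshold..r_void} {queue_at..<heads_at} s s' \<and> queued s' (queue sd xs)) s"
proof -
  define s1 where "s1 = s\<lparr>regs := (regs s)(r_threshold := tau (length xs))\<rparr>"
  have "length xs \<le> Z" using elems by (auto simp: reads_def)
  then have threshold: "eval w inp s (Reg r_scale *\<^sub>e Reg r_scale div\<^sub>e (Reg r_B1 *\<^sub>e Reg r_size) +\<^sub>e Const 1) =
      tau (length xs)"
    using eval_threshold[OF params] elems(2) by simp
  have frame_s1: "modifies {r_threshold..r_void} {queue_at..<heads_at} s s1" by (simp add: s1_def)
  have params_s1: "params (regs s1)" by (rule params_modifies[OF params frame_s1]) auto
  show ?thesis unfolding generate_def
  proof (rule wp_seq_assign[OF threshold s1_def], rule wp_seq, rule wp_conseq[OF wp_push_roots[OF params_s1]],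
      elim conjE, goal_cases after)
    case (after T2 s2)
    have frame_s2: "modifies {r_threshold..r_void} {queue_at..<heads_at} s s2"
      by (rule modifies_trans[OF frame_s1 after(2)]) auto
    have params_s2: "params (regs s2)" by (rule params_modifies[OF params frame_s2]) auto
    have seeds_s2: "seeds_in (mem s2) sd"
      using seeds by (rule seeds_in_cong) (use frame_s2 in \<open>simp add: modifies_def\<close>)
    have elems_s2: "reads inp (regs s2 r_elems) xs" "regs s2 r_size = length xs"
      "regs s2 r_threshold = tau (length xs)"
      using elems after(2) by (simp_all add: modifies_def s1_def)
    show ?case
    proof (rule wp_conseq[OF wp_expand_all[OF params_s2 seeds_s2 elems_s2 after(3)]], elim conjE,
        goal_cases after)
      case (after T3 s3)
      have "modifies {r_threshold..r_void} {queue_at..<heads_at} s s3"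
        by (rule modifies_trans[OF frame_s2 after(2)]) auto
      moreover have "cap * (20 * length xs + 100) = cap * (20 * length xs + 40) + 60 * cap"
        by (simp add: algebra_simps)
      ultimately show ?case using after(1,3) \<open>T2 \<le> 10 * cap + 10\<close> by (intro conjI) linarith+
    qed
  qed
qed

end

subsection \<open>Inserting the sets\<close>

definition bucket_of :: exp where
  "bucket_of = hash_of (Reg r_queue -\<^sub>e Const 2) (Reg r_queue -\<^sub>e Const 1) (Reg r_id *\<^sub>e Reg r_scale +\<^sub>e Reg r_tag)
    mod\<^sub>e Reg r_buckets"

definition insert_leaf :: com where
  "insert_leaf =
    (r_bucket ::= bucket_of) ;;
    (r_last ::= Reg r_last +\<^sub>e Const 1) ;;
    Store (Reg r_entries +\<^sub>e Const 2 *\<^sub>e Reg r_last) (Reg r_sets +\<^sub>e Reg r_pos) ;;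
    Store (Reg r_entries +\<^sub>e Const 2 *\<^sub>e Reg r_last +\<^sub>e Const 1) (Mem (Reg r_heads +\<^sub>e Reg r_bucket)) ;;
    Store (Reg r_heads +\<^sub>e Reg r_bucket) (Reg r_last)"

definition copy_set :: com where
  "copy_set =
    (r_i ::= Const 0) ;;
    While (Reg r_i <\<^sub>e Reg r_size +\<^sub>e Const 1)
      (Store (Reg r_sets +\<^sub>e (Reg r_pos +\<^sub>e Reg r_i)) (Inp (Reg r_pos +\<^sub>e Reg r_i)) ;;
       (r_i ::= Reg r_i +\<^sub>e Const 1))"

definition insert_set :: com where
  "insert_set = copy_set ;; generate ;; for_nodes skip insert_leaf"

definition process_set :: com where
  "process_set =
    (r_size ::= Inp (Reg r_pos)) ;;
    (r_elems ::= Reg r_pos +\<^sub>e Const 1) ;;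
    insert_set ;;
    (r_pos ::= Reg r_pos +\<^sub>e (Reg r_size +\<^sub>e Const 1)) ;;
    (r_set ::= Reg r_set +\<^sub>e Const 1)"

definition process_sets :: com where
  "process_sets =
    (r_pos ::= Const 4) ;; (r_set ::= Const 0) ;; (r_last ::= Const 0) ;;
    While (Reg r_set <\<^sub>e Reg r_n) process_set"

text \<open>The input starts with four parameters.\<close>

fun set_pos :: "nat list list \<Rightarrow> nat \<Rightarrow> nat" where
  "set_pos xss 0 = 4"
| "set_pos xss (Suc i) = set_pos xss i + Suc (length (xss ! i))"

lemma set_pos_mono: "i \<le> j \<Longrightarrow> set_pos xss i \<le> set_pos xss j"
  by (induction j rule: dec_induct) auto

lemma set_pos_ge: "4 \<le> set_pos xss i"
  using set_pos_mono[of 0 i xss] by simp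

text \<open>Entries are numbered from 1, and 0 ends a chain: \<open>prev_entry es b e\<close> is the last entry of bucket \<open>b\<close>
  among the first \<open>e\<close>.\<close>

fun prev_entry :: "(nat \<times> nat) list \<Rightarrow> nat \<Rightarrow> nat \<Rightarrow> nat" where
  "prev_entry es b 0 = 0"
| "prev_entry es b (Suc e) = (if fst (es ! e) = b then Suc e else prev_entry es b e)"

lemma prev_entry_append: "e \<le> length es \<Longrightarrow> prev_entry (es @ es') b e = prev_entry es b e"
  by (induction e) (auto simp: nth_append)

context layout
begin

definition bucket :: "nat list \<Rightarrow> node \<Rightarrow> nat" where
  "bucket f p = hash w z (f ! 0) (f ! 1) (snd p * Z + fst p) mod buckets"

definition bucket_seed_in :: "(nat \<Rightarrow> nat) \<Rightarrow> nat list \<Rightarrow> bool" where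
  "bucket_seed_in m f \<longleftrightarrow> m (queue_at - 2) = f ! 0 \<and> m (queue_at - 1) = f ! 1"

lemma bucket_seed_in_cong: "bucket_seed_in m f \<Longrightarrow> (\<And>a. a < queue_at \<Longrightarrow> m' a = m a) \<Longrightarrow> bucket_seed_in m' f"
  by (simp add: bucket_seed_in_def queue_at_def)

definition table_in :: "(nat \<Rightarrow> nat) \<Rightarrow> (nat \<Rightarrow> nat) \<Rightarrow> (nat \<times> nat) list \<Rightarrow> bool" where
  "table_in m ad es \<longleftrightarrow>
    (\<forall>e<length es. m (entries_at + 2 * Suc e) = ad (snd (es ! e)) \<and>
      m (entries_at + 2 * Suc e + 1) = prev_entry es (fst (es ! e)) e) \<and>
    (\<forall>b<buckets. m (heads_at + b) = prev_entry es b (length es))"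

lemma table_in_push:
  assumes "table_in m ad es" "b < buckets"
  shows "table_in (m(entries_at + 2 * Suc (length es) := ad i,
      entries_at + 2 * Suc (length es) + 1 := m (heads_at + b), heads_at + b := Suc (length es))) ad
        (es @ [(b, i)])"
proof -
  have heads: "heads_at + b' < entries_at" if "b' < buckets" for b' using that memory_bounds by linarith
  show ?thesis using assms heads
    by (auto simp: table_in_def nth_append less_Suc_eq prev_entry_append dest: heads)
qed

lemma table_in_cong:
  "table_in m ad es \<Longrightarrow> length es \<le> buckets \<Longrightarrow> (\<And>a. heads_at \<le> a \<Longrightarrow> a < sets_at \<Longrightarrow> m' a = m a) \<Longrightarrow>
    table_in m' ad es"
  using memory_bounds(2,3) by (auto simp: table_in_def)

lemma bucket_less: "bucket f p < buckets"
  using memory_bounds by (simp add: bucket_def)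

lemma eval_bucket_of:
  assumes params: "params (regs s)" and node: "good_node (regs s r_tag, regs s r_id)"
    and bucket_seed: "bucket_seed_in (mem s) f"
  shows "eval w inp s bucket_of = bucket f (regs s r_tag, regs s r_id)"
proof -
  have "34 \<le> queue_at" "queue_at < 2 ^ w" using memory_bounds no_overflow by auto
  then have seeds: "eval w inp s (Reg r_queue -\<^sub>e Const 2) = queue_at - 2"
    "eval w inp s (Reg r_queue -\<^sub>e Const 1) = queue_at - 1"
    using params w_pos no_overflow Z_ge by (simp_all add: params_def mod_if)
  have less: "regs s r_id < Z" "regs s r_tag < Z" using node memory_bounds by (auto simp: good_node_def)
  have "regs s r_id * Z + Z \<le> Z * Z" using less mult_right_mono[of "Suc (regs s r_id)" Z Z] by simp
  then have key: "eval w inp s (Reg r_id *\<^sub>e Reg r_scale +\<^sub>e Reg r_tag) = regs s r_id * Z + regs s r_tag"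
    using params no_overflow less by (simp add: params_def)
  have "regs s r_divisor = 2 ^ (w - z)" using params by (simp add: params_def)
  then have "eval w inp s (hash_of (Reg r_queue -\<^sub>e Const 2) (Reg r_queue -\<^sub>e Const 1)
    (Reg r_id *\<^sub>e Reg r_scale +\<^sub>e Reg r_tag)) =
    hash w z (f ! 0) (f ! 1) (regs s r_id * Z + regs s r_tag)"
    using bucket_seed by (simp only: eval_hash_of seeds key bucket_seed_in_def)
  then show ?thesis using params by (simp add: bucket_of_def bucket_def params_def)
qed

lemma wp_insert_leaf:
  assumes params: "params (regs s)" and node: "good_node (regs s r_tag, regs s r_id)"
    and bucket_seed: "bucket_seed_in (mem s) f"
    and table: "table_in (mem s) ad es" "regs s r_last = length es" "length es < buckets"
    and address: "sets_at + regs s r_pos = ad i" "regs s r_pos \<le> N"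
  shows "wp w inp insert_leaf (\<lambda>T s'. modifies {r_last, r_bucket} {heads_at..<sets_at} s s' \<and>
      table_in (mem s') ad (es @ [(bucket f (regs s r_tag, regs s r_id), i)]) \<and>
      regs s' r_last = Suc (length es)) s"
proof -
  define b where "b = bucket f (regs s r_tag, regs s r_id)"
  have b_less: "b < buckets" by (simp add: b_def bucket_less)
  have eval_b: "eval w inp s bucket_of = b" unfolding b_def by (rule eval_bucket_of[OF params node bucket_seed])
  let ?entry = "entries_at + 2 * Suc (length es)"
  have addresses: "?entry + 1 < sets_at" "sets_at + N \<le> Z" "heads_at + b < entries_at"
    using table(3) b_less memory_bounds by auto
  then have small: "?entry + 1 < 2 ^ w" "2 * Suc (length es) < 2 ^ w" "Suc (length es) < 2 ^ w"
    "sets_at + regs s r_pos < 2 ^ w" "heads_at + b < 2 ^ w" "2 < (2::nat) ^ w"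
    using no_overflow Z_ge address(2) by auto
  let ?m = "(mem s)(?entry := ad i, ?entry + 1 := mem s (heads_at + b), heads_at + b := Suc (length es))"
  let ?s = "s\<lparr>regs := (regs s)(r_bucket := b, r_last := Suc (length es)), mem := ?m\<rparr>"
  have "heads_at + b \<noteq> ?entry" "heads_at \<le> ?entry" using addresses memory_bounds(2) by linarith+
  moreover from this have "modifies {r_last, r_bucket} {heads_at..<sets_at} s ?s"
    using addresses by (auto simp: modifies_def)
  moreover have "table_in ?m ad (es @ [(b, i)])" by (rule table_in_push[OF table(1) b_less])
  moreover have "regs s r_entries = entries_at" "regs s r_heads = heads_at" "regs s r_sets = sets_at"
    using params by (auto simp: params_def)
  ultimately show ?thesis
    unfolding insert_leaf_def b_def[symmetric] using small w_pos table(2) address(1)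
    by (intro wp_seq_assign[OF eval_b refl] wp_seq wp_assign wp_store) (simp add: fun_upd_twist)
qed

definition leaf_entries :: "nat list \<Rightarrow> nat \<Rightarrow> node list \<Rightarrow> (nat \<times> nat) list" where
  "leaf_entries f i Q = map (\<lambda>p. (bucket f p, i)) (filter is_leaf Q)"

lemma length_leaf_entries: "length (leaf_entries f i Q) \<le> length Q"
  by (simp add: leaf_entries_def)

lemma wp_insert_if_leaf:
  assumes params: "params (regs s)" and bucket_seed: "bucket_seed_in (mem s) f"
    and node: "(regs s r_tag, regs s r_id) = q" "good_node q"
    and table: "table_in (mem s) ad es" "regs s r_last = length es" "length es < buckets"
    and address: "sets_at + regs s r_pos = ad i" "regs s r_pos \<le> N"
  shows "wp w inp (if is_leaf q then insert_leaf else skip) (\<lambda>T s'.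
      modifies {r_last, r_void, r_bucket} {heads_at..<sets_at} s s' \<and>
      table_in (mem s') ad (es @ leaf_entries f i [q]) \<and> regs s' r_last = length (es @ leaf_entries f i [q])) s"
proof (cases "is_leaf q")
  case True
  then have "leaf_entries f i [q] = [(bucket f (regs s r_tag, regs s r_id), i)]"
    using node by (simp add: leaf_entries_def)
  moreover have "good_node (regs s r_tag, regs s r_id)" using node by simp
  ultimately show ?thesis
    using True by (auto intro!: wp_conseq[OF wp_insert_leaf[OF params _ bucket_seed table address]]
      elim: modifies_trans[OF _ modifies_refl])
next
  case False
  then show ?thesis using table by (auto simp: leaf_entries_def intro!: wp_skip)
qed

lemma wp_insert_leaves:
  assumes params: "params (regs s)" and bucket_seed: "bucket_seed_in (mem s) f"
    and queue: "queued s Q" "\<forall>q\<in>set Q. good_node q"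
    and table: "table_in (mem s) ad es" "regs s r_last = length es" "length es + length Q \<le> buckets"
    and address: "sets_at + regs s r_pos = ad i" "regs s r_pos \<le> N"
  shows "wp w inp (for_nodes skip insert_leaf) (\<lambda>T s'.
      modifies {r_last, r_node, r_tag, r_id, r_void, r_bucket} {heads_at..<sets_at} s s' \<and>
      table_in (mem s') ad (es @ leaf_entries f i Q) \<and> regs s' r_last = length (es @ leaf_entries f i Q)) s"
proof -
  define es_after where "es_after h = es @ leaf_entries f i (take h Q)" for h
  define I where "I h t s' \<longleftrightarrow> modifies {r_last, r_node, r_tag, r_id, r_void, r_bucket} {heads_at..<sets_at} s s' \<and>
    table_in (mem s') ad (es_after h) \<and> regs s' r_last = length (es_after h)" for h and t :: nat and s'
  have queued: "queued s' Q" if "I h t s'" for h t s'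
    by (rule queued_modifies[OF queue(1)]) (use that in \<open>auto simp: I_def\<close>)
  have params_I: "params (regs s')" if "I h t s'" for h t s'
    by (rule params_modifies[OF params]) (use that in \<open>auto simp: I_def\<close>)
  show ?thesis
  proof (rule wp_for_nodes[where I = I and Q = "\<lambda>_. Q"], goal_cases init frame params queued body exit)
    case init
    show ?case using table by (simp add: I_def es_after_def leaf_entries_def)
  next
    case (frame h t s' s'')
    then have "mem s'' = mem s'" by (auto simp: modifies_def)
    with frame show ?case by (auto simp: I_def intro: modifies_trans simp: modifies_regs)
  next
    case (body h t s1)
    then have es_after_Suc: "es_after (Suc h) = es_after h @ leaf_entries f i [Q ! h]"
      by (simp add: es_after_def leaf_entries_def take_Suc_conv_app_nth)
    have frame_s1: "modifies {r_last, r_node, r_tag, r_id, r_void, r_bucket} {heads_at..<sets_at} s s1"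
      and table_s1: "table_in (mem s1) ad (es_after h)" "regs s1 r_last = length (es_after h)"
      using body(1) by (auto simp: I_def)
    have bucket_seed_s1: "bucket_seed_in (mem s1) f"
      using bucket_seed by (rule bucket_seed_in_cong) (use frame_s1 memory_bounds in \<open>auto simp: modifies_def\<close>)
    have node: "(regs s1 r_tag, regs s1 r_id) = Q ! h" "good_node (Q ! h)" using body queue(2) by simp_all
    have "length (leaf_entries f i (take h Q)) \<le> h" using length_leaf_entries[of f i "take h Q"] by simp
    then have room: "length (es_after h) < buckets" using table(3) body(3) by (simp add: es_after_def)
    have address_s1: "sets_at + regs s1 r_pos = ad i" "regs s1 r_pos \<le> N"
      using address frame_s1 by (simp_all add: modifies_def)
    show ?case
      by (rule wp_conseq[OF wp_insert_if_leaf[OF params_I[OF body(1)] bucket_seed_s1 node table_s1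
        room address_s1]])
        (use frame_s1 es_after_Suc body(4) in \<open>auto simp: I_def modifies_regs intro: modifies_trans\<close>)
  next
    case (exit h t s')
    then have "length Q \<le> h" using queued[OF exit(1)] by (simp add: queued_def)
    then show ?case using exit(1) by (simp add: I_def es_after_def)
  qed (use params_I queued in blast)+
qed

lemma wp_insert_paths:
  assumes params: "params (regs s)" and seeds: "seeds_in (mem s) sd" and bucket_seed: "bucket_seed_in (mem s) f"
    and elems: "reads inp (regs s r_elems) xs" "regs s r_size = length xs"
    and table: "table_in (mem s) ad es" "regs s r_last = length es" "length es + cap \<le> buckets"
    and address: "sets_at + regs s r_pos = ad i" "regs s r_pos \<le> N"
  shows "wp w inp (generate ;; for_nodes skip insert_leaf) (\<lambda>T s'.
      modifies ({r_last} \<union> {r_threshold..r_bucket}) {queue_at..<sets_at} s s' \<and>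
      table_in (mem s') ad (es @ leaf_entries f i (queue sd xs)) \<and>
      regs s' r_last = length (es @ leaf_entries f i (queue sd xs))) s"
proof (rule wp_seq, rule wp_conseq[OF wp_generate[OF params seeds elems]], elim conjE, goal_cases after)
  case (after T1 s1)
  note frame_s1 = after(2) and queue_s1 = after(3)
  have bounds: "queue_at \<le> heads_at" "heads_at \<le> entries_at" "entries_at \<le> sets_at"
    using memory_bounds by linarith+
  have mem_s1: "mem s1 a = mem s a" if "a < queue_at \<or> heads_at \<le> a" for a
    using that frame_s1 by (auto simp: modifies_def)
  have params_s1: "params (regs s1)" by (rule params_modifies[OF params frame_s1]) auto
  have bucket_seed_s1: "bucket_seed_in (mem s1) f"
    using bucket_seed by (rule bucket_seed_in_cong) (simp add: mem_s1)
  have room: "length es + length (queue sd xs) \<le> buckets" using table(3) length_queue[of sd xs] by linarith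
  have table_s1: "table_in (mem s1) ad es" using table(1) by (rule table_in_cong) (use table(3) mem_s1 in auto)
  have regs_s1: "regs s1 r_last = length es" "sets_at + regs s1 r_pos = ad i" "regs s1 r_pos \<le> N"
    using table(2) address frame_s1 by (simp_all add: modifies_def)
  have good: "\<forall>q\<in>set (queue sd xs). good_node q" using good_queue by blast
  show ?case
    by (rule wp_conseq[OF wp_insert_leaves[OF params_s1 bucket_seed_s1 queue_s1 good table_s1 regs_s1(1)
      room regs_s1(2,3)]])
      (use frame_s1 bounds in \<open>auto simp: modifies_def\<close>)
qed

lemma wp_copy_set:
  assumes params: "params (regs s)" and fits: "regs s r_pos + regs s r_size < N" "length inp = N"
  shows "wp w inp copy_set (\<lambda>T s'.
      modifies {r_i} {sets_at + regs s r_pos..sets_at + regs s r_pos + regs s r_size} s s' \<and>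
      (\<forall>j \<le> regs s r_size. mem s' (sets_at + regs s r_pos + j) = inp ! (regs s r_pos + j))) s"
proof -
  define I where "I s' \<longleftrightarrow> regs s' r_i \<le> Suc (regs s r_size) \<and>
      modifies {r_i} {sets_at + regs s r_pos..sets_at + regs s r_pos + regs s r_size} s s' \<and>
      (\<forall>j < regs s' r_i. mem s' (sets_at + regs s r_pos + j) = inp ! (regs s r_pos + j))" for s'
  have small: "sets_at + N < 2 ^ w" "regs s r_size + 1 < 2 ^ w" "1 < (2::nat) ^ w"
    using memory_bounds no_overflow fits Z_ge by auto
  show ?thesis unfolding copy_set_def
  proof (rule wp_seq, rule wp_assign,
      rule wp_while_measure[where I = I and V = "\<lambda>s'. Suc (regs s r_size) - regs s' r_i"],
      goal_cases init step exit)
    case init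
    show ?case by (simp add: I_def)
  next
    case (step s1)
    then show ?case
      by (intro wp_seq wp_assign wp_store)
        (use small params fits in \<open>auto simp: I_def params_def modifies_def Let_def less_Suc_eq\<close>)
  next
    case (exit T s')
    then show ?case using small w_pos by (auto simp: I_def modifies_def less_Suc_eq_le)
  qed
qed

definition sets_in :: "nat list \<Rightarrow> nat list list \<Rightarrow> bool" where
  "sets_in inp xss \<longleftrightarrow> length xss = n \<and> length inp = N \<and> set_pos xss n = N \<and>
    (\<forall>i<n. inp ! set_pos xss i = length (xss ! i) \<and> reads inp (set_pos xss i + 1) (xss ! i))"

lemma set_pos_less:
  assumes "sets_in inp xss" "i < n"
  shows "set_pos xss i + Suc (length (xss ! i)) \<le> N"
  using set_pos_mono[of "Suc i" n xss] assms by (simp add: sets_in_def)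

definition entries :: "nat list \<Rightarrow> nat list \<Rightarrow> nat list list \<Rightarrow> nat \<Rightarrow> (nat \<times> nat) list" where
  "entries sd f xss i = concat (map (\<lambda>j. leaf_entries f j (queue sd (xss ! j))) [0..<i])"

lemma entries_0: "entries sd f xss 0 = []"
  by (simp add: entries_def)

lemma entries_Suc: "entries sd f xss (Suc i) = entries sd f xss i @ leaf_entries f i (queue sd (xss ! i))"
  by (simp add: entries_def)

lemma length_entries: "length (entries sd f xss i) \<le> i * cap"
proof (induction i)
  case (Suc i)
  have "length (leaf_entries f i (queue sd (xss ! i))) \<le> cap"
    using length_leaf_entries length_queue by (rule le_trans)
  then show ?case using Suc by (simp add: entries_Suc)
qed (simp add: entries_0)

lemma length_entries_room: "i < n \<Longrightarrow> length (entries sd f xss i) + cap \<le> buckets"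
  using length_entries[of sd f xss i] mult_right_mono[of "Suc i" n cap] by (simp add: buckets_def)

abbreviation set_at :: "nat list list \<Rightarrow> nat \<Rightarrow> nat" where
  "set_at xss i \<equiv> sets_at + set_pos xss i"

definition structure_in :: "(nat \<Rightarrow> nat) \<Rightarrow> nat list \<Rightarrow> nat list \<Rightarrow> nat list \<Rightarrow> nat list list \<Rightarrow> nat \<Rightarrow> bool" where
  "structure_in m sd f inp xss i \<longleftrightarrow> params m \<and> seeds_in m sd \<and> bucket_seed_in m f \<and>
    table_in m (set_at xss) (entries sd f xss i) \<and>
    (\<forall>p. 4 \<le> p \<and> p < set_pos xss i \<longrightarrow> m (sets_at + p) = inp ! p) \<and>
    (\<forall>a \<ge> set_at xss i. m a = 0)"

lemma structure_in_0:
  assumes "params m" "seeds_in m sd" "bucket_seed_in m f" "\<forall>a\<ge>queue_at. m a = 0"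
  shows "structure_in m sd f inp xss 0"
proof -
  have "queue_at \<le> heads_at" "queue_at \<le> sets_at" using memory_bounds by linarith+
  then show ?thesis using assms by (auto simp: structure_in_def table_in_def entries_0)
qed

lemma structure_in_Suc:
  assumes stored: "structure_in m sd f inp xss i"
    and frame: "\<And>a. a < queue_at \<Longrightarrow> m' a = m a"
      "\<And>a. sets_at \<le> a \<Longrightarrow> a \<notin> {set_at xss i..set_at xss i + length (xss ! i)} \<Longrightarrow> m' a = m a"
    and table: "table_in m' (set_at xss) (entries sd f xss (Suc i))"
    and copied: "\<And>j. j \<le> length (xss ! i) \<Longrightarrow> m' (set_at xss i + j) = inp ! (set_pos xss i + j)"
  shows "structure_in m' sd f inp xss (Suc i)"
  unfolding structure_in_def
proof (intro conjI allI impI)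
  have low: "34 \<le> queue_at" using memory_bounds by linarith
  show "params m'" by (rule params_cong[of m]) (use stored frame(1) low in \<open>auto simp: structure_in_def\<close>)
  show "seeds_in m' sd" by (rule seeds_in_cong[of m]) (use stored frame(1) in \<open>auto simp: structure_in_def\<close>)
  show "bucket_seed_in m' f"
    by (rule bucket_seed_in_cong[of m]) (use stored frame(1) in \<open>auto simp: structure_in_def\<close>)
  show "m' (sets_at + p) = inp ! p" if p: "4 \<le> p \<and> p < set_pos xss (Suc i)" for p
  proof (cases "p < set_pos xss i")
    case True
    then show ?thesis using p stored frame(2)[of "sets_at + p"] by (auto simp: structure_in_def)
  next
    case False
    then obtain j where "p = set_pos xss i + j" "j \<le> length (xss ! i)"
      using p le_Suc_ex[of "set_pos xss i" p] by auto
    then show ?thesis using copied[of j] by (simp add: add.assoc)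
  qed
  show "m' a = 0" if "set_at xss (Suc i) \<le> a" for a
    using that stored frame(2)[of a] by (auto simp: structure_in_def)
qed (rule table)

lemma structure_in_cong_below:
  assumes stored: "structure_in m sd f inp xss i" and i: "i < n"
    and agree: "\<And>a. a < set_at xss i \<Longrightarrow> m' a = m a"
  shows "seeds_in m' sd" "bucket_seed_in m' f" "table_in m' (set_at xss) (entries sd f xss i)"
proof -
  have bounds: "queue_at \<le> heads_at" "heads_at \<le> sets_at" using memory_bounds by linarith+
  have parts: "seeds_in m sd" "bucket_seed_in m f" "table_in m (set_at xss) (entries sd f xss i)"
    using stored by (auto simp: structure_in_def)
  show "seeds_in m' sd" by (rule seeds_in_cong[OF parts(1)]) (use agree bounds in auto)
  show "bucket_seed_in m' f" by (rule bucket_seed_in_cong[OF parts(2)]) (use agree bounds in auto)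
  show "table_in m' (set_at xss) (entries sd f xss i)"
    by (rule table_in_cong[OF parts(3)]) (use agree length_entries_room[OF i, of sd f xss] in auto)
qed

lemma wp_insert_set:
  assumes params: "params (regs s)" and stored: "structure_in (mem s) sd f inp xss i"
    and regs: "regs s r_last = length (entries sd f xss i)" "regs s r_pos = set_pos xss i"
      "regs s r_size = length (xss ! i)" "regs s r_elems = set_pos xss i + 1"
    and xss: "sets_in inp xss" and i: "i < n"
  shows "wp w inp insert_set (\<lambda>T s'. modifies ({r_last} \<union> {r_threshold..r_bucket}) UNIV s s' \<and>
      regs s' r_last = length (entries sd f xss (Suc i)) \<and> structure_in (mem s') sd f inp xss (Suc i)) s"
proof -
  define xs where "xs = xss ! i"
  have elems: "reads inp (set_pos xss i + 1) xs" "length inp = N" using xss i by (auto simp: sets_in_def xs_def)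
  have fits: "regs s r_pos + regs s r_size < N" using set_pos_less[OF xss i] regs by simp
  have bounds: "queue_at \<le> heads_at" "heads_at \<le> sets_at" using memory_bounds by linarith+
  show ?thesis unfolding insert_set_def
  proof (rule wp_seq, rule wp_conseq[OF wp_copy_set[OF params fits elems(2)]], elim conjE, goal_cases after)
    case (after T1 s1)
    note copied = after(2)
    have frame_s1: "modifies {r_i} {set_at xss i..set_at xss i + length xs} s s1"
      using after(1) regs by (simp add: xs_def)
    have mem_s1: "mem s1 a = mem s a" if "a < set_at xss i" for a using that frame_s1 by (auto simp: modifies_def)
    have params_s1: "params (regs s1)" by (rule params_modifies[OF params frame_s1]) simp
    have parts_s1: "seeds_in (mem s1) sd" "bucket_seed_in (mem s1) f"
      "table_in (mem s1) (set_at xss) (entries sd f xss i)"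
      by (rule structure_in_cong_below[OF stored i], erule mem_s1)+
    have elems_s1: "reads inp (regs s1 r_elems) xs" "regs s1 r_size = length xs"
      using elems regs frame_s1 by (auto simp: modifies_def xs_def)
    have last_s1: "regs s1 r_last = length (entries sd f xss i)" using regs frame_s1 by (simp add: modifies_def)
    have address_s1: "sets_at + regs s1 r_pos = set_at xss i" "regs s1 r_pos \<le> N"
      using regs fits frame_s1 by (simp_all add: modifies_def)
    show ?case
    proof (rule wp_conseq[OF wp_insert_paths[OF params_s1 parts_s1(1,2) elems_s1 parts_s1(3) last_s1
      length_entries_room[OF i] address_s1]],
        elim conjE, goal_cases after)
      case (after T2 s2)
      have mem_s2: "mem s2 a = mem s1 a" if "a < queue_at \<or> sets_at \<le> a" for a
        using that after(1) by (auto simp: modifies_def)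
      have "structure_in (mem s2) sd f inp xss (Suc i)"
      proof (rule structure_in_Suc[OF stored])
        show "mem s2 a = mem s a" if "a < queue_at" for a using that bounds by (simp add: mem_s1 mem_s2)
        show "mem s2 a = mem s a" if "sets_at \<le> a" "a \<notin> {set_at xss i..set_at xss i + length (xss ! i)}" for a
          using that frame_s1 by (auto simp: mem_s2 modifies_def xs_def)
        show "mem s2 (set_at xss i + j) = inp ! (set_pos xss i + j)" if "j \<le> length (xss ! i)" for j
          using that copied regs by (simp add: mem_s2)
      qed (use after(2) in \<open>simp add: entries_Suc xs_def\<close>)
      moreover have "modifies ({r_last} \<union> {r_threshold..r_bucket}) UNIV s s2"
        using frame_s1 after(1) by (auto simp: modifies_def)
      ultimately show ?case using after(3) by (simp add: entries_Suc xs_def)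
    qed
  qed
qed

definition processed :: "nat list \<Rightarrow> nat list \<Rightarrow> nat list \<Rightarrow> nat list list \<Rightarrow> nat \<Rightarrow> store \<Rightarrow> bool" where
  "processed sd f inp xss i s \<longleftrightarrow> params (regs s) \<and> regs s r_set = i \<and> regs s r_pos = set_pos xss i \<and>
    regs s r_last = length (entries sd f xss i) \<and> structure_in (mem s) sd f inp xss i"

lemma wp_process_set:
  assumes processed: "processed sd f inp xss i s" and xss: "sets_in inp xss" and i: "i < n"
  shows "wp w inp process_set (\<lambda>T. processed sd f inp xss (Suc i)) s"
proof -
  have header: "inp ! set_pos xss i = length (xss ! i)" "length inp = N" using xss i by (auto simp: sets_in_def)
  have fits: "set_pos xss i + Suc (length (xss ! i)) \<le> N" by (rule set_pos_less[OF xss i])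
  then have small: "set_pos xss i + Suc (length (xss ! i)) < 2 ^ w" "Suc (length (xss ! i)) < 2 ^ w"
    "i + 1 < 2 ^ w"
    using memory_bounds no_overflow i by auto
  define s1 where "s1 = s\<lparr>regs := (regs s)(r_size := length (xss ! i))\<rparr>"
  define s2 where "s2 = s1\<lparr>regs := (regs s1)(r_elems := set_pos xss i + 1)\<rparr>"
  have size: "eval w inp s (Inp (Reg r_pos)) = length (xss ! i)"
    using processed header fits by (simp add: processed_def)
  have elems: "eval w inp s1 (Reg r_pos +\<^sub>e Const 1) = set_pos xss i + 1"
    using processed small w_pos by (simp add: processed_def s1_def)
  have frame_s2: "modifies {r_size, r_elems} {} s s2" by (simp add: s1_def s2_def)
  have state_s2: "params (regs s2)" "structure_in (mem s2) sd f inp xss i"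
    "regs s2 r_last = length (entries sd f xss i)"
    "regs s2 r_pos = set_pos xss i" "regs s2 r_size = length (xss ! i)" "regs s2 r_elems = set_pos xss i + 1"
    using processed params_modifies[OF _ frame_s2] by (auto simp: processed_def s1_def s2_def)
  show ?thesis unfolding process_set_def
  proof (rule wp_seq_assign[OF size s1_def], rule wp_seq_assign[OF elems s2_def], rule wp_seq,
      rule wp_conseq[OF wp_insert_set[OF state_s2 xss i]], elim conjE, goal_cases after)
    case (after T3 s3)
    have regs3: "regs s3 r_pos = set_pos xss i" "regs s3 r_size = length (xss ! i)" "regs s3 r_set = i"
      using after(1) state_s2 processed by (simp_all add: modifies_def processed_def s1_def s2_def)
    have params_s3: "params (regs s3)" by (rule params_modifies[OF state_s2(1) after(1)]) auto
    then have "params ((regs s3)(r_pos := set_pos xss (Suc i), r_set := Suc i))" by (rule params_cong) auto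
    then show ?case
      using regs3 small w_pos after(2,3) by (intro wp_seq wp_assign) (simp add: processed_def)
  qed
qed

lemma wp_process_sets:
  assumes "params (regs s)" "params (mem s)" "seeds_in (mem s) sd" "bucket_seed_in (mem s) f"
    and "\<forall>a\<ge>queue_at. mem s a = 0" and xss: "sets_in inp xss"
  shows "wp w inp process_sets (\<lambda>T s'. structure_in (mem s') sd f inp xss n) s"
proof -
  define I where "I s' \<longleftrightarrow> regs s' r_set \<le> n \<and> processed sd f inp xss (regs s' r_set) s'" for s'
  have small: "4 < (2::nat) ^ w" using no_overflow Z_ge by auto
  have empty: "structure_in (mem s) sd f inp xss 0" using assms(2-5) by (rule structure_in_0)
  have start: "params ((regs s)(r_pos := 4, r_set := 0, r_last := 0))" using assms(1) by (rule params_cong) auto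
  show ?thesis unfolding process_sets_def
  proof (rule wp_seq, rule wp_assign, rule wp_seq, rule wp_assign, rule wp_seq, rule wp_assign,
      rule wp_while_measure[where I = I and V = "\<lambda>s'. n - regs s' r_set"], goal_cases init step exit)
    case init
    show ?case using empty start small by (simp add: I_def processed_def entries_0)
  next
    case (step s1)
    have processed_s1: "processed sd f inp xss (regs s1 r_set) s1" using step(1) by (simp add: I_def)
    then have i: "regs s1 r_set < n" using step(2) by (simp add: processed_def params_def)
    show ?case
      by (rule wp_conseq[OF wp_process_set[OF processed_s1 xss i]]) (use i in \<open>auto simp: I_def processed_def\<close>)
  next
    case (exit T s')
    then have "regs s' r_set = n" by (auto simp: I_def processed_def params_def)
    then show ?case using exit(1) by (simp add: I_def processed_def)
  qed
qed

end

subsection \<open>The query\<close>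

definition merge_step :: com where
  "merge_step =
    (r_x ::= Mem (Reg r_cand +\<^sub>e Const 1 +\<^sub>e Reg r_i)) ;;
    (r_y ::= Inp (Const 1 +\<^sub>e Reg r_j)) ;;
    (r_common ::= Reg r_common +\<^sub>e (Reg r_x =\<^sub>e Reg r_y)) ;;
    (r_i ::= Reg r_i +\<^sub>e Const 1 -\<^sub>e (Reg r_y <\<^sub>e Reg r_x)) ;;
    (r_j ::= Reg r_j +\<^sub>e Const 1 -\<^sub>e (Reg r_x <\<^sub>e Reg r_y))"

definition merge_count :: com where
  "merge_count =
    (r_i ::= Const 0) ;; (r_j ::= Const 0) ;; (r_common ::= Const 0) ;;
    While (Reg r_i <\<^sub>e Reg r_cand_size \<and>\<^sub>e Reg r_j <\<^sub>e Reg r_size) merge_step"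

definition load_candidate :: com where
  "load_candidate =
    (r_count ::= Reg r_count +\<^sub>e Const 1) ;;
    (r_cand ::= Mem (Reg r_entries +\<^sub>e Const 2 *\<^sub>e Reg r_entry)) ;;
    (r_cand_size ::= Mem (Reg r_cand))"

definition advance :: com where
  "advance =
    If (Reg r_count <\<^sub>e Const 40 *\<^sub>e Reg r_cap)
      (r_entry ::= Mem (Reg r_entries +\<^sub>e Const 2 *\<^sub>e Reg r_entry +\<^sub>e Const 1))
      ((r_entry ::= Const 0) ;; (r_len ::= Const 0))"

definition verify :: com where
  "verify =
    merge_count ;;
    If (Reg r_B2 *\<^sub>e Reg r_cand_size <\<^sub>e Reg r_common *\<^sub>e Reg r_scale \<and>\<^sub>e
        Reg r_B2 *\<^sub>e Reg r_size <\<^sub>e Reg r_common *\<^sub>e Reg r_scale)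
      ((r_result ::= Reg r_cand) ;; (r_entry ::= Const 0) ;; (r_len ::= Const 0))
      advance"

text \<open>The test rejects sets much larger than the query before the merge, which keeps the merge linear in
  the size of the query.\<close>

definition check_candidate :: com where
  "check_candidate =
    load_candidate ;;
    If (Reg r_B2 *\<^sub>e Reg r_cand_size <\<^sub>e Reg r_size *\<^sub>e Reg r_scale) verify advance"

definition scan_leaf :: com where
  "scan_leaf =
    (r_bucket ::= bucket_of) ;;
    (r_entry ::= Mem (Reg r_heads +\<^sub>e Reg r_bucket)) ;;
    While (Reg r_entry) check_candidate"

fun load_upto :: "nat \<Rightarrow> com" where
  "load_upto 0 = skip"
| "load_upto (Suc r) = load_upto r ;; (Suc r ::= Mem (Const (Suc r)))"

definition query_prog :: com where
  "query_prog =
    load_upto 13 ;; (r_size ::= Inp (Const 0)) ;; (r_elems ::= Const 1) ;; generate ;;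
    (r_count ::= Const 0) ;; for_nodes skip scan_leaf"

lemma wp_load_upto:
  "r < 2 ^ w \<Longrightarrow> wp w inp (load_upto r) (\<lambda>T s'. T \<le> 2 * r + 1 \<and> mem s' = mem s \<and>
    (\<forall>j. 1 \<le> j \<and> j \<le> r \<longrightarrow> regs s' j = mem s j)) s"
proof (induction r)
  case 0
  show ?case by (auto intro!: wp_skip)
next
  case (Suc r)
  show ?case unfolding load_upto.simps
    by (rule wp_seq, rule wp_conseq[OF Suc.IH])
      (use Suc.prems in \<open>auto intro!: wp_assign simp: le_Suc_eq\<close>)
qed

lemma eval_increment_unless:
  assumes "eval w inp s A = a" "eval w inp s B = of_bool P" "a + 1 < 2 ^ w"
  shows "eval w inp s (A +\<^sub>e Const 1 -\<^sub>e B) = a + of_bool (\<not> P)"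
proof -
  have "0 < w" using assms(3) by (cases w) auto
  then show ?thesis using assms by (cases P) (simp_all add: mod_if)
qed

lemma card_inter_merge:
  fixes x y :: nat
  assumes "sorted_wrt (<) (x # A)" "sorted_wrt (<) (y # B)"
  shows "card (set (x # A) \<inter> set (y # B)) =
    of_bool (x = y) + card (set (if y < x then x # A else A) \<inter> set (if x < y then y # B else B))"
proof (cases x y rule: linorder_cases)
  case less
  then have "x \<notin> set (y # B)" using assms by auto
  then show ?thesis using less by (simp add: Int_insert_left)
next
  case equal
  then have "set (x # A) \<inter> set (y # B) = insert x (set A \<inter> set B)" "x \<notin> set A" using assms by auto
  then show ?thesis using equal by simp
next
  case greater
  then have "y \<notin> set (x # A)" using assms by auto
  then show ?thesis using greater by (simp add: Int_insert_right)
qed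

lemma card_inter_drop_merge:
  fixes xs ys :: "nat list"
  assumes "sorted_wrt (<) xs" "sorted_wrt (<) ys" "i < length xs" "j < length ys"
  shows "card (set (drop i xs) \<inter> set (drop j ys)) = of_bool (xs ! i = ys ! j) +
    card (set (drop (i + of_bool (\<not> ys ! j < xs ! i)) xs) \<inter> set (drop (j + of_bool (\<not> xs ! i < ys ! j)) ys))"
proof -
  have drops: "drop i xs = xs ! i # drop (Suc i) xs" "drop j ys = ys ! j # drop (Suc j) ys"
    using assms by (simp_all add: Cons_nth_drop_Suc)
  moreover have "sorted_wrt (<) (drop i xs)" "sorted_wrt (<) (drop j ys)"
    using assms by (simp_all add: sorted_wrt_drop)
  ultimately show ?thesis
    using card_inter_merge[of "xs ! i" "drop (Suc i) xs" "ys ! j" "drop (Suc j) ys"] by simp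
qed

fun chain :: "(nat \<times> nat) list \<Rightarrow> nat \<Rightarrow> nat \<Rightarrow> nat list" where
  "chain es b 0 = []"
| "chain es b (Suc e) = (if fst (es ! e) = b then snd (es ! e) # chain es b e else chain es b e)"

lemma chain_prev_entry: "chain es b (prev_entry es b e) = chain es b e"
  by (induction e) auto

lemma prev_entry_le: "prev_entry es b e \<le> e"
  by (induction e) (auto simp: le_SucI)

lemma prev_entry_bucket: "prev_entry es b e = Suc e' \<Longrightarrow> fst (es ! e') = b"
  by (induction e) (auto split: if_splits)

lemma mset_chain: "e \<le> length es \<Longrightarrow> mset (chain es b e) = mset (map snd (filter (\<lambda>p. fst p = b) (take e es)))"
  by (induction e) (auto simp: take_Suc_conv_app_nth)

context layout
begin

definition accept :: "nat list \<Rightarrow> nat list \<Rightarrow> bool" where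
  "accept ys xs \<longleftrightarrow> B2 * length xs < card (set xs \<inter> set ys) * Z \<and> B2 * length ys < card (set xs \<inter> set ys) * Z"

definition set_in :: "(nat \<Rightarrow> nat) \<Rightarrow> nat \<Rightarrow> nat list \<Rightarrow> bool" where
  "set_in m a xs \<longleftrightarrow> m a = length xs \<and> (\<forall>j<length xs. m (a + 1 + j) = xs ! j) \<and>
    a + Suc (length xs) \<le> Z \<and> sorted_wrt (<) xs"

definition index_in :: "(nat \<Rightarrow> nat) \<Rightarrow> (nat \<Rightarrow> nat) \<Rightarrow> (nat \<times> nat) list \<Rightarrow> nat list list \<Rightarrow> bool" where
  "index_in m ad es xss \<longleftrightarrow> table_in m ad es \<and> length es \<le> buckets \<and> (\<forall>e<length es. snd (es ! e) < n) \<and>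
    (\<forall>i<n. set_in m (ad i) (xss ! i))"

definition candidates :: "(nat \<times> nat) list \<Rightarrow> nat list \<Rightarrow> node list \<Rightarrow> nat list" where
  "candidates es f Q = concat (map (\<lambda>p. if is_leaf p then chain es (bucket f p) (length es) else []) Q)"

definition search_outcome :: "(nat \<Rightarrow> nat) \<Rightarrow> nat list list \<Rightarrow> nat list \<Rightarrow> nat list \<Rightarrow> store \<Rightarrow> bool" where
  "search_outcome ad xss ys C s \<longleftrightarrow> (\<exists>i\<in>set C. accept ys (xss ! i) \<and> regs s r_result = ad i) \<or>
    (\<forall>i\<in>set (take (40 * cap) C). \<not> accept ys (xss ! i))"

lemma candidates_append: "candidates es f (A @ B) = candidates es f A @ candidates es f B"
  by (simp add: candidates_def)

end

abbreviation (input) "merge_regs \<equiv> {r_i, r_j, r_x, r_y, r_common}"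
abbreviation (input) "candidate_regs \<equiv> {r_result, r_len, r_entry, r_count, r_cand, r_cand_size} \<union> merge_regs"

text \<open>\<open>ad i\<close> is the address of set \<open>i\<close> in the memory \<open>m\<close>, and \<open>es\<close> lists the entries of its hash table.\<close>

locale index_scan = layout +
  fixes m ad :: "nat \<Rightarrow> nat" and es :: "(nat \<times> nat) list" and xss :: "nat list list" and inp ys :: "nat list"
    and size_ratio :: nat
  assumes index: "index_in m ad es xss" and ys: "reads inp 1 ys" "sorted_wrt (<) ys"
    and size_ratio: "Z \<le> size_ratio * B2"
begin

definition ready :: "store \<Rightarrow> bool" where
  "ready s \<longleftrightarrow> params (regs s) \<and> mem s = m \<and> regs s r_size = length ys"

lemma ready_modifies: "ready s \<Longrightarrow> modifies R {} s s' \<Longrightarrow> R \<inter> ({1..13} \<union> {r_size}) = {} \<Longrightarrow> ready s'"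
  using params_modifies[of s R "{}" s'] by (auto simp: ready_def modifies_def)

lemma length_ys: "Suc (length ys) \<le> Z" "Suc (length ys) \<le> length inp"
  using ys by (auto simp: reads_def)

definition loaded :: "store \<Rightarrow> nat list \<Rightarrow> bool" where
  "loaded s xs \<longleftrightarrow> ready s \<and> set_in m (regs s r_cand) xs \<and> regs s r_cand_size = length xs"

lemma loaded_modifies:
  assumes "loaded s xs" "modifies R {} s s'" "R \<inter> ({1..13} \<union> {r_size, r_cand, r_cand_size}) = {}"
  shows "loaded s' xs"
proof -
  have "ready s" using assms(1) by (simp add: loaded_def)
  moreover have "R \<inter> ({1..13} \<union> {r_size}) = {}" using assms(3) by blast
  ultimately have "ready s'" by (rule ready_modifies[OF _ assms(2)])
  moreover have "regs s' r_cand = regs s r_cand" "regs s' r_cand_size = regs s r_cand_size"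
    using assms(3) by (auto intro: modifies_regs[OF assms(2)])
  ultimately show ?thesis using assms(1) by (simp add: loaded_def)
qed

lemma wp_merge_step:
  assumes loaded: "loaded s xs" and i: "regs s r_i = i" "i < length xs" and j: "regs s r_j = j" "j < length ys"
    and common: "regs s r_common \<le> Z"
  shows "wp w inp merge_step (\<lambda>T s'. T = 9 \<and> modifies merge_regs {} s s' \<and>
      regs s' r_common = regs s r_common + of_bool (xs ! i = ys ! j) \<and>
      regs s' r_i = i + of_bool (\<not> ys ! j < xs ! i) \<and> regs s' r_j = j + of_bool (\<not> xs ! i < ys ! j)) s"
proof -
  have small: "regs s r_cand + 1 + i < 2 ^ w" "1 + j < 2 ^ w" "i + 1 < 2 ^ w" "regs s r_common + 1 < 2 ^ w"
    using loaded i j length_ys common no_overflow Z_ge by (auto simp: loaded_def set_in_def)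
  define s1 where "s1 = s\<lparr>regs := (regs s)(r_x := xs ! i)\<rparr>"
  define s2 where "s2 = s1\<lparr>regs := (regs s1)(r_y := ys ! j)\<rparr>"
  define s3 where "s3 = s2\<lparr>regs := (regs s2)(r_common := regs s r_common + of_bool (xs ! i = ys ! j))\<rparr>"
  define s4 where "s4 = s3\<lparr>regs := (regs s3)(r_i := i + of_bool (\<not> ys ! j < xs ! i))\<rparr>"
  have eval_x: "eval w inp s (Mem (Reg r_cand +\<^sub>e Const 1 +\<^sub>e Reg r_i)) = xs ! i"
    using loaded i small w_pos by (simp add: loaded_def ready_def set_in_def)
  have eval_y: "eval w inp s1 (Inp (Const 1 +\<^sub>e Reg r_j)) = ys ! j"
    using ys j length_ys small w_pos by (simp add: reads_def s1_def)
  have eval_common: "eval w inp s2 (Reg r_common +\<^sub>e (Reg r_x =\<^sub>e Reg r_y)) =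
      regs s r_common + of_bool (xs ! i = ys ! j)"
    using small by (simp add: s1_def s2_def)
  have eval_i: "eval w inp s3 (Reg r_i +\<^sub>e Const 1 -\<^sub>e (Reg r_y <\<^sub>e Reg r_x)) = i + of_bool (\<not> ys ! j < xs ! i)"
    by (rule eval_increment_unless) (use i small in \<open>simp_all add: s1_def s2_def s3_def\<close>)
  have eval_j: "eval w inp s4 (Reg r_j +\<^sub>e Const 1 -\<^sub>e (Reg r_x <\<^sub>e Reg r_y)) = j + of_bool (\<not> xs ! i < ys ! j)"
    by (rule eval_increment_unless) (use j small in \<open>simp_all add: s1_def s2_def s3_def s4_def\<close>)
  show ?thesis unfolding merge_step_def
    by (rule wp_seq_assign[OF eval_x s1_def], rule wp_seq_assign[OF eval_y s2_def],
      rule wp_seq_assign[OF eval_common s3_def],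
        rule wp_seq_assign[OF eval_i s4_def], rule wp_assign, unfold eval_j)
      (simp add: s1_def s2_def s3_def s4_def)
qed

lemma wp_merge_count:
  assumes loaded: "loaded s xs"
  shows "wp w inp merge_count (\<lambda>T s'. T \<le> 20 * (length xs + length ys) + 20 \<and> modifies merge_regs {} s s' \<and>
      regs s' r_common = card (set xs \<inter> set ys)) s"
proof -
  define I where "I s' \<longleftrightarrow> modifies merge_regs {} s s' \<and> regs s' r_i \<le> length xs \<and> regs s' r_j \<le> length ys \<and>
      regs s' r_common + card (set (drop (regs s' r_i) xs) \<inter> set (drop (regs s' r_j) ys)) =
        card (set xs \<inter> set ys)" for s'
  have sorted: "sorted_wrt (<) xs" using loaded by (simp add: loaded_def set_in_def)
  have "card (set xs \<inter> set ys) \<le> card (set ys)" by (intro card_mono) auto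
  also have "\<dots> \<le> Z" using card_length[of ys] length_ys by linarith
  finally have common_le: "card (set xs \<inter> set ys) \<le> Z" .
  show ?thesis unfolding merge_count_def
  proof (rule wp_seq, rule wp_assign, rule wp_seq, rule wp_assign, rule wp_seq, rule wp_assign,
      rule wp_while[where I = I and V = "\<lambda>s'. 20 * ((length xs - regs s' r_i) + (length ys - regs s' r_j))"],
      goal_cases init step exit)
    case init
    show ?case by (simp add: I_def)
  next
    case (step s1)
    have frame_s1: "modifies merge_regs {} s s1" using step(1) by (simp add: I_def)
    have loaded_s1: "loaded s1 xs" by (rule loaded_modifies[OF loaded frame_s1]) auto
    have less: "regs s1 r_i < length xs" "regs s1 r_j < length ys"
      using step(2) loaded_s1 by (auto simp: loaded_def ready_def)
    have "regs s1 r_common \<le> Z" using step(1) common_le by (simp add: I_def)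
    note merge_step = wp_merge_step[OF loaded_s1 refl less(1) refl less(2) this]
    show ?case
    proof (rule wp_conseq[OF merge_step], elim conjE, goal_cases after)
      case (after T2 s2)
      have "modifies merge_regs {} s s2" by (rule modifies_trans[OF frame_s1 after(2)]) auto
      moreover have "regs s1 r_i < regs s2 r_i \<or> regs s1 r_j < regs s2 r_j" using after by auto
      ultimately show ?case
        using after step(1) less card_inter_drop_merge[OF sorted ys(2) less] by (auto simp: I_def)
    qed
  next
    case (exit T s')
    have "loaded s' xs" by (rule loaded_modifies[OF loaded]) (use exit(1) in \<open>auto simp: I_def\<close>)
    then have "drop (regs s' r_i) xs = [] \<or> drop (regs s' r_j) ys = []"
      using exit(2) by (auto simp: loaded_def ready_def)
    then show ?case using exit by (auto simp: I_def)
  qed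
qed

definition unsuccessful :: "nat list \<Rightarrow> store \<Rightarrow> bool" where
  "unsuccessful C s \<longleftrightarrow> regs s r_count = length C \<and> length C < 40 * cap \<and> (\<forall>i\<in>set C. \<not> accept ys (xss ! i))"

definition stopped :: "nat list \<Rightarrow> store \<Rightarrow> bool" where
  "stopped C s \<longleftrightarrow> regs s r_len = 0 \<and> ((\<exists>i\<in>set C. accept ys (xss ! i) \<and> regs s r_result = ad i) \<or>
    (40 * cap \<le> length C \<and> (\<forall>i\<in>set (take (40 * cap) C). \<not> accept ys (xss ! i))))"

lemma stopped_append: "stopped C s \<Longrightarrow> stopped (C @ D) s"
  by (auto simp: stopped_def)

lemma stopped_modifies: "stopped C s \<Longrightarrow> modifies R A s s' \<Longrightarrow> R \<inter> {r_len, r_result} = {} \<Longrightarrow> stopped C s'"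
  by (auto simp: stopped_def modifies_def)

definition checked :: "nat list \<Rightarrow> nat \<Rightarrow> store \<Rightarrow> store \<Rightarrow> bool" where
  "checked C e s s' \<longleftrightarrow> modifies candidate_regs {} s s' \<and> regs s' r_count = Suc (length C) \<and>
    (unsuccessful (C @ [snd (es ! e)]) s' \<and> regs s' r_len = regs s r_len \<and>
        regs s' r_entry = prev_entry es (fst (es ! e)) e \<or>
      stopped (C @ [snd (es ! e)]) s' \<and> regs s' r_entry = 0)"

lemma entry_in:
  assumes "e < length es"
  shows "m (entries_at + 2 * Suc e) = ad (snd (es ! e))"
    "m (entries_at + 2 * Suc e + 1) = prev_entry es (fst (es ! e)) e"
    "entries_at + 2 * Suc e + 1 < 2 ^ w" "snd (es ! e) < n"
proof -
  show "m (entries_at + 2 * Suc e) = ad (snd (es ! e))"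
    "m (entries_at + 2 * Suc e + 1) = prev_entry es (fst (es ! e)) e"
    "snd (es ! e) < n"
    using index assms by (auto simp: index_in_def table_in_def)
  have "e < buckets" using index assms by (simp add: index_in_def)
  then show "entries_at + 2 * Suc e + 1 < 2 ^ w" using memory_bounds no_overflow by auto
qed

lemma wp_advance:
  assumes ready_s1: "ready s1" "modifies candidate_regs {} s s1" "regs s1 r_entry = Suc e" "e < length es"
      "regs s1 r_len = regs s r_len" "regs s1 r_count = Suc (length C)"
    and unaccepted: "\<forall>i\<in>set C. \<not> accept ys (xss ! i)" "length C < 40 * cap" "\<not> accept ys (xss ! snd (es ! e))"
  shows "wp w inp advance (\<lambda>T s'. T \<le> 5 \<and> checked C e s s') s1"
proof -
  have small: "2 * Suc e < 2 ^ w" "2 < (2::nat) ^ w" "40 < (2::nat) ^ w" "40 * cap < 2 ^ w"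
    using entry_in(3)[OF ready_s1(4)] memory_bounds no_overflow Z_ge by auto
  have count_test: "eval w inp s1 (Reg r_count <\<^sub>e Const 40 *\<^sub>e Reg r_cap) = of_bool (Suc (length C) < 40 * cap)"
    using ready_s1 small by (simp add: ready_def params_def)
  have next_entry: "eval w inp s1 (Mem (Reg r_entries +\<^sub>e Const 2 *\<^sub>e Reg r_entry +\<^sub>e Const 1)) =
      prev_entry es (fst (es ! e)) e"
    using ready_s1 small entry_in[OF ready_s1(4)] w_pos by (simp add: ready_def params_def)
  show ?thesis unfolding advance_def
  proof (rule wp_if, unfold count_test, goal_cases holds fails)
    case holds
    then show ?case
      by (intro wp_assign, unfold next_entry)
        (use ready_s1 unaccepted in \<open>simp add: checked_def unsuccessful_def\<close>)
  next
    case fails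
    have "\<not> accept ys (xss ! i)" if "i \<in> set (take (40 * cap) (C @ [snd (es ! e)]))" for i
      using in_set_takeD[OF that] unaccepted by auto
    with fails show ?case
      by (intro wp_seq wp_assign) (use ready_s1 in \<open>simp add: checked_def stopped_def\<close>)
  qed
qed

text \<open>The first test only rejects sets that \<^const>\<open>accept\<close> would reject as well.\<close>

lemma accept_length:
  assumes "accept ys xs"
  shows "B2 * length xs < length ys * Z"
proof -
  have "card (set xs \<inter> set ys) \<le> length ys"
    using card_mono[of "set ys" "set xs \<inter> set ys"] card_length[of ys] by auto
  then have "card (set xs \<inter> set ys) * Z \<le> length ys * Z" by (rule mult_right_mono) simp
  then show ?thesis using assms unfolding accept_def by linarith
qed

lemma size_products_less:
  assumes "length xs \<le> Z"
  shows "B2 * length xs < 2 ^ w" "B2 * length ys < 2 ^ w" "length ys * Z < 2 ^ w"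
    "card (set xs \<inter> set ys) * Z < 2 ^ w"
proof -
  have "card (set xs \<inter> set ys) \<le> length xs"
    using card_mono[of "set xs" "set xs \<inter> set ys"] card_length[of xs] by auto
  then have "B2 * length xs \<le> Z * Z" "B2 * length ys \<le> Z * Z" "length ys * Z \<le> Z * Z"
    "card (set xs \<inter> set ys) * Z \<le> Z * Z"
    using B2 assms length_ys by (auto intro!: mult_mono)
  moreover have "Z * Z < 2 ^ w" using no_overflow by linarith
  ultimately show "B2 * length xs < 2 ^ w" "B2 * length ys < 2 ^ w" "length ys * Z < 2 ^ w"
    "card (set xs \<inter> set ys) * Z < 2 ^ w"
    by linarith+
qed

lemma wp_load_candidate:
  assumes ready: "ready s" "regs s r_entry = Suc e" "e < length es" and unsuccessful: "unsuccessful C s"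
  shows "wp w inp load_candidate (\<lambda>T s'. T = 5 \<and> modifies {r_count, r_cand, r_cand_size} {} s s' \<and>
      regs s' r_count = Suc (length C) \<and> regs s' r_cand = ad (snd (es ! e)) \<and> loaded s' (xss ! snd (es ! e))) s"
proof -
  define i where "i = snd (es ! e)"
  have xs: "set_in m (ad i) (xss ! i)" using index entry_in(4)[OF ready(3)] by (simp add: index_in_def i_def)
  define s1 where "s1 = s\<lparr>regs := (regs s)(r_count := Suc (length C))\<rparr>"
  define s2 where "s2 = s1\<lparr>regs := (regs s1)(r_cand := ad i)\<rparr>"
  define s3 where "s3 = s2\<lparr>regs := (regs s2)(r_cand_size := length (xss ! i))\<rparr>"
  have small: "2 * Suc e < 2 ^ w" "2 < (2::nat) ^ w" "Suc (length C) < 2 ^ w"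
    using entry_in(3)[OF ready(3)] unsuccessful memory_bounds no_overflow Z_ge by (auto simp: unsuccessful_def)
  have count: "eval w inp s (Reg r_count +\<^sub>e Const 1) = Suc (length C)"
    using unsuccessful small w_pos by (simp add: unsuccessful_def)
  have cand: "eval w inp s1 (Mem (Reg r_entries +\<^sub>e Const 2 *\<^sub>e Reg r_entry)) = ad i"
    using ready small entry_in[OF ready(3)] by (simp add: s1_def i_def ready_def params_def)
  have size: "eval w inp s2 (Mem (Reg r_cand)) = length (xss ! i)"
    using ready xs by (simp add: s1_def s2_def ready_def set_in_def)
  have frame_s3: "modifies {r_count, r_cand, r_cand_size} {} s s3" by (simp add: s1_def s2_def s3_def)
  have "ready s3" by (rule ready_modifies[OF ready(1) frame_s3]) simp
  then have "loaded s3 (xss ! i)" using xs by (simp add: loaded_def s2_def s3_def)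
  then show ?thesis unfolding load_candidate_def i_def[symmetric] using frame_s3
    by (intro wp_seq_assign[OF count s1_def] wp_seq_assign[OF cand s2_def] wp_assign, unfold size, fold s3_def)
      (simp add: s1_def s2_def s3_def)
qed

lemma wp_verify:
  assumes loaded_s1: "loaded s1 xs" "modifies candidate_regs {} s s1" "regs s1 r_entry = Suc e" "e < length es"
      "regs s1 r_len = regs s r_len" "regs s1 r_count = Suc (length C)" "regs s1 r_cand = ad (snd (es ! e))"
    and xs: "xs = xss ! snd (es ! e)"
    and unaccepted: "\<forall>i\<in>set C. \<not> accept ys (xss ! i)" "length C < 40 * cap"
  shows "wp w inp verify (\<lambda>T s'. T \<le> 20 * (length xs + length ys) + 30 \<and> checked C e s s') s1"
  unfolding verify_def
proof (rule wp_seq, rule wp_conseq[OF wp_merge_count[OF loaded_s1(1)]], elim conjE, goal_cases after)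
  case (after T2 s2)
  note merged = after(2)
  have loaded_s2: "loaded s2 xs" by (rule loaded_modifies[OF loaded_s1(1) merged]) auto
  have frame_s2: "modifies candidate_regs {} s s2" by (rule modifies_trans[OF loaded_s1(2) merged]) auto
  have regs2: "regs s2 r_entry = Suc e" "regs s2 r_len = regs s r_len" "regs s2 r_count = Suc (length C)"
    "regs s2 r_cand = ad (snd (es ! e))"
    using merged loaded_s1 by (simp_all add: modifies_def)
  have "length xs \<le> Z" using loaded_s1(1) by (simp add: loaded_def set_in_def)
  then have test: "eval w inp s2 (Reg r_B2 *\<^sub>e Reg r_cand_size <\<^sub>e Reg r_common *\<^sub>e Reg r_scale \<and>\<^sub>e
      Reg r_B2 *\<^sub>e Reg r_size <\<^sub>e Reg r_common *\<^sub>e Reg r_scale) = of_bool (accept ys xs)"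
    using loaded_s2 after(3) size_products_less[of xs] by (simp add: loaded_def ready_def params_def accept_def)
  show ?case
  proof (rule wp_if, unfold test, goal_cases holds fails)
    case holds
    then have "accept ys (xss ! snd (es ! e))" using xs by simp
    then show ?case
      by (intro wp_seq wp_assign)
        (use frame_s2 regs2 \<open>T2 \<le> _\<close> in \<open>auto simp: checked_def stopped_def\<close>)
  next
    case fails
    then have "\<not> accept ys (xss ! snd (es ! e))" using xs by simp
    moreover have "ready s2" using loaded_s2 by (simp add: loaded_def)
    ultimately show ?case using \<open>T2 \<le> _\<close>
      by (intro wp_conseq[OF wp_advance[OF _ frame_s2 regs2(1) loaded_s1(4) regs2(2,3) unaccepted]]) auto
  qed
qed

lemma wp_check_candidate:
  assumes ready: "ready s" "regs s r_entry = Suc e" "e < length es" and unsuccessful: "unsuccessful C s"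
  shows "wp w inp check_candidate (\<lambda>T s'. T \<le> 20 * (size_ratio + 1) * length ys + 60 \<and> checked C e s s') s"
  unfolding check_candidate_def
proof (rule wp_seq, rule wp_conseq[OF wp_load_candidate[OF ready unsuccessful]], elim conjE, goal_cases after)
  case (after T1 s1)
  define xs where "xs = xss ! snd (es ! e)"
  have loaded_s1: "loaded s1 xs" "ready s1" using after(5) by (auto simp: xs_def loaded_def)
  have frame_s1: "modifies candidate_regs {} s s1" by (rule modifies_trans[OF after(2) modifies_refl]) auto
  have regs1: "regs s1 r_entry = Suc e" "regs s1 r_len = regs s r_len"
    using after(2) ready by (simp_all add: modifies_def)
  have unaccepted: "\<forall>i\<in>set C. \<not> accept ys (xss ! i)" "length C < 40 * cap"
    using unsuccessful by (auto simp: unsuccessful_def)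
  have "length xs \<le> Z" using loaded_s1(1) by (simp add: loaded_def set_in_def)
  then have test: "eval w inp s1 (Reg r_B2 *\<^sub>e Reg r_cand_size <\<^sub>e Reg r_size *\<^sub>e Reg r_scale) =
    of_bool (B2 * length xs < length ys * Z)"
    using loaded_s1 size_products_less[of xs] by (simp add: loaded_def ready_def params_def)
  show ?case
  proof (rule wp_if, unfold test, goal_cases holds fails)
    case holds
    then have "B2 * length xs < length ys * Z" by simp
    also have "\<dots> \<le> length ys * (size_ratio * B2)" using size_ratio by (rule mult_left_mono) simp
    finally have "B2 * length xs < B2 * (size_ratio * length ys)" by (simp add: mult_ac)
    then have "length xs \<le> size_ratio * length ys" by simp
    then show ?case using \<open>T1 = 5\<close>
      by (intro wp_conseq[OF wp_verify[OF loaded_s1(1) frame_s1 regs1(1) ready(3) regs1(2)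
        \<open>regs s1 r_count = _\<close> \<open>regs s1 r_cand = _\<close> xs_def unaccepted]])
        (auto simp: algebra_simps)
  next
    case fails
    then have "\<not> accept ys (xss ! snd (es ! e))" using accept_length[of xs] by (auto simp: xs_def)
    then show ?case using \<open>T1 = 5\<close>
      by (intro wp_conseq[OF wp_advance[OF loaded_s1(2) frame_s1 regs1(1) ready(3) regs1(2)
        \<open>regs s1 r_count = _\<close> unaccepted]]) auto
  qed
qed

definition check_time :: nat where
  "check_time = 20 * (size_ratio + 1) * length ys + 61"

text \<open>The running time is charged to the candidates that may still be checked.\<close>

definition scanned :: "nat list \<Rightarrow> nat \<Rightarrow> store \<Rightarrow> nat \<Rightarrow> store \<Rightarrow> bool" where
  "scanned C c s T s' \<longleftrightarrow>
    T + check_time * (40 * cap - regs s' r_count) \<le> check_time * (40 * cap - regs s r_count) + c \<and>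
    (unsuccessful C s' \<and> regs s' r_len = regs s r_len \<or> stopped C s')"

definition pending :: "nat list \<Rightarrow> nat \<Rightarrow> store \<Rightarrow> store \<Rightarrow> bool" where
  "pending C b s s' \<longleftrightarrow> regs s' r_len = regs s r_len \<and> regs s' r_entry \<le> length es \<and>
    (\<forall>e. regs s' r_entry = Suc e \<longrightarrow> fst (es ! e) = b) \<and>
    (\<exists>cs. C @ chain es b (length es) = cs @ chain es b (regs s' r_entry) \<and> unsuccessful cs s')"

definition scanning :: "nat list \<Rightarrow> nat \<Rightarrow> store \<Rightarrow> store \<Rightarrow> bool" where
  "scanning C b s s' \<longleftrightarrow> modifies candidate_regs {} s s' \<and>
    (pending C b s s' \<or> stopped (C @ chain es b (length es)) s' \<and> regs s' r_entry = 0)"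

lemma scanning_checked:
  assumes scanning: "scanning C b s s1" "regs s1 r_entry = Suc e"
    and cs: "C @ chain es b (length es) = cs @ chain es b (Suc e)" and checked: "checked cs e s1 s2"
  shows "scanning C b s s2"
proof -
  have state_s1: "modifies candidate_regs {} s s1" "fst (es ! e) = b" "e < length es"
    "regs s1 r_len = regs s r_len"
    using scanning by (auto simp: scanning_def pending_def)
  have frame_s2: "modifies candidate_regs {} s s2"
    by (rule modifies_trans[OF state_s1(1)]) (use checked in \<open>auto simp: checked_def\<close>)
  have append: "C @ chain es b (length es) = (cs @ [snd (es ! e)]) @ chain es b (prev_entry es b e)"
    using cs state_s1(2) by (simp add: chain_prev_entry)
  consider (continue) "unsuccessful (cs @ [snd (es ! e)]) s2" "regs s2 r_len = regs s1 r_len"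
    "regs s2 r_entry = prev_entry es b e"
    | (stop) "stopped (cs @ [snd (es ! e)]) s2" "regs s2 r_entry = 0"
    using checked state_s1(2) by (auto simp: checked_def)
  then show ?thesis
  proof cases
    case continue
    moreover have "prev_entry es b e \<le> length es" using prev_entry_le[of es b e] state_s1(3) by simp
    ultimately have "pending C b s s2"
      unfolding pending_def append using state_s1(4) prev_entry_bucket[of es b e] by auto
    then show ?thesis using frame_s2 by (simp add: scanning_def)
  next
    case stop
    then show ?thesis using frame_s2 stopped_append unfolding scanning_def append by blast
  qed
qed

lemma wp_scan_chain:
  assumes ready: "ready s" "regs s r_entry = prev_entry es b (length es)" and unsuccessful: "unsuccessful C s"
  shows "wp w inp (While (Reg r_entry) check_candidate) (\<lambda>T s'. modifies candidate_regs {} s s' \<and>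
      scanned (C @ chain es b (length es)) 1 s T s') s"
proof (rule wp_while[where I = "scanning C b s" and V = "\<lambda>s'. check_time * (40 * cap - regs s' r_count)"],
    goal_cases init step exit)
  case init
  have "pending C b s s"
    using ready(2) unsuccessful prev_entry_le[of es b "length es"] prev_entry_bucket[of es b "length es"]
    by (auto simp: pending_def chain_prev_entry)
  then show ?case by (simp add: scanning_def)
next
  case (step s1)
  then obtain e where entry: "regs s1 r_entry = Suc e" using not0_implies_Suc by auto
  then obtain cs where cs: "C @ chain es b (length es) = cs @ chain es b (Suc e)" "unsuccessful cs s1"
    and e: "e < length es" and frame_s1: "modifies candidate_regs {} s s1"
    using step(1) by (auto simp: scanning_def pending_def)
  have ready_s1: "ready s1" by (rule ready_modifies[OF ready(1) frame_s1]) auto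
  show ?case
  proof (rule wp_conseq[OF wp_check_candidate[OF ready_s1 entry e cs(2)]], elim conjE, goal_cases after)
    case (after T s2)
    have "regs s2 r_count = Suc (regs s1 r_count)" "regs s1 r_count < 40 * cap"
      using after(2) cs(2) by (auto simp: checked_def unsuccessful_def)
    then have "40 * cap - regs s1 r_count = Suc (40 * cap - regs s2 r_count)" by simp
    then have "Suc T + check_time * (40 * cap - regs s2 r_count) \<le> check_time * (40 * cap - regs s1 r_count)"
      using after(1) by (simp add: check_time_def)
    then show ?case using scanning_checked[OF step(1) entry cs(1) after(2)] by simp
  qed
next
  case (exit T s')
  then show ?case by (auto simp: scanning_def pending_def scanned_def)
qed

lemma wp_scan_leaf:
  assumes ready: "ready s" and node: "good_node (regs s r_tag, regs s r_id)" and bucket_seed: "bucket_seed_in m f"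
    and unsuccessful: "unsuccessful C s"
  shows "wp w inp scan_leaf (\<lambda>T s'. modifies ({r_bucket} \<union> candidate_regs) {} s s' \<and>
      scanned (C @ chain es (bucket f (regs s r_tag, regs s r_id)) (length es)) 5 s T s') s"
proof -
  define b where "b = bucket f (regs s r_tag, regs s r_id)"
  define s1 where "s1 = s\<lparr>regs := (regs s)(r_bucket := b)\<rparr>"
  define s2 where "s2 = s1\<lparr>regs := (regs s1)(r_entry := prev_entry es b (length es))\<rparr>"
  have b_less: "b < buckets" by (simp add: b_def bucket_less)
  have eval_b: "eval w inp s bucket_of = b"
    using eval_bucket_of[of s f] ready node bucket_seed by (simp add: b_def ready_def)
  have "heads_at + b < 2 ^ w" using b_less memory_bounds no_overflow by auto
  then have head: "eval w inp s1 (Mem (Reg r_heads +\<^sub>e Reg r_bucket)) = prev_entry es b (length es)"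
    using ready index b_less by (simp add: s1_def ready_def params_def index_in_def table_in_def)
  have frame_s2: "modifies {r_bucket, r_entry} {} s s2" by (simp add: s1_def s2_def)
  have ready_s2: "ready s2" by (rule ready_modifies[OF ready frame_s2]) simp
  have entry: "regs s2 r_entry = prev_entry es b (length es)" and "unsuccessful C s2"
    and regs2: "regs s2 r_count = regs s r_count" "regs s2 r_len = regs s r_len"
    using unsuccessful by (simp_all add: s1_def s2_def unsuccessful_def)
  show ?thesis unfolding scan_leaf_def b_def[symmetric]
  proof (rule wp_seq_assign[OF eval_b s1_def], rule wp_seq_assign[OF head s2_def],
      rule wp_conseq[OF wp_scan_chain[OF ready_s2 entry \<open>unsuccessful C s2\<close>]], elim conjE, goal_cases after)
    case (after T s')
    have "modifies ({r_bucket} \<union> candidate_regs) {} s s'" by (rule modifies_trans[OF frame_s2 after(1)]) auto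
    then show ?case using after(2) regs2 by (simp add: scanned_def)
  qed
qed

lemma wp_scan_if_leaf:
  assumes ready: "ready s" and node: "(regs s r_tag, regs s r_id) = q" "good_node q"
    and bucket_seed: "bucket_seed_in m f"
    and unsuccessful: "unsuccessful C s"
  shows "wp w inp (if is_leaf q then scan_leaf else skip) (\<lambda>T s'.
      modifies ({r_void, r_bucket} \<union> candidate_regs) {} s s' \<and> scanned (C @ candidates es f [q]) 5 s T s') s"
proof (cases "is_leaf q")
  case True
  have "wp w inp scan_leaf (\<lambda>T s'. modifies ({r_void, r_bucket} \<union> candidate_regs) {} s s' \<and>
      scanned (C @ chain es (bucket f q) (length es)) 5 s T s') s"
    using wp_scan_leaf[OF ready _ bucket_seed unsuccessful] node
    by (auto elim!: wp_conseq intro: modifies_trans[OF _ modifies_refl])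
  then show ?thesis using True by (simp add: candidates_def)
next
  case False
  then show ?thesis using unsuccessful by (auto simp: candidates_def scanned_def unsuccessful_def intro!: wp_skip)
qed

abbreviation (input) "scan_regs \<equiv> {r_node, r_tag, r_id, r_void, r_bucket} \<union> candidate_regs"

definition scanned_upto :: "nat list \<Rightarrow> node list \<Rightarrow> store \<Rightarrow> nat \<Rightarrow> nat \<Rightarrow> store \<Rightarrow> bool" where
  "scanned_upto f Q s h t s' \<longleftrightarrow> modifies scan_regs {} s s' \<and>
    t + check_time * (40 * cap - regs s' r_count) \<le> check_time * (40 * cap) + 20 * h \<and>
    (queued s' Q \<and> unsuccessful (candidates es f (take h Q)) s' \<or> stopped (candidates es f Q) s')"

lemma scanned_upto_frame:
  assumes scanned: "scanned_upto f Q s h t s'" and frame: "modifies {r_node, r_tag, r_id} {} s' s''"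
  shows "scanned_upto f Q s h t s''"
proof -
  have "modifies scan_regs {} s s''"
    by (rule modifies_trans[OF _ frame]) (use scanned in \<open>auto simp: scanned_upto_def\<close>)
  moreover have "regs s'' r_count = regs s' r_count" using frame by (simp add: modifies_def)
  moreover have "queued s'' Q" if "queued s' Q" by (rule queued_modifies[OF that frame]) auto
  moreover have "stopped (candidates es f Q) s''" if "stopped (candidates es f Q) s'"
    by (rule stopped_modifies[OF that frame]) auto
  ultimately show ?thesis using scanned by (auto simp: scanned_upto_def unsuccessful_def)
qed

lemma scanned_upto_ready: "ready s \<Longrightarrow> scanned_upto f Q s h t s' \<Longrightarrow> ready s'"
  by (rule ready_modifies[where R = scan_regs]) (auto simp: scanned_upto_def)

lemma wp_scan_visit:
  assumes ready: "ready s" and bucket_seed: "bucket_seed_in m f" and scanned: "scanned_upto f Q s h t s1"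
    and queue: "queued s1 Q" "h < length Q" and node: "regs s1 r_node = h" "(regs s1 r_tag, regs s1 r_id) = Q ! h"
      "good_node (Q ! h)"
  shows "wp w inp (if is_leaf (Q ! h) then scan_leaf else skip)
    (\<lambda>t' s''. scanned_upto f Q s (Suc h) (t + t' + 8) s'' \<and> regs s'' r_node = h) s1"
proof -
  have take_Suc: "candidates es f (take (Suc h) Q) = candidates es f (take h Q) @ candidates es f [Q ! h]"
    using queue(2) by (simp add: take_Suc_conv_app_nth flip: candidates_append)
  have split: "candidates es f Q = candidates es f (take (Suc h) Q) @ candidates es f (drop (Suc h) Q)"
    by (simp flip: candidates_append)
  have "0 < regs s1 r_len" using queue by (auto simp: queued_def)
  then have unsuccessful_s1: "unsuccessful (candidates es f (take h Q)) s1"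
    and frame_s1: "modifies scan_regs {} s s1"
    and time: "t + check_time * (40 * cap - regs s1 r_count) \<le> check_time * (40 * cap) + 20 * h"
    using scanned by (auto simp: scanned_upto_def stopped_def)
  have ready_s1: "ready s1" using ready scanned by (rule scanned_upto_ready)
  show ?thesis
  proof (rule wp_conseq[OF wp_scan_if_leaf[OF ready_s1 node(2,3) bucket_seed unsuccessful_s1]], elim conjE,
      goal_cases after)
    case (after T s')
    have "modifies scan_regs {} s s'" by (rule modifies_trans[OF frame_s1 after(1)]) auto
    moreover have "queued s' Q" if "regs s' r_len = regs s1 r_len"
      using queue(1) that modifies_mem_empty[OF after(1)] by (simp add: queued_def)
    moreover have "stopped (candidates es f Q) s'" if "stopped (candidates es f (take (Suc h) Q)) s'"
      unfolding split by (rule stopped_append[OF that])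
    moreover have "regs s' r_node = h" using after(1) node(1) by (simp add: modifies_def)
    ultimately show ?case
      using after(2) time by (auto simp: scanned_upto_def scanned_def simp flip: take_Suc)
  qed
qed

lemma wp_scan_leaves:
  assumes ready: "ready s" "regs s r_count = 0" and bucket_seed: "bucket_seed_in m f"
    and queue: "queued s Q" "\<forall>q\<in>set Q. good_node q"
  shows "wp w inp (for_nodes skip scan_leaf) (\<lambda>T s'. T \<le> check_time * (40 * cap) + 20 * cap + 3 \<and>
      modifies scan_regs {} s s' \<and> search_outcome ad xss ys (candidates es f Q) s') s"
proof (rule wp_for_nodes[where I = "scanned_upto f Q s" and Q = "\<lambda>_. Q"],
    goal_cases init frame params queued body exit)
  case init
  show ?case using queue memory_bounds by (simp add: scanned_upto_def candidates_def unsuccessful_def ready(2))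
next
  case (frame h t s' s'')
  then show ?case by (rule scanned_upto_frame)
next
  case (params h t s')
  then show ?case using scanned_upto_ready[OF ready(1)] by (auto simp: ready_def)
next
  case (queued h t s')
  then show ?case by (auto simp: scanned_upto_def stopped_def)
next
  case (body h t s1)
  then show ?case using queue(2) by (intro wp_scan_visit[OF ready(1) bucket_seed]) auto
next
  case (exit h t s')
  have "stopped (candidates es f Q) s' \<or> unsuccessful (candidates es f Q) s'"
    using exit by (auto simp: scanned_upto_def queued_def)
  then have "search_outcome ad xss ys (candidates es f Q) s'"
    by (auto simp: search_outcome_def stopped_def unsuccessful_def dest: in_set_takeD)
  then show ?case using exit by (auto simp: scanned_upto_def)
qed

end

context layout
begin

lemma snd_entries_less: "q \<in> set (entries sd f xss i) \<Longrightarrow> snd q < i"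
  by (auto simp: entries_def leaf_entries_def)

lemma structure_in_copied:
  assumes "structure_in m sd f binp xss n" "sets_in binp xss" "i < n" "j \<le> length (xss ! i)"
  shows "m (set_at xss i + j) = binp ! (set_pos xss i + j)"
proof -
  have "set_pos xss i + j < set_pos xss n" using set_pos_less[OF assms(2,3)] assms by (simp add: sets_in_def)
  then have "m (sets_at + (set_pos xss i + j)) = binp ! (set_pos xss i + j)"
    using assms(1) set_pos_ge[of xss i] by (simp add: structure_in_def)
  then show ?thesis by (simp add: add.assoc)
qed

lemma structure_index_in:
  assumes stored: "structure_in m sd f binp xss n" and xss: "sets_in binp xss"
    and sorted: "\<forall>i<n. sorted_wrt (<) (xss ! i)"
    and m': "\<And>a. heads_at \<le> a \<Longrightarrow> m' a = m a"
  shows "index_in m' (set_at xss) (entries sd f xss n) xss"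
proof -
  have len: "length (entries sd f xss n) \<le> buckets" using length_entries[of sd f xss n] by (simp add: buckets_def)
  have table: "table_in m' (set_at xss) (entries sd f xss n)"
    using stored len m' unfolding structure_in_def by (blast intro: table_in_cong)
  have "set_in m' (set_at xss i) (xss ! i)" if i: "i < n" for i
  proof -
    have "heads_at \<le> sets_at" using memory_bounds by linarith
    then have copied: "m' (set_at xss i + j) = binp ! (set_pos xss i + j)" if "j \<le> length (xss ! i)" for j
      using structure_in_copied[OF stored xss i that] m' by simp
    have "m' (set_at xss i + 1 + j) = xss ! i ! j" if "j < length (xss ! i)" for j
      using copied[of "Suc j"] that xss i by (simp add: sets_in_def reads_def)
    moreover have "m' (set_at xss i) = length (xss ! i)" using copied[of 0] xss i by (simp add: sets_in_def)
    moreover have "set_at xss i + Suc (length (xss ! i)) \<le> Z"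
      using set_pos_less[OF xss i] memory_bounds by linarith
    ultimately show ?thesis using sorted i by (simp add: set_in_def)
  qed
  then show ?thesis using table len snd_entries_less[OF nth_mem] by (simp add: index_in_def)
qed

lemma wp_generate_and_scan:
  assumes stored: "structure_in (mem s) sd f binp xss n" and xss: "sets_in binp xss"
    "\<forall>i<n. sorted_wrt (<) (xss ! i)"
    and params: "params (regs s)" and elems: "regs s r_elems = 1" "regs s r_size = length ys"
    and ys: "reads inp 1 ys" "sorted_wrt (<) ys"
    and size_ratio: "Z \<le> size_ratio * B2" and C: "C = candidates (entries sd f xss n) f (queue sd ys)"
  shows "wp w inp (generate ;; (r_count ::= Const 0) ;; for_nodes skip scan_leaf) (\<lambda>T s'.
    T \<le> cap * (40 * (20 * (size_ratio + 1) * length ys + 61) + 20 * length ys + 140) + 110 \<and>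
    (\<forall>a. heads_at \<le> a \<longrightarrow> mem s' a = mem s a) \<and>
    search_outcome (set_at xss) xss ys C s') s"
proof -
  have seeds: "seeds_in (mem s) sd" "bucket_seed_in (mem s) f" using stored by (auto simp: structure_in_def)
  have elems': "reads inp (regs s r_elems) ys" using ys elems by simp
  show ?thesis
  proof (rule wp_seq, rule wp_conseq[OF wp_generate[OF params seeds(1) elems' elems(2)]], elim conjE,
      goal_cases after)
    case (after T1 s1)
    note frame_s1 = after(2)
    define s2 where "s2 = s1\<lparr>regs := (regs s1)(r_count := 0)\<rparr>"
    have zero: "eval w inp s1 (Const 0) = 0" by simp
    interpret index_scan w z Z B1 B2 k L cap n N "mem s2" "set_at xss" "entries sd f xss n" xss inp ys size_ratio
    proof
      show "index_in (mem s2) (set_at xss) (entries sd f xss n) xss"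
        using stored xss by (rule structure_index_in) (use frame_s1 in \<open>simp add: modifies_def s2_def\<close>)
    qed (use ys size_ratio in auto)
    have "params (regs s2)" using params_modifies[OF params frame_s1] by (rule params_cong) (auto simp: s2_def)
    moreover have "regs s2 r_size = length ys" using frame_s1 elems by (simp add: s2_def modifies_def)
    ultimately have ready_s2: "ready s2" by (simp add: ready_def)
    have count_s2: "regs s2 r_count = 0" and queue_s2: "queued s2 (queue sd ys)"
      using after(3) by (simp_all add: s2_def)
    have bucket_seed_s2: "bucket_seed_in (mem s2) f"
      using seeds(2) by (rule bucket_seed_in_cong) (use frame_s1 in \<open>simp add: modifies_def s2_def\<close>)
    have good: "\<forall>q\<in>set (queue sd ys). good_node q" using good_queue by blast
    show ?case
    proof (rule wp_seq_assign[OF zero s2_def],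
        rule wp_conseq[OF wp_scan_leaves[OF ready_s2 count_s2 bucket_seed_s2 queue_s2 good]], elim conjE,
        goal_cases after)
      case (after T3 s3)
      have "mem s3 a = mem s a" if "heads_at \<le> a" for a
        using that modifies_mem_empty[OF after(2)] frame_s1 by (simp add: s2_def modifies_def)
      moreover have "cap * (40 * (20 * (size_ratio + 1) * length ys + 61) + 20 * length ys + 140) =
          check_time * (40 * cap) + 40 * cap + cap * (20 * length ys + 100)"
        by (simp add: check_time_def algebra_simps)
      ultimately show ?case using after(1,3) \<open>T1 \<le> _\<close> unfolding C by (intro conjI allI impI) simp_all
    qed
  qed
qed

lemma wp_query:
  assumes stored: "structure_in m sd f binp xss n" and xss: "sets_in binp xss" "\<forall>i<n. sorted_wrt (<) (xss ! i)"
    and ys: "reads inp 1 ys" "inp ! 0 = length ys" "sorted_wrt (<) ys"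
    and size_ratio: "Z \<le> size_ratio * B2" and C: "C = candidates (entries sd f xss n) f (queue sd ys)"
  shows "wp w inp query_prog (\<lambda>T s'. T \<le> cap * (40 * (20 * (size_ratio + 1) * length ys + 61) +
    20 * length ys + 140) + 200 \<and>
    (\<forall>a. heads_at \<le> a \<longrightarrow> mem s' a = m a) \<and>
    search_outcome (set_at xss) xss ys C s') (init m)"
proof -
  have params: "params m" using stored by (simp add: structure_in_def)
  have small: "13 < (2::nat) ^ w" using no_overflow Z_ge by auto
  have "0 < length inp" using ys by (auto simp: reads_def)
  show ?thesis unfolding query_prog_def
  proof (rule wp_seq, rule wp_conseq[OF wp_load_upto[OF small]], elim conjE, goal_cases after)
    case (after T1 s1)
    define s2 where "s2 = s1\<lparr>regs := (regs s1)(r_size := length ys)\<rparr>"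
    define s3 where "s3 = s2\<lparr>regs := (regs s2)(r_elems := 1)\<rparr>"
    have size: "eval w inp s1 (Inp (Const 0)) = length ys" using \<open>0 < length inp\<close> ys by simp
    have one: "eval w inp s2 (Const 1) = 1" using w_pos by simp
    have params_s3: "params (regs s3)"
      using params by (rule params_cong) (use after in \<open>auto simp: init_def s2_def s3_def\<close>)
    have mem_s3: "mem s3 = m" and elems_s3: "regs s3 r_elems = 1" "regs s3 r_size = length ys"
      using after by (simp_all add: init_def s2_def s3_def)
    then have "structure_in (mem s3) sd f binp xss n" using stored by simp
    note generate_and_scan = wp_generate_and_scan[OF this xss params_s3 elems_s3 ys(1,3) size_ratio C]
    show ?case
      by (intro wp_seq_assign[OF size s2_def] wp_seq_assign[OF one s3_def], rule wp_conseq[OF generate_and_scan])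
        (use \<open>T1 \<le> _\<close> mem_s3 in auto)
  qed
qed

end

subsection \<open>Choosing the parameters\<close>

text \<open>Division of \<open>2 ^ w - 1\<close> by 256 until it drops below 256 computes \<open>Z = 2 ^ ((w - 1) div 8)\<close>, so that products
  of up to eight numbers below \<open>Z\<close> do not overflow.\<close>

definition find_scale :: com where
  "find_scale =
    (r_quotient ::= Const 0 -\<^sub>e Const 1) ;; (r_scale ::= Const 1) ;;
    While (Const 255 <\<^sub>e Reg r_quotient)
      ((r_quotient ::= Reg r_quotient div\<^sub>e Const 256) ;; (r_scale ::= Reg r_scale *\<^sub>e Const 2))"

text \<open>Fixed-point powers of \<open>1 / b2\<close> and \<open>1 / b1\<close>: the depth is the first \<open>k\<close> with \<open>(1 / b2) ^ k \<ge> n\<close>.\<close>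

definition find_depth :: com where
  "find_depth =
    (r_pow2 ::= Reg r_scale) ;; (r_pow1 ::= Reg r_scale) ;; (r_depth ::= Const 0) ;;
    While (Reg r_pow2 <\<^sub>e Reg r_n *\<^sub>e Reg r_scale)
      ((r_pow2 ::= Reg r_pow2 *\<^sub>e Reg r_scale div\<^sub>e Reg r_B2) ;;
       (r_pow1 ::= Reg r_pow1 *\<^sub>e Reg r_scale div\<^sub>e Reg r_B1) ;;
       (r_depth ::= Reg r_depth +\<^sub>e Const 1))"

definition set_layout :: "nat \<Rightarrow> com" where
  "set_layout cap_factor =
    (r_reps ::= Const 8 *\<^sub>e (Reg r_depth +\<^sub>e Const 1)) ;;
    (r_cap ::= Const cap_factor *\<^sub>e Reg r_reps *\<^sub>e (Reg r_pow1 div\<^sub>e Reg r_scale +\<^sub>e Const 1)) ;;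
    (r_buckets ::= Reg r_n *\<^sub>e Reg r_cap) ;;
    (r_queue ::= Const 34 +\<^sub>e Const 2 *\<^sub>e (Reg r_reps *\<^sub>e (Reg r_depth +\<^sub>e Const 1))) ;;
    (r_heads ::= Reg r_queue +\<^sub>e Const 2 *\<^sub>e Reg r_cap) ;;
    (r_entries ::= Reg r_heads +\<^sub>e Reg r_buckets) ;;
    (r_sets ::= Reg r_entries +\<^sub>e Const 2 *\<^sub>e Reg r_buckets +\<^sub>e Const 2)"

fun store_upto :: "nat \<Rightarrow> com" where
  "store_upto 0 = skip"
| "store_upto (Suc r) = store_upto r ;; Store (Const (Suc r)) (Reg (Suc r))"

definition set_params :: "nat \<Rightarrow> com" where
  "set_params cap_factor =
    (r_n ::= Inp (Const 0)) ;; find_scale ;;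
    (r_divisor ::= (Const 0 -\<^sub>e Const 1) div\<^sub>e Reg r_scale +\<^sub>e Const 1) ;;
    (r_B1 ::= Inp (Const 2) div\<^sub>e Reg r_divisor) ;;
    (r_B2 ::= Inp (Const 3) div\<^sub>e Reg r_divisor +\<^sub>e Const 1) ;;
    find_depth ;; set_layout cap_factor ;; store_upto 13 ;; (r_dest ::= Const 32)"

definition build_prog :: "nat \<Rightarrow> com" where
  "build_prog cap_factor = set_params cap_factor ;; draw_words ;; process_sets"

fun scaled_pow :: "nat \<Rightarrow> nat \<Rightarrow> nat \<Rightarrow> nat" where
  "scaled_pow Z B 0 = Z"
| "scaled_pow Z B (Suc j) = scaled_pow Z B j * Z div B"

lemma wp_store_upto:
  "r < 2 ^ w \<Longrightarrow> r < r_void \<Longrightarrow> wp w inp (store_upto r) (\<lambda>T s'. (\<forall>j. j \<noteq> r_void \<longrightarrow> regs s' j = regs s j) \<and>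
    (\<forall>j. mem s' j = (if 1 \<le> j \<and> j \<le> r then regs s j else mem s j))) s"
proof (induction r)
  case 0
  show ?case by (auto intro!: wp_skip)
next
  case (Suc r)
  show ?case unfolding store_upto.simps
    by (rule wp_seq, rule wp_conseq[OF Suc.IH])
      (use Suc.prems in \<open>auto intro!: wp_store simp: le_Suc_eq\<close>)
qed

lemma pow2_minus_1_div_256:
  assumes "8 < e"
  shows "(2 ^ e - 1) div 256 = (2 ^ (e - 8) - 1 :: nat)"
proof -
  have "(2::nat) ^ e = 256 * 2 ^ (e - 8)" using assms power_add[of "2::nat" 8 "e - 8"] by simp
  moreover have "(256 * m - 1) div 256 = m - 1" for m :: nat by (cases m) auto
  ultimately show ?thesis by simp
qed

lemma wp_find_scale:
  assumes w_ge_10: "10 \<le> w"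
  shows "wp w inp find_scale (\<lambda>T s'. regs s' r_scale = 2 ^ ((w - 1) div 8) \<and>
    modifies {r_scale, r_quotient} {} s s') s"
proof -
  define I where "I s' \<longleftrightarrow> modifies {r_scale, r_quotient} {} s s' \<and>
    (\<exists>j. 8 * j < w \<and> regs s' r_scale = 2 ^ j \<and> regs s' r_quotient = 2 ^ (w - 8 * j) - 1)" for s'
  have "(2::nat) ^ 10 \<le> 2 ^ w" using w_ge_10 by (intro power_increasing) auto
  then have small: "1024 \<le> (2::nat) ^ w" by simp
  show ?thesis unfolding find_scale_def
  proof (rule wp_seq, rule wp_assign, rule wp_seq, rule wp_assign,
      rule wp_while_measure[where I = I and V = "\<lambda>s'. regs s' r_quotient"], goal_cases init step exit)
    case init
    show ?case using small w_ge_10 by (auto simp: I_def intro!: exI[of _ 0])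
  next
    case (step s1)
    then obtain j where j: "8 * j < w" "regs s1 r_scale = 2 ^ j" "regs s1 r_quotient = 2 ^ (w - 8 * j) - 1"
      by (auto simp: I_def)
    have "255 < regs s1 r_quotient" using step(2) small by simp
    then have "(2::nat) ^ 8 < 2 ^ (w - 8 * j)" using j by simp
    then have bits_left: "8 < w - 8 * j" using power_less_imp_less_exp[of "2::nat" 8 "w - 8 * j"] by simp
    have "w - 8 * j - 8 = w - 8 * Suc j" by simp
    then have quotient: "eval w inp s1 (Reg r_quotient div\<^sub>e Const 256) = 2 ^ (w - 8 * Suc j) - 1"
      using pow2_minus_1_div_256[OF bits_left] j small by simp
    have "2 ^ j * 2 < (2::nat) ^ w"
      using j w_ge_10 power_strict_increasing[of "Suc j" w "2::nat"] by (simp add: mult.commute)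
    moreover have "(2::nat) ^ (w - 8 * Suc j) - 1 < 2 ^ (w - 8 * j) - 1"
      using bits_left by (intro diff_less_mono power_strict_increasing) auto
    moreover have "8 * Suc j < w" using bits_left by simp
    ultimately show ?case
      by (intro wp_seq wp_assign, unfold quotient)
        (use step(1) j small in \<open>auto simp: I_def intro!: exI[of _ "Suc j"] simp del: mult_Suc_right\<close>)
  next
    case (exit T s')
    then obtain j where j: "8 * j < w" "regs s' r_scale = 2 ^ j" "regs s' r_quotient = 2 ^ (w - 8 * j) - 1"
      by (auto simp: I_def)
    have "regs s' r_quotient \<le> 255" using exit(2) small by simp
    then have "(2::nat) ^ (w - 8 * j) \<le> 2 ^ 8" using j by simp
    then have "w - 8 * j \<le> 8" using power_le_imp_le_exp[of "2::nat" "w - 8 * j" 8] by simp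
    then have "(w - 1) div 8 = j" using j(1) by (intro div_nat_eqI) auto
    then show ?case using exit(1) j by (auto simp: I_def)
  qed
qed

locale tuned_layout = layout +
  fixes cap_factor :: nat
  assumes z_eq: "z = (w - 1) div 8"
    and depth: "\<And>j. j < k \<Longrightarrow> scaled_pow Z B2 j < n * Z" "n * Z \<le> scaled_pow Z B2 k"
    and growth_le: "\<And>j. j \<le> k \<Longrightarrow> scaled_pow Z B1 j \<le> Z * Z"
    and L_eq: "L = 8 * Suc k" and cap_eq: "cap = cap_factor * L * (scaled_pow Z B1 k div Z + 1)"
      and cap_factor: "0 < cap_factor"
begin

definition header_in :: "nat list \<Rightarrow> bool" where
  "header_in inp \<longleftrightarrow> length inp = N \<and> 4 \<le> N \<and> inp ! 0 = n \<and> B1 = inp ! 2 div 2 ^ (w - z) \<and>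
    B2 = inp ! 3 div 2 ^ (w - z) + 1"

lemma eval_divisor:
  assumes "regs s r_scale = Z"
  shows "eval w inp s ((Const 0 -\<^sub>e Const 1) div\<^sub>e Reg r_scale +\<^sub>e Const 1) = 2 ^ (w - z)"
proof -
  define g where "g = (2::nat) ^ (w - z) - 1"
  have power_eq: "(2::nat) ^ (w - z) = Suc g" by (simp add: g_def)
  have "(2::nat) ^ w = 2 ^ (w - z) * Z" using z_le by (simp add: Z_def flip: power_add)
  then have "2 ^ w - 1 = (Z - 1) + g * Z" using Z_ge by (simp add: power_eq)
  moreover have "((Z - 1) + g * Z) div Z = g" using Z_ge by (subst div_mult_self1) auto
  ultimately have "(2 ^ w - 1) div Z + 1 = (2::nat) ^ (w - z)" by (simp only: power_eq)
  moreover have "(2::nat) ^ (w - z) < 2 ^ w" using z_ge z_le by (intro power_strict_increasing) auto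
  ultimately show ?thesis using assms w_pos by simp
qed

lemma cap_factors_le: "cap_factor \<le> cap" "cap_factor * L \<le> cap" "scaled_pow Z B1 k div Z + 1 \<le> cap"
proof -
  have "cap_factor * L * 1 \<le> cap" unfolding cap_eq by (intro mult_left_mono) auto
  moreover have "cap_factor * 1 \<le> cap_factor * L" using L by (intro mult_left_mono) auto
  moreover have "1 * (scaled_pow Z B1 k div Z + 1) \<le> cap"
    unfolding cap_eq using cap_factor L by (intro mult_right_mono) auto
  ultimately show "cap_factor \<le> cap" "cap_factor * L \<le> cap" "scaled_pow Z B1 k div Z + 1 \<le> cap"
    unfolding mult_1_right mult_1_left by linarith+
qed

lemma layout_less:
  "cap_factor < 2 ^ w" "cap_factor * L < 2 ^ w" "scaled_pow Z B1 k div Z + 1 < 2 ^ w" "cap < 2 ^ w"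
    "2 * cap < 2 ^ w" "k + 1 < 2 ^ w"
  "L < 2 ^ w" "L * Suc k < 2 ^ w" "2 * (L * Suc k) < 2 ^ w" "buckets < 2 ^ w" "2 * buckets < 2 ^ w"
  "queue_at < 2 ^ w" "heads_at < 2 ^ w" "entries_at < 2 ^ w" "entries_at + 2 * buckets < 2 ^ w" "sets_at < 2 ^ w"
  "34 < (2::nat) ^ w"
  using cap_factors_le memory_bounds no_overflow Z_ge by linarith+

lemma wp_find_depth:
  assumes start: "regs s r_scale = Z" "regs s r_B1 = B1" "regs s r_B2 = B2" "regs s r_n = n"
  shows "wp w inp find_depth (\<lambda>T s'. modifies {r_depth, r_pow1, r_pow2} {} s s' \<and>
    regs s' r_depth = k \<and> regs s' r_pow1 = scaled_pow Z B1 k) s"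
proof -
  define I where "I s' \<longleftrightarrow> modifies {r_depth, r_pow1, r_pow2} {} s s' \<and> regs s' r_depth \<le> k \<and>
    regs s' r_pow2 = scaled_pow Z B2 (regs s' r_depth) \<and> regs s' r_pow1 = scaled_pow Z B1 (regs s' r_depth)" for s'
  have "n \<le> Z" using memory_bounds by linarith
  then have n_mult_le: "n * Z \<le> Z * Z" by simp
  then have small: "n * Z < 2 ^ w" "Suc k < 2 ^ w" using layout_less no_overflow by linarith+
  show ?thesis unfolding find_depth_def
  proof (rule wp_seq, rule wp_assign, rule wp_seq, rule wp_assign, rule wp_seq, rule wp_assign,
      rule wp_while_measure[where I = I and V = "\<lambda>s'. k - regs s' r_depth"], goal_cases init step exit)
    case init
    show ?case using start by (simp add: I_def)
  next
    case (step s1)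
    define j where "j = regs s1 r_depth"
    have state_s1: "regs s1 r_pow2 = scaled_pow Z B2 j" "regs s1 r_pow1 = scaled_pow Z B1 j" "j \<le> k"
      "regs s1 r_scale = Z" "regs s1 r_B1 = B1" "regs s1 r_B2 = B2" "regs s1 r_n = n"
      using step(1) start by (auto simp: I_def j_def modifies_def)
    have less: "scaled_pow Z B2 j < n * Z" using step(2) state_s1 small by simp
    then have j_less: "j < k" using depth(2) state_s1(3) by (cases "j = k") auto
    have "scaled_pow Z B2 j * Z \<le> Z * Z * Z" using less n_mult_le by (intro mult_right_mono) linarith+
    moreover have "scaled_pow Z B1 j * Z \<le> Z * Z * Z"
      using growth_le[OF state_s1(3)] by (intro mult_right_mono) auto
    ultimately have "scaled_pow Z B2 j * Z < 2 ^ w" "scaled_pow Z B1 j * Z < 2 ^ w" using no_overflow by linarith+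
    then show ?case
      by (intro wp_seq wp_assign) (use step(1) state_s1 j_less small w_pos in \<open>simp add: I_def j_def[symmetric]\<close>)
  next
    case (exit T s')
    have "n * Z \<le> scaled_pow Z B2 (regs s' r_depth)" using exit start small by (simp add: I_def modifies_def)
    then have "\<not> regs s' r_depth < k" using depth(1) by (meson linorder_not_less)
    then show ?case using exit(1) by (simp add: I_def)
  qed
qed

lemma wp_set_layout:
  assumes start: "regs s r_scale = Z" "regs s r_divisor = 2 ^ (w - z)" "regs s r_B1 = B1" "regs s r_B2 = B2"
    "regs s r_n = n" "regs s r_depth = k" "regs s r_pow1 = scaled_pow Z B1 k"
  shows "wp w inp (set_layout cap_factor) (\<lambda>T s'. params (regs s') \<and> mem s' = mem s) s"
proof -
  note small = layout_less w_pos
  define s1 where "s1 = s\<lparr>regs := (regs s)(r_reps := L)\<rparr>"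
  define s2 where "s2 = s1\<lparr>regs := (regs s1)(r_cap := cap)\<rparr>"
  define s3 where "s3 = s2\<lparr>regs := (regs s2)(r_buckets := buckets)\<rparr>"
  define s4 where "s4 = s3\<lparr>regs := (regs s3)(r_queue := queue_at)\<rparr>"
  define s5 where "s5 = s4\<lparr>regs := (regs s4)(r_heads := heads_at)\<rparr>"
  define s6 where "s6 = s5\<lparr>regs := (regs s5)(r_entries := entries_at)\<rparr>"
  note states = s1_def s2_def s3_def s4_def s5_def s6_def
  have "8 * (k + 1) < 2 ^ w" using layout_less(7) L_eq by simp
  then have reps: "eval w inp s (Const 8 *\<^sub>e (Reg r_depth +\<^sub>e Const 1)) = L"
    using start small by (simp add: L_eq)
  have cap: "eval w inp s1 (Const cap_factor *\<^sub>e Reg r_reps *\<^sub>e (Reg r_pow1 div\<^sub>e Reg r_scale +\<^sub>e Const 1)) = cap"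
    using start small by (simp add: states cap_eq)
  have buckets: "eval w inp s2 (Reg r_n *\<^sub>e Reg r_cap) = buckets"
    using start small by (simp add: states buckets_def)
  have queue: "eval w inp s3 (Const 34 +\<^sub>e Const 2 *\<^sub>e (Reg r_reps *\<^sub>e (Reg r_depth +\<^sub>e Const 1))) = queue_at"
    using start small by (simp add: states queue_at_def n_seeds_def)
  have heads: "eval w inp s4 (Reg r_queue +\<^sub>e Const 2 *\<^sub>e Reg r_cap) = heads_at"
    using small by (simp add: states heads_at_def)
  have entries: "eval w inp s5 (Reg r_heads +\<^sub>e Reg r_buckets) = entries_at"
    using small by (simp add: states entries_at_def)
  have sets: "eval w inp s6 (Reg r_entries +\<^sub>e Const 2 *\<^sub>e Reg r_buckets +\<^sub>e Const 2) = sets_at"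
    using small by (simp add: states sets_at_def)
  show ?thesis unfolding set_layout_def
    by (rule wp_seq_assign[OF reps s1_def], rule wp_seq_assign[OF cap s2_def],
      rule wp_seq_assign[OF buckets s3_def],
        rule wp_seq_assign[OF queue s4_def], rule wp_seq_assign[OF heads s5_def],
        rule wp_seq_assign[OF entries s6_def], rule wp_assign, unfold sets)
      (use start in \<open>simp add: states params_def\<close>)
qed

lemma wp_set_params:
  assumes inp: "header_in inp"
  shows "wp w inp (set_params cap_factor) (\<lambda>T s'. params (regs s') \<and> params (mem s') \<and> regs s' r_dest = 32 \<and>
    (\<forall>a\<ge>14. mem s' a = 0)) (init (\<lambda>_. 0))"
proof -
  define s1 where "s1 = (init (\<lambda>_. 0))\<lparr>regs := (regs (init (\<lambda>_. 0)))(r_n := n)\<rparr>"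
  have size: "eval w inp (init (\<lambda>_. 0)) (Inp (Const 0)) = n" using inp by (auto simp: header_in_def)
  have w_ge_10: "10 \<le> w" using w_ge by simp
  have small: "13 < (2::nat) ^ w" "32 < (2::nat) ^ w" "B2 < 2 ^ w" using B2 no_overflow Z_ge by auto
  show ?thesis unfolding set_params_def
  proof (rule wp_seq_assign[OF size s1_def], rule wp_seq, rule wp_conseq[OF wp_find_scale[OF w_ge_10]],
      elim conjE,
      goal_cases after)
    case (after T2 s2)
    have state_s2: "regs s2 r_scale = Z" "regs s2 r_n = n" "mem s2 = (\<lambda>_. 0)"
      using after(1) modifies_regs[OF after(2), of r_n] modifies_mem_empty[OF after(2)]
      by (simp_all add: s1_def init_def Z_def z_eq)
    define s3 where "s3 = s2\<lparr>regs := (regs s2)(r_divisor := 2 ^ (w - z))\<rparr>"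
    define s4 where "s4 = s3\<lparr>regs := (regs s3)(r_B1 := B1)\<rparr>"
    define s5 where "s5 = s4\<lparr>regs := (regs s4)(r_B2 := B2)\<rparr>"
    have eval_B1: "eval w inp s3 (Inp (Const 2) div\<^sub>e Reg r_divisor) = B1"
      using inp small by (simp add: s3_def header_in_def)
    have eval_B2: "eval w inp s4 (Inp (Const 3) div\<^sub>e Reg r_divisor +\<^sub>e Const 1) = B2"
      using inp small w_pos by (simp add: s3_def s4_def header_in_def)
    have state_s5: "regs s5 r_scale = Z" "regs s5 r_B1 = B1" "regs s5 r_B2 = B2" "regs s5 r_n = n"
      "regs s5 r_divisor = 2 ^ (w - z)" "mem s5 = (\<lambda>_. 0)"
      using state_s2 by (auto simp: s3_def s4_def s5_def)
    show ?case
    proof (rule wp_seq_assign[OF eval_divisor[OF state_s2(1)] s3_def], rule wp_seq_assign[OF eval_B1 s4_def],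
        rule wp_seq_assign[OF eval_B2 s5_def], rule wp_seq, rule wp_conseq[OF wp_find_depth[OF state_s5(1-4)]],
        elim conjE, goal_cases after)
      case (after T6 s6)
      have state_s6: "regs s6 r_scale = Z" "regs s6 r_divisor = 2 ^ (w - z)" "regs s6 r_B1 = B1"
        "regs s6 r_B2 = B2"
        "regs s6 r_n = n" "mem s6 = (\<lambda>_. 0)"
        using modifies_regs[OF after(1)] modifies_mem_empty[OF after(1)] state_s5 by auto
      show ?case
      proof (rule wp_seq, rule wp_conseq[OF wp_set_layout[OF state_s6(1-5) after(2,3)]], elim conjE, rule wp_seq,
          rule wp_conseq[OF wp_store_upto[of 13]], goal_cases word void after)
        case (after T7 s7 T8 s8)
        have "params (mem s8)" "params ((regs s8)(r_dest := 32))"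
          using after(1) by (rule params_cong, use after(3) in auto)+
        moreover have "mem s8 a = 0" if "14 \<le> a" for a using after(2,3) state_s6 that by auto
        ultimately show ?case using small by (intro wp_assign) simp
      qed (use small in auto)
    qed
  qed
qed

end

lemma run_draw_words_between:
  assumes c1: "exec w inp c1 s t1 s1"
    and draw: "regs s1 r_dest + R = regs s1 r_queue" "regs s1 r_queue < 2 ^ w"
    and c2: "\<And>ws. length ws = R \<Longrightarrow> wp w inp c2 (\<lambda>_. Q ws) (put_words s1 ws)"
  shows "\<exists>T F. run w inp T ([c1 ;; draw_words ;; c2], s) = map_pmf (\<lambda>ws. ([], F ws)) (random_words w R) \<and>
    (\<forall>ws. length ws = R \<longrightarrow> Q ws (F ws))"
proof -
  have "\<exists>t s'. length ws = R \<longrightarrow> exec w inp c2 (put_words s1 ws) t s' \<and> Q ws s'" for ws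
    using c2[of ws] unfolding wp_def by blast
  then obtain time F where F: "\<And>ws. length ws = R \<Longrightarrow> exec w inp c2 (put_words s1 ws) (time ws) (F ws) \<and>
      Q ws (F ws)"
    by metis
  define T where "T = Max (time ` set_pmf (random_words w R))"
  have "run w inp T ([c2], put_words s1 ws) =
      return_pmf ([], F ws)" if ws: "ws \<in> set_pmf (random_words w R)" for ws
  proof (rule run_halted_le)
    show "run w inp (time ws) ([c2], put_words s1 ws) = return_pmf ([], F ws)"
      using F[of ws] ws by (simp add: set_random_words exec_def)
    show "time ws \<le> T" unfolding T_def using finite_random_words ws by (intro Max_ge) auto
  qed
  then have "bind_pmf (random_words w R) (\<lambda>ws. run w inp T ([c2], put_words s1 ws)) =
    map_pmf (\<lambda>ws. ([], F ws)) (random_words w R)"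
    unfolding map_pmf_def by (intro bind_pmf_cong refl)
  moreover have "run w inp (Suc (t1 + Suc (6 * R + 1 + T))) ([c1 ;; draw_words ;; c2], s) =
    bind_pmf (run w inp t1 ([c1, draw_words ;; c2], s)) (run w inp (Suc (6 * R + 1 + T)))"
    by (simp only: run.simps step.simps bind_return_pmf run_add)
  moreover have "\<dots> = run w inp (6 * R + 1 + T) ([draw_words, c2], s1)"
    using c1 unfolding exec_def by (simp only: bind_return_pmf run.simps step.simps)
  moreover have "\<dots> = bind_pmf (random_words w R) (\<lambda>ws. run w inp T ([c2], put_words s1 ws))"
    unfolding run_add[of _ _ "6 * R + 1"] run_draw_words[OF draw] by (simp only: bind_map_pmf)
  ultimately show ?thesis using F by metis
qed

context tuned_layout
begin

lemma build_distribution: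
  assumes inp: "header_in inp" and xss: "sets_in inp xss"
  shows "\<exists>T F. run w inp T ([build_prog cap_factor], init (\<lambda>_. 0)) =
      map_pmf (\<lambda>ws. ([], F ws)) (random_words w (n_seeds + 2)) \<and>
    (\<forall>ws. length ws = n_seeds + 2 \<longrightarrow>
      structure_in (mem (F ws)) (take n_seeds ws) (drop n_seeds ws) inp xss n)"
proof -
  have queue_at: "queue_at = 32 + (n_seeds + 2)" by (simp add: queue_at_def)
  obtain t1 s1 where exec1: "exec w inp (set_params cap_factor) (init (\<lambda>_. 0)) t1 s1"
    and state_s1: "params (regs s1)" "params (mem s1)" "regs s1 r_dest = 32" "\<forall>a\<ge>14. mem s1 a = 0"
    using wp_set_params[OF inp] unfolding wp_def by blast
  show ?thesis unfolding build_prog_def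
  proof (rule run_draw_words_between[OF exec1])
    show "regs s1 r_dest + (n_seeds + 2) = regs s1 r_queue" "regs s1 r_queue < 2 ^ w"
      using state_s1 queue_at layout_less by (auto simp: params_def)
    fix ws :: "nat list"
    assume ws: "length ws = n_seeds + 2"
    have inside: "mem (put_words s1 ws) (32 + i) = ws ! i" if "i < n_seeds + 2" for i
      using mem_put_words_inside[of i ws s1] ws that state_s1(3) by simp
    have outside: "mem (put_words s1 ws) a = mem s1 a" if "a < 32 \<or> queue_at \<le> a" for a
      using mem_put_words_outside[of a s1 ws] ws that state_s1(3) queue_at by simp
    show "wp w inp process_sets
      (\<lambda>_ s'. structure_in (mem s') (take n_seeds ws) (drop n_seeds ws) inp xss n) (put_words s1 ws)"
    proof (rule wp_process_sets[OF _ _ _ _ _ xss])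
      show "params (regs (put_words s1 ws))" using state_s1(1) by (rule params_cong) (simp add: regs_put_words)
      show "params (mem (put_words s1 ws))" using state_s1(2) by (rule params_cong) (simp add: outside)
      show "seeds_in (mem (put_words s1 ws)) (take n_seeds ws)"
        using inside ws by (simp add: seeds_in_def)
      have "queue_at - 2 = 32 + n_seeds" "queue_at - 1 = 32 + (n_seeds + 1)" using queue_at by simp_all
      then show "bucket_seed_in (mem (put_words s1 ws)) (drop n_seeds ws)"
        using inside[of n_seeds] inside[of "n_seeds + 1"] ws by (simp add: bucket_seed_in_def)
      show "\<forall>a\<ge>queue_at. mem (put_words s1 ws) a = 0" using outside state_s1(4) queue_at by auto
    qed
  qed
qed

end

subsection \<open>The queue and the branching process\<close>

text \<open>If \<open>D p\<close> collects the descendants of \<open>p\<close>, expanding nodes leaves this multiset unchanged until the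
  queue is truncated.\<close>

definition reachable :: "(node \<Rightarrow> node multiset) \<Rightarrow> node list \<Rightarrow> nat \<Rightarrow> node multiset" where
  "reachable D Q h = mset (take h Q) + (\<Sum>p\<leftarrow>drop h Q. D p)"

lemma reachable_expand:
  assumes "h < length Q" "D (Q ! h) = add_mset (Q ! h) (\<Sum>c\<leftarrow>ch (Q ! h). D c)"
  shows "reachable D (Q @ ch (Q ! h)) (Suc h) = reachable D Q h"
proof -
  have "drop h Q = Q ! h # drop (Suc h) Q" using assms(1) by (simp add: Cons_nth_drop_Suc)
  moreover have "take (Suc h) Q = take h Q @ [Q ! h]" using assms(1) by (simp add: take_Suc_conv_app_nth)
  ultimately show ?thesis using assms by (simp add: reachable_def ac_simps)
qed

lemma reachable_take:
  assumes "h \<le> cap"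
  shows "reachable D (take cap Q) h \<subseteq># reachable D Q h"
proof -
  have "drop h Q = drop h (take cap Q) @ drop (cap - h) (drop h Q)"
    using assms by (simp only: drop_take append_take_drop_id)
  then have "(\<Sum>p\<leftarrow>drop h Q. D p) = (\<Sum>p\<leftarrow>drop h (take cap Q). D p) + (\<Sum>p\<leftarrow>drop (cap - h) (drop h Q). D p)"
    by (metis map_append sum_list_append)
  then show ?thesis using assms by (simp add: reachable_def min_def)
qed

lemma reachable_bfs:
  assumes D: "\<And>p. P p \<Longrightarrow> D p = add_mset p (\<Sum>c\<leftarrow>ch p. D c)"
    and roots: "\<And>p. p \<in> set roots \<Longrightarrow> P p" and ch: "\<And>p p'. P p \<Longrightarrow> p' \<in> set (ch p) \<Longrightarrow> P p'"
    and cap: "length roots \<le> cap"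
  shows "reachable D (bfs cap ch roots h) h \<subseteq># (\<Sum>p\<leftarrow>roots. D p) \<and>
    (length (bfs cap ch roots h) < cap \<longrightarrow> reachable D (bfs cap ch roots h) h = (\<Sum>p\<leftarrow>roots. D p))"
proof (induction h)
  case 0
  show ?case by (simp add: reachable_def)
next
  case (Suc h)
  define Q where "Q = bfs cap ch roots h"
  show ?case
  proof (cases "h < length Q")
    case False
    then show ?thesis using Suc by (simp add: reachable_def Q_def Let_def)
  next
    case True
    have "P (Q ! h)" unfolding Q_def
      by (rule bfs_invariant[where P = P, OF roots ch nth_mem]) (use True in \<open>auto simp: Q_def\<close>)
    then have expand: "reachable D (Q @ ch (Q ! h)) (Suc h) = reachable D Q h"
      using True by (intro reachable_expand D)
    have Q_cap: "length Q \<le> cap" unfolding Q_def by (rule length_bfs[OF cap])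
    have Suc_Q: "bfs cap ch roots (Suc h) = take cap (Q @ ch (Q ! h))" using True by (simp add: Q_def[symmetric])
    have subset: "reachable D (take cap (Q @ ch (Q ! h))) (Suc h) \<subseteq># reachable D Q h"
      unfolding expand[symmetric] using True Q_cap by (intro reachable_take) simp
    have equal: "reachable D (take cap (Q @ ch (Q ! h))) (Suc h) = reachable D Q h" "length Q < cap"
      if "length (take cap (Q @ ch (Q ! h))) < cap"
      using that expand by auto
    show ?thesis unfolding Suc_Q
      using Suc subset equal unfolding Q_def[symmetric] by (metis subset_mset.order_trans)
  qed
qed

lemma bfs_mset:
  assumes "\<And>p. P p \<Longrightarrow> D p = add_mset p (\<Sum>c\<leftarrow>ch p. D c)"
    and "\<And>p. p \<in> set roots \<Longrightarrow> P p" and "\<And>p p'. P p \<Longrightarrow> p' \<in> set (ch p) \<Longrightarrow> P p'"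
    and cap: "length roots \<le> cap"
  shows "mset (bfs cap ch roots cap) \<subseteq># (\<Sum>p\<leftarrow>roots. D p)"
    and "length (bfs cap ch roots cap) < cap \<Longrightarrow> mset (bfs cap ch roots cap) = (\<Sum>p\<leftarrow>roots. D p)"
  using reachable_bfs[where h = cap, OF assms] length_bfs[OF cap, of ch cap] by (auto simp: reachable_def)

lemma filter_mset_sum: "finite A \<Longrightarrow> filter_mset P (\<Sum>x\<in>A. f x) = (\<Sum>x\<in>A. filter_mset P (f x))"
  by (induction A rule: finite_induct) auto

context layout
begin

primrec desc :: "nat list \<Rightarrow> nat list \<Rightarrow> nat \<Rightarrow> node \<Rightarrow> node multiset" where
  "desc sd xs 0 p = {#p#}"
| "desc sd xs (Suc m) p = add_mset p (\<Sum>c\<leftarrow>kids w z (tau (length xs)) sd xs p. desc sd xs m c)"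

definition level :: "nat \<Rightarrow> nat list \<Rightarrow> nat list \<Rightarrow> nat \<Rightarrow> nat \<Rightarrow> nat list" where
  "level \<tau> xs sd r j = grow w z \<tau> xs [0] (take (2 * j) (drop (r * (2 * Suc k)) sd))"

abbreviation set_level :: "nat list \<Rightarrow> nat list \<Rightarrow> nat \<Rightarrow> nat \<Rightarrow> nat list" where
  "set_level xs \<equiv> level (tau (length xs)) xs"

definition level_nodes :: "nat list \<Rightarrow> nat list \<Rightarrow> nat \<Rightarrow> nat \<Rightarrow> node list" where
  "level_nodes sd xs r j = map (Pair (r * Suc k + j)) (set_level xs sd r j)"

definition tree_size :: "nat list \<Rightarrow> nat list \<Rightarrow> nat" where
  "tree_size sd xs = (\<Sum>r<L. \<Sum>j\<le>k. length (set_level xs sd r j))"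

lemma concat_kids:
  "concat (map (\<lambda>v. kids w z \<tau> sd xs (t, v)) V) =
    map (Pair (Suc t)) (next_level w z \<tau> xs (sd ! (2 * t)) (sd ! (2 * t + 1)) V)"
  by (induction V) (auto simp: kids_def next_level_def keys_def child_id_def[abs_def] o_def)

lemma sum_desc:
  assumes "2 * (t + m) \<le> length sd"
  shows "(\<Sum>v\<leftarrow>V. desc sd xs m (t, v)) =
    (\<Sum>i\<le>m. mset (map (Pair (t + i)) (grow w z (tau (length xs)) xs V (take (2 * i) (drop (2 * t) sd)))))"
  using assms
proof (induction m arbitrary: t V)
  case 0
  show ?case by (induction V) auto
next
  case (Suc m)
  define a c where "a = sd ! (2 * t)" and "c = sd ! (2 * t + 1)"
  have words: "drop (2 * t) sd = a # c # drop (2 * Suc t) sd"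
    using Suc.prems Cons_nth_drop_Suc[of "2 * t" sd] Cons_nth_drop_Suc[of "Suc (2 * t)" sd]
      by (simp add: a_def c_def)
  define V' where "V' = next_level w z (tau (length xs)) xs a c V"
  have kids_V: "concat (map (\<lambda>v. kids w z (tau (length xs)) sd xs (t, v)) V) = map (Pair (Suc t)) V'"
    unfolding V'_def a_def c_def by (rule concat_kids)
  have "(\<Sum>v\<leftarrow>V. desc sd xs (Suc m) (t, v)) =
    mset (map (Pair t) V) + (\<Sum>v\<leftarrow>V. \<Sum>p\<leftarrow>kids w z (tau (length xs)) sd xs (t, v). desc sd xs m p)"
    by (induction V) auto
  also have "(\<Sum>v\<leftarrow>V. \<Sum>p\<leftarrow>kids w z (tau (length xs)) sd xs (t, v). desc sd xs m p) =
    (\<Sum>p\<leftarrow>concat (map (\<lambda>v. kids w z (tau (length xs)) sd xs (t, v)) V). desc sd xs m p)"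
    by (simp only: sum_list_concat map_map o_def)
  also have "\<dots> = (\<Sum>v\<leftarrow>V'. desc sd xs m (Suc t, v))"
    unfolding kids_V by (simp add: o_def)
  also have "\<dots> =
      (\<Sum>i\<le>m. mset (map (Pair (Suc t + i)) (grow w z (tau (length xs)) xs V'
        (take (2 * i) (drop (2 * Suc t) sd)))))"
    by (rule Suc.IH) (use Suc.prems in simp)
  also have "\<dots> =
      (\<Sum>i\<le>m. mset (map (Pair (t + Suc i)) (grow w z (tau (length xs)) xs V (take (2 * Suc i) (drop (2 * t) sd)))))"
    unfolding words by (simp add: V'_def)
  finally show ?case by (simp add: sum.atMost_Suc_shift del: sum.atMost_Suc)
qed

lemma desc_children:
  "desc sd xs (k - fst p mod Suc k) p = add_mset p (\<Sum>c\<leftarrow>children sd xs p. desc sd xs (k - fst c mod Suc k) c)"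
proof (cases "is_leaf p")
  case True
  moreover have "fst p mod Suc k < Suc k" by (rule mod_less_divisor) simp
  ultimately have "fst p mod Suc k = k" unfolding is_leaf_def by linarith
  then show ?thesis using True by (simp add: children_def)
next
  case False
  then have less: "fst p mod Suc k < k" by (simp add: is_leaf_def)
  then obtain m where m: "k - fst p mod Suc k = Suc m" by (metis Suc_diff_Suc)
  have "Suc (fst p) mod Suc k = Suc (fst p mod Suc k)" using less by (simp add: mod_Suc)
  then have "k - fst c mod Suc k = m" if "c \<in> set (children sd xs p)" for c
    using that m False by (auto simp: children_def kids_def)
  then have "(\<Sum>c\<leftarrow>children sd xs p. desc sd xs (k - fst c mod Suc k) c) = (\<Sum>c\<leftarrow>children sd xs p. desc sd xs m c)"
    by (intro arg_cong[where f = sum_list] map_cong) auto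
  then show ?thesis using False m by (simp add: children_def)
qed

lemma desc_roots:
  assumes "length sd = n_seeds"
  shows "(\<Sum>p\<leftarrow>roots. desc sd xs (k - fst p mod Suc k) p) = (\<Sum>r<L. \<Sum>j\<le>k. mset (level_nodes sd xs r j))"
proof -
  have "desc sd xs (k - r * Suc k mod Suc k) (r * Suc k, 0) =
      (\<Sum>j\<le>k. mset (level_nodes sd xs r j))" if "r < L" for r
  proof -
    have "Suc r * Suc k \<le> L * Suc k" using that by (intro mult_right_mono) auto
    then have "2 * (r * Suc k + k) \<le> length sd" using assms by (simp add: n_seeds_def)
    note sum_desc[OF this, of xs "[0]"]
    moreover have "2 * (r * Suc k) = r * (2 * Suc k)" by simp
    ultimately show ?thesis
      by (simp only: level_nodes_def level_def list.map sum_list_simps add_0_right mod_mult_self2_is_0 diff_zero)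
  qed
  then show ?thesis
    by (simp add: roots_def o_def sum_list_distinct_conv_sum_set lessThan_atLeast0 del: mult_Suc_right)
qed

lemma queue_mset:
  assumes "length sd = n_seeds"
  shows "mset (queue sd xs) \<subseteq># (\<Sum>r<L. \<Sum>j\<le>k. mset (level_nodes sd xs r j))"
    and "tree_size sd xs < cap \<Longrightarrow> mset (queue sd xs) = (\<Sum>r<L. \<Sum>j\<le>k. mset (level_nodes sd xs r j))"
proof -
  have "length roots \<le> cap" using L by simp
  note bfs = bfs_mset[where P = good_node and ch = "children sd xs"
    and D = "\<lambda>p. desc sd xs (k - fst p mod Suc k) p",
      OF _ good_roots good_children this, OF desc_children, folded queue_def, unfolded desc_roots[OF assms]]
  show subset: "mset (queue sd xs) \<subseteq># (\<Sum>r<L. \<Sum>j\<le>k. mset (level_nodes sd xs r j))" by (rule bfs(1))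
  assume "tree_size sd xs < cap"
  moreover have "size (\<Sum>r<L. \<Sum>j\<le>k. mset (level_nodes sd xs r j)) = tree_size sd xs"
    by (simp add: tree_size_def size_multiset_sum level_nodes_def)
  ultimately have "length (queue sd xs) < cap" using size_mset_mono[OF subset] by simp
  then show "mset (queue sd xs) = (\<Sum>r<L. \<Sum>j\<le>k. mset (level_nodes sd xs r j))"
    using bfs(2) by simp
qed

lemma is_leaf_iff: "j \<le> k \<Longrightarrow> is_leaf (r * Suc k + j, v) \<longleftrightarrow> j = k"
  unfolding is_leaf_def fst_conv mod_mult_self3 by auto

lemma leaf_in_queue:
  assumes "length sd = n_seeds" "tree_size sd xs < cap" "r < L" "v \<in> set (set_level xs sd r k)"
  shows "(r * Suc k + k, v) \<in> set (queue sd xs)"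
proof -
  have "(r * Suc k + k, v) \<in># mset (level_nodes sd xs r k)" using assms(4) by (auto simp: level_nodes_def)
  also have "set_mset (mset (level_nodes sd xs r k)) \<subseteq> set_mset (\<Sum>r<L. \<Sum>j\<le>k. mset (level_nodes sd xs r j))"
    using assms(3) by (auto simp: set_mset_sum)
  finally show ?thesis using queue_mset(2)[OF assms(1,2)] by (metis set_mset_mset)
qed

abbreviation leaves :: "nat list \<Rightarrow> nat list \<Rightarrow> node list" where
  "leaves sd xs \<equiv> filter is_leaf (queue sd xs)"

lemma leaves_mset:
  assumes "length sd = n_seeds"
  shows "mset (leaves sd xs) \<subseteq># mset (concat (map (\<lambda>r. level_nodes sd xs r k) [0..<L]))"
proof -
  have "filter_mset is_leaf (mset (level_nodes sd xs r j)) =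
      (if j = k then mset (level_nodes sd xs r k) else {#})"
    if "j \<le> k" for r j
    using is_leaf_iff[OF that, of r]
    by (auto simp: level_nodes_def filter_mset_eq_conv simp flip: mset_filter simp del: mult_Suc_right)
  then have "filter_mset is_leaf (\<Sum>r<L. \<Sum>j\<le>k. mset (level_nodes sd xs r j)) =
    (\<Sum>r<L. \<Sum>j\<le>k. if j = k then mset (level_nodes sd xs r k) else {#})"
    by (simp add: filter_mset_sum)
  also have "\<dots> = mset (concat (map (\<lambda>r. level_nodes sd xs r k) [0..<L]))"
    by (simp add: mset_concat o_def sum_list_distinct_conv_sum_set lessThan_atLeast0)
  finally show ?thesis using multiset_filter_mono[OF queue_mset(1)[OF assms], of is_leaf xs] by simp
qed

end

lemma coll_mono_mset:
  assumes "mset A \<subseteq># mset A'" "mset B \<subseteq># mset B'"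
  shows "coll A B \<le> coll A' B'"
proof -
  have conv: "coll X Y = (\<Sum>x\<in>#mset X. real (count (mset Y) x))" for X Y :: "'a list"
    by (simp add: coll_conv_count_list count_mset flip: sum_mset_sum_list)
  have nonneg: "0 \<le> (\<Sum>x\<in>#M. real (count N x))" for M N :: "'a multiset"
    by (induction M) auto
  have "(\<Sum>x\<in>#mset A. real (count (mset B) x)) \<le> (\<Sum>x\<in>#mset A. real (count (mset B') x))"
    using assms(2) by (intro sum_mset_mono) (auto simp: mset_subset_eq_count)
  also have "\<dots> \<le> (\<Sum>x\<in>#mset A. real (count (mset B') x)) + (\<Sum>x\<in>#mset A' - mset A. real (count (mset B') x))"
    using nonneg by simp
  also have "\<dots> = (\<Sum>x\<in>#mset A'. real (count (mset B') x))"
    using assms(1) by (metis image_mset_union subset_mset.add_diff_inverse sum_mset.union)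
  finally show ?thesis by (simp only: conv)
qed

lemma coll_concat: "coll (concat As) (concat Bs) = (\<Sum>A\<leftarrow>As. \<Sum>B\<leftarrow>Bs. coll A B)"
proof -
  have "coll A (concat Bs) = (\<Sum>B\<leftarrow>Bs. coll A B)" for A
    unfolding coll_def sum_list_concat by (rule sum_list_swap)
  then show ?thesis by (induction As) (auto simp: coll_def)
qed

lemma coll_map_Pair: "coll (map (Pair s) A) (map (Pair t) B) = of_bool (s = t) * coll A B"
  by (auto simp: coll_def o_def sum_list_const_mult)

lemma coll_concat_tagged:
  assumes "distinct rs" "inj_on t (set rs)"
  shows "coll (concat (map (\<lambda>r. map (Pair (t r)) (A r)) rs)) (concat (map (\<lambda>r. map (Pair (t r)) (B r)) rs)) =
    (\<Sum>r\<in>set rs. coll (A r) (B r))"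
proof -
  have "coll (concat (map (\<lambda>r. map (Pair (t r)) (A r)) rs)) (concat (map (\<lambda>r. map (Pair (t r)) (B r)) rs)) =
    (\<Sum>r\<in>set rs. \<Sum>r'\<in>set rs. of_bool (t r = t r') * coll (A r) (B r'))"
    using assms(1) by (simp add: coll_concat coll_map_Pair o_def sum_list_distinct_conv_sum_set)
  also have "\<dots> = (\<Sum>r\<in>set rs. \<Sum>r'\<in>set rs. if r = r' then coll (A r) (B r) else 0)"
    using assms(2) by (intro sum.cong refl) (auto simp: inj_on_eq_iff)
  finally show ?thesis by simp
qed

lemma (in layout) coll_leaves:
  assumes "length sd = n_seeds"
  shows "coll (leaves sd ys) (leaves sd xs) \<le> (\<Sum>r<L. coll (set_level ys sd r k) (set_level xs sd r k))"
proof -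
  have "inj_on (\<lambda>r. r * Suc k + k) (set [0..<L])" by (auto simp: inj_on_def simp del: mult_Suc_right)
  then have "coll (concat (map (\<lambda>r. level_nodes sd ys r k) [0..<L]))
    (concat (map (\<lambda>r. level_nodes sd xs r k) [0..<L])) =
    (\<Sum>r<L. coll (set_level ys sd r k) (set_level xs sd r k))"
    unfolding level_nodes_def by (subst coll_concat_tagged) (auto simp: lessThan_atLeast0)
  then show ?thesis using coll_mono_mset[OF leaves_mset leaves_mset, OF assms assms, of ys xs] by simp
qed

subsection \<open>False candidates\<close>

lemma sum_of_bool_mod_eq_le:
  assumes "0 < m" "m \<le> Z"
  shows "(\<Sum>\<beta><Z. of_bool (\<beta> mod m = r)) \<le> 2 * real Z / real m"
proof -
  define S where "S = {\<beta>. \<beta> < Z \<and> \<beta> mod m = r}"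
  have "inj_on (\<lambda>\<beta>. \<beta> div m) S"
    by (intro inj_onI) (metis (mono_tags, lifting) S_def div_mult_mod_eq mem_Collect_eq)
  moreover have "(\<lambda>\<beta>. \<beta> div m) ` S \<subseteq> {..Z div m}" by (auto simp: S_def div_le_mono)
  ultimately have "card S \<le> card {..Z div m}" by (intro card_inj_on_le) auto
  then have "real (card S) \<le> real (Z div m) + 1" by simp
  also have "\<dots> \<le> real Z / real m + real Z / real m"
    using assms by (intro add_mono of_nat_div_le_of_nat) auto
  finally have "real (card S) \<le> 2 * real Z / real m" by simp
  moreover have "(\<Sum>\<beta><Z. of_bool (\<beta> mod m = r)) = real (card S)"
    by (simp add: of_bool_def sum.If_cases S_def Int_def lessThan_def)
  ultimately show ?thesis by simp
qed

lemma length_filter_chain: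
  "length (filter P (chain es b (length es))) = length (filter (\<lambda>(b', i). b' = b \<and> P i) es)"
proof -
  have "length (filter P (chain es b (length es))) = size (filter_mset P (mset (chain es b (length es))))"
    by (simp flip: mset_filter)
  also have "\<dots> = length (filter P (map snd (filter (\<lambda>q. fst q = b) es)))"
    unfolding mset_chain[OF le_refl] by (simp flip: mset_filter mset_map)
  also have "\<dots> = length (filter (\<lambda>(b', i). b' = b \<and> P i) es)"
    by (simp add: filter_map o_def case_prod_unfold conj_commute)
  finally show ?thesis .
qed

context layout
begin

lemma expect_bucket_eq:
  assumes "good_node p" "good_node p'" "p \<noteq> p'"
  shows "expect w 2 (\<lambda>f. of_bool (bucket f p' = bucket f p)) \<le> 2 / real buckets"
proof -
  define key :: "node \<Rightarrow> nat" where "key q = snd q * 2 ^ z + fst q" for q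
  have "L * Suc k \<le> Z" "buckets \<le> Z" using memory_bounds by linarith+
  then have bounded: "fst q < 2 ^ z" "snd q < 2 ^ z" if "good_node q" for q
    using that by (auto simp: good_node_def simp flip: Z_def)
  then have key_le: "key q * 2 ^ z \<le> 2 ^ w" if "good_node q" for q
    unfolding key_def using that zw by (intro key_mult_le) auto
  have "key p' \<noteq> key p"
    unfolding key_def using assms bounded by (subst key_eq_iff) (auto simp: prod_eq_iff)
  from expect_hash_pair[OF this key_le[OF assms(2)] key_le[OF assms(1)] z_le,
      of "\<lambda>\<alpha> \<beta>. of_bool (\<alpha> mod buckets = \<beta> mod buckets)"]
  have "expect w 2 (\<lambda>f. of_bool (bucket f p' = bucket f p)) =
    (\<Sum>\<alpha><2 ^ z. \<Sum>\<beta><2 ^ z. of_bool (\<alpha> mod buckets = \<beta> mod buckets)) / (2 ^ z)\<^sup>2"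
    by (simp add: bucket_def key_def flip: Z_def)
  also have "\<dots> \<le> (\<Sum>\<alpha><(2::nat) ^ z. 2 * real Z / real buckets) / (2 ^ z)\<^sup>2"
  proof (intro divide_right_mono sum_mono)
    fix \<alpha>
    show "(\<Sum>\<beta><2 ^ z. of_bool (\<alpha> mod buckets = \<beta> mod buckets)) \<le> 2 * real Z / real buckets"
      using sum_of_bool_mod_eq_le[OF _ \<open>buckets \<le> Z\<close>, of "\<alpha> mod buckets"] memory_bounds
      by (simp add: Z_def eq_commute)
  qed simp
  also have "\<dots> = 2 / real buckets" by (simp add: Z_def power2_eq_square)
  finally show ?thesis .
qed

lemma length_filter_leaf_entries:
  "real (length (filter (\<lambda>(b', j). b' = b \<and> P j) (leaf_entries f i Q))) =
    (if P i then \<Sum>p\<leftarrow>filter is_leaf Q. of_bool (bucket f p = b) else 0)"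
  by (induction Q) (auto simp: leaf_entries_def)

lemma length_filter_entries:
  "real (length (filter (\<lambda>(b', j). b' = b \<and> P j) (entries sd f xss m))) =
    (\<Sum>i\<leftarrow>filter P [0..<m]. \<Sum>p\<leftarrow>leaves sd (xss ! i). of_bool (bucket f p = b))"
  by (induction m) (auto simp: entries_0 entries_Suc length_filter_leaf_entries)

lemma length_filter_candidates:
  "real (length (filter P (candidates (entries sd f xss m) f Q))) =
    (\<Sum>i\<leftarrow>filter P [0..<m]. \<Sum>p\<leftarrow>filter is_leaf Q. \<Sum>p'\<leftarrow>leaves sd (xss ! i). of_bool (bucket f p' = bucket f p))"
proof -
  have "real (length (filter P (candidates (entries sd f xss m) f Q))) =
    (\<Sum>p\<leftarrow>filter is_leaf Q. \<Sum>i\<leftarrow>filter P [0..<m]. \<Sum>p'\<leftarrow>leaves sd (xss ! i). of_bool (bucket f p' = bucket f p))"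
    by (induction Q) (auto simp: candidates_def length_filter_chain length_filter_entries)
  also have "\<dots> =
      (\<Sum>i\<leftarrow>filter P [0..<m]. \<Sum>p\<leftarrow>filter is_leaf Q. \<Sum>p'\<leftarrow>leaves sd (xss ! i). of_bool (bucket f p' = bucket f p))"
    by (rule sum_list_swap)
  finally show ?thesis .
qed

definition reject_count :: "nat list \<Rightarrow> nat list \<Rightarrow> nat list list \<Rightarrow> nat list \<Rightarrow> nat" where
  "reject_count sd f xss ys =
    length (filter (\<lambda>i. \<not> accept ys (xss ! i)) (candidates (entries sd f xss n) f (queue sd ys)))"

text \<open>Candidates are pairs of leaves in a common bucket: either equal leaves, or different ones with
  colliding bucket hashes.\<close>

lemma expect_reject_count:
  assumes "length sd = n_seeds"
  shows "expect w 2 (\<lambda>f. real (reject_count sd f xss ys)) \<le>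
    (\<Sum>i\<leftarrow>filter (\<lambda>i. \<not> accept ys (xss ! i)) [0..<n]. \<Sum>r<L. coll (set_level ys sd r k)
      (set_level (xss ! i) sd r k)) +
    2 * real cap"
proof -
  define I where "I = filter (\<lambda>i. \<not> accept ys (xss ! i)) [0..<n]"
  have length_I: "length I \<le> n" using length_filter_le[of _ "[0..<n]"] by (simp add: I_def)
  have good: "good_node p" if "p \<in> set (leaves sd xs)" for p xs using that good_queue[of p sd xs] by simp
  have length_leaves: "real (length (leaves sd xs)) \<le> real cap" for xs
    using le_trans[OF length_filter_le length_queue] by simp
  have pair: "expect w 2 (\<lambda>f. of_bool (bucket f p' = bucket f p)) \<le> of_bool (p = p') * 1 + 2 / real buckets"
    if "good_node p" "good_node p'" for p p'
    using expect_bucket_eq[OF that] by (cases "p = p'") auto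
  have "expect w 2 (\<lambda>f. real (reject_count sd f xss ys)) =
    (\<Sum>i\<leftarrow>I. \<Sum>p\<leftarrow>leaves sd ys. \<Sum>p'\<leftarrow>leaves sd (xss ! i). expect w 2 (\<lambda>f. of_bool (bucket f p' = bucket f p)))"
    unfolding reject_count_def length_filter_candidates I_def[symmetric] by (simp add: integral_sum_list)
  also have "\<dots> \<le> (\<Sum>i\<leftarrow>I. \<Sum>p\<leftarrow>leaves sd ys. \<Sum>p'\<leftarrow>leaves sd (xss ! i). of_bool (p = p') * 1 + 2 / real buckets)"
    by (intro sum_list_mono pair) (auto intro: good)
  also have "\<dots> = (\<Sum>i\<leftarrow>I. coll (leaves sd ys) (leaves sd (xss ! i)) +
      real (length (leaves sd ys)) * real (length (leaves sd (xss ! i))) * (2 / real buckets))"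
    unfolding sum_list_pairs by simp
  also have "\<dots> \<le> (\<Sum>i\<leftarrow>I. (\<Sum>r<L. coll (set_level ys sd r k) (set_level (xss ! i) sd r k)) +
      real cap * real cap * (2 / real buckets))"
    using assms by (intro sum_list_mono add_mono coll_leaves mult_mono length_leaves) auto
  also have "\<dots> = (\<Sum>i\<leftarrow>I. \<Sum>r<L. coll (set_level ys sd r k) (set_level (xss ! i) sd r k)) +
      real (length I) * (real cap * real cap * (2 / real buckets))"
    by (simp only: sum_list_addf sum_list_triv)
  also have "real (length I) * (real cap * real cap * (2 / real buckets)) \<le>
    real n * (real cap * real cap * (2 / real buckets))"
    using length_I by (intro mult_right_mono) auto
  also have "\<dots> = 2 * real cap" using n L by (simp add: buckets_def)
  finally show ?thesis by (simp add: I_def)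
qed

end

subsection \<open>The success probability\<close>

lemma of_bool_ball_lessThan: "of_bool (\<forall>r<n. P r) = (\<Prod>r<n. of_bool (P r) :: real)" for n :: nat
  by (induction n) (auto simp: less_Suc_eq)

lemma exists_in_take:
  assumes "i \<in> set C" "P i" "length (filter (\<lambda>i. \<not> P i) C) < m"
  shows "\<exists>i\<in>set (take m C). P i"
proof (rule ccontr)
  assume none: "\<not> ?thesis"
  then have "filter (\<lambda>i. \<not> P i) (take m C) = take m C" by (intro filter_True) auto
  then have "length (take m C) \<le> length (filter (\<lambda>i. \<not> P i) C)"
    by (metis append_take_drop_id filter_append length_append le_add1)
  then have "take m C = C" using assms(3) by simp
  then show False using none assms(1,2) by auto
qed

context layout
begin

lemma expect_level:
  assumes "r < L" "j \<le> k"
  shows "expect w n_seeds (\<lambda>sd. f (level \<tau> xs sd r j) (level \<tau>' xs' sd r j)) =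
    expect w (2 * j) (\<lambda>ws. f (grow w z \<tau> xs [0] ws) (grow w z \<tau>' xs' [0] ws))"
proof -
  have "Suc r * Suc k \<le> L * Suc k" using assms by (intro mult_right_mono) auto
  then have "r * (2 * Suc k) + 2 * j + (n_seeds - (r * (2 * Suc k) + 2 * j)) = n_seeds"
    using assms by (simp add: n_seeds_def)
  then show ?thesis
    using expect_block[where p = "r * (2 * Suc k)" and m = "2 * j" and q = "n_seeds - (r * (2 * Suc k) + 2 * j)"
        and f = "\<lambda>ws. f (grow w z \<tau> xs [0] ws) (grow w z \<tau>' xs' [0] ws)"]
    unfolding level_def by simp
qed

lemma level_mono:
  assumes "set xs \<subseteq> set xs'" "\<tau> \<le> \<tau>'"
  shows "set (level \<tau> xs sd r j) \<subseteq> set (level \<tau>' xs' sd r j)"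
  unfolding level_def using assms by (rule set_grow_mono) simp

lemma expect_tree_size:
  assumes "real (length xs) * pass_prob z (tau (length xs)) \<le> M"
  shows "expect w n_seeds (\<lambda>sd. real (tree_size sd xs)) \<le> real L * (\<Sum>j\<le>k. M ^ j)"
proof -
  have "expect w n_seeds (\<lambda>sd. real (length (set_level xs sd r j))) \<le> M ^ j" if "r < L" "j \<le> k" for r j
  proof -
    have "expect w n_seeds (\<lambda>sd. real (length (set_level xs sd r j))) =
      (real (length xs) * pass_prob z (tau (length xs))) ^ j"
      using expect_level[OF that, where f = "\<lambda>a b. real (length a)"] expect_length_grow[OF z_le] by simp
    also have "\<dots> \<le> M ^ j" using assms by (intro power_mono) (auto simp: pass_prob_nonneg)
    finally show ?thesis .
  qed
  then have "(\<Sum>r<L. \<Sum>j\<le>k. expect w n_seeds (\<lambda>sd. real (length (set_level xs sd r j)))) \<le> (\<Sum>r<L. \<Sum>j\<le>k. M ^ j)"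
    by (intro sum_mono) auto
  then show ?thesis by (simp add: tree_size_def)
qed

lemma expect_no_survivor:
  assumes xs: "set xs \<subseteq> {..<2 ^ z}" "distinct xs" and mean: "1 \<le> real (length xs) * pass_prob z \<tau>"
    and \<epsilon>: "0 \<le> \<epsilon>" "1 \<le> pass_prob z \<tau> * 2 ^ z * \<epsilon>" "\<epsilon> * (real k)\<^sup>2 \<le> 1" and L: "L = 8 * Suc k"
  shows "expect w n_seeds (\<lambda>sd. of_bool (\<forall>r<L. level \<tau> xs sd r k = [])) \<le> 1 / 16"
proof -
  define dead :: "nat list \<Rightarrow> real" where "dead = (\<lambda>ws. of_bool (grow w z \<tau> xs [0] (take (2 * k) ws) = []))"
  define E where "E = expect w (2 * Suc k) dead"
  have "1 / (2 * real k + 2) \<le> expect w (2 * k) (\<lambda>ws. of_bool (grow w z \<tau> xs [0] ws \<noteq> []))"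
    using xs mean \<epsilon> zw by (intro grow_survives) auto
  also have "\<dots> = 1 - expect w (2 * k) (\<lambda>ws. of_bool (grow w z \<tau> xs [0] ws = []))"
    by (simp add: of_bool_not_iff)
  also have "expect w (2 * k) (\<lambda>ws. of_bool (grow w z \<tau> xs [0] ws = [])) = E"
    using expect_block[of w 0 "2 * k" 2 "\<lambda>ws. of_bool (grow w z \<tau> xs [0] ws = [])"] by (simp add: E_def dead_def)
  finally have E_le: "E \<le> 1 - 1 / (2 * real k + 2)" by simp
  have E_nonneg: "0 \<le> E" by (simp add: E_def dead_def)
  have "of_bool (\<forall>r<L. level \<tau> xs sd r k = []) = (\<Prod>r<L. dead (take (2 * Suc k) (drop (r * (2 * Suc k)) sd)))"
    for sd
    unfolding of_bool_ball_lessThan by (simp add: level_def dead_def min_def)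
  moreover have "n_seeds = L * (2 * Suc k)" by (simp add: n_seeds_def)
  ultimately have "expect w n_seeds (\<lambda>sd. of_bool (\<forall>r<L. level \<tau> xs sd r k = [])) = E ^ L"
    by (simp only: expect_prod_blocks E_def)
  also have "\<dots> \<le> (1 - 1 / (2 * real k + 2)) ^ L" using E_nonneg E_le by (rule power_mono[rotated])
  also have "\<dots> \<le> exp (- 1 / (2 * real k + 2)) ^ L"
    using exp_ge_add_one_self[of "- 1 / (2 * real k + 2)"] by (intro power_mono) (auto simp: field_simps)
  also have "\<dots> = exp (- 4)"
    unfolding exp_of_nat_mult[symmetric] L by (simp add: field_simps)
  also have "\<dots> = (1 / exp 1) ^ 4" by (simp add: exp_minus power_one_over inverse_eq_divide flip: exp_of_nat_mult)
  also have "\<dots> \<le> (1 / 2) ^ 4" using exp_ge_add_one_self[of 1] by (intro power_mono divide_left_mono) auto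
  also have "\<dots> = 1 / 16" by (simp add: power_one_over)
  finally show ?thesis .
qed

definition finds :: "nat list \<Rightarrow> nat list \<Rightarrow> nat list list \<Rightarrow> nat list \<Rightarrow> bool" where
  "finds sd f xss ys \<longleftrightarrow>
    (\<exists>i\<in>set (take (40 * cap) (candidates (entries sd f xss n) f (queue sd ys))). accept ys (xss ! i))"

text \<open>A survivor of the tree of common elements is a leaf of both trees.\<close>

lemma finds_of_survivor:
  assumes length_sd: "length sd = n_seeds" and i: "i < n" "accept ys (xss ! i)"
    and small: "tree_size sd (xss ! i) < cap" "tree_size sd ys < cap"
    and survivor: "r < L" "level (min (tau (length (xss ! i))) (tau (length ys))) common sd r k \<noteq> []"
    and common: "set common \<subseteq> set (xss ! i)" "set common \<subseteq> set ys"
    and rejects: "reject_count sd f xss ys < 40 * cap"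
  shows "finds sd f xss ys"
proof -
  obtain v where v: "v \<in> set (level (min (tau (length (xss ! i))) (tau (length ys))) common sd r k)"
    using survivor(2) by (metis list.set_intros(1) neq_Nil_conv)
  then have "v \<in> set (set_level (xss ! i) sd r k)" "v \<in> set (set_level ys sd r k)"
    using level_mono[OF common(1) min.cobounded1] level_mono[OF common(2) min.cobounded2] by blast+
  moreover define p where "p = (r * Suc k + k, v)"
  ultimately have leaf_p: "p \<in> set (leaves sd (xss ! i))" "p \<in> set (leaves sd ys)"
    using leaf_in_queue[OF length_sd small(1) survivor(1)] leaf_in_queue[OF length_sd small(2) survivor(1)]
      is_leaf_iff[of k]
    by (simp_all del: mult_Suc_right)
  define es where "es = entries sd f xss n"
  have "(bucket f p, i) \<in> set es"
    unfolding es_def entries_def leaf_entries_def using leaf_p(1) i by auto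
  then have "i \<in># mset (chain es (bucket f p) (length es))"
    unfolding mset_chain[OF le_refl] by (auto simp: image_iff intro!: bexI[of _ "(bucket f p, i)"])
  then have "i \<in> set (candidates es f (queue sd ys))"
    unfolding candidates_def using leaf_p(2) by auto
  then show ?thesis unfolding finds_def es_def[symmetric]
    by (rule exists_in_take) (use i rejects in \<open>auto simp: reject_count_def es_def\<close>)
qed

end

text \<open>Set \<open>i0\<close> is acceptable for the query \<open>ys\<close>. Here \<open>M\<close> bounds the branching of the trees of single sets,
  \<open>\<eta>\<close> that of the pairs formed by the query and a set that it rejects, and \<open>\<epsilon>\<close> controls the variance.\<close>

locale planted_query = layout +
  fixes xss :: "nat list list" and ys :: "nat list" and i0 d :: nat and M \<eta> \<epsilon> :: real
  assumes sets: "\<And>i. i < n \<Longrightarrow> distinct (xss ! i) \<and> set (xss ! i) \<subseteq> {..<Z} \<and> length (xss ! i) \<le> d"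
    and query: "distinct ys" "set ys \<subseteq> {..<Z}" "length ys \<le> d"
    and planted: "i0 < n" "accept ys (xss ! i0)"
    and M: "1 \<le> M" "\<And>m. m \<le> d \<Longrightarrow> real m * pass_prob z (tau m) \<le> M"
    and \<eta>: "0 \<le> \<eta>" "\<eta> \<le> M" "\<And>i. i < n \<Longrightarrow> \<not> accept ys (xss ! i) \<Longrightarrow>
      coll ys (xss ! i) * pass_prob z (min (tau (length ys)) (tau (length (xss ! i)))) \<le> \<eta>"
    and close: "1 \<le> real (card (set (xss ! i0) \<inter> set ys)) *
      pass_prob z (min (tau (length (xss ! i0))) (tau (length ys)))"
    and \<epsilon>: "0 \<le> \<epsilon>" "1 \<le> pass_prob z (min (tau (length (xss ! i0))) (tau (length ys))) * 2 ^ z * \<epsilon>"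
      "\<epsilon> * (real k)\<^sup>2 \<le> 1"
    and cap_tree: "10 * (real L * (\<Sum>j\<le>k. M ^ j)) \<le> real cap"
    and cap_reject: "real L * (real n * (\<eta> ^ k + real k * (2 * M * M) ^ k * (real d * real d / 2 ^ z))) \<le>
        real cap"
    and reps: "L = 8 * Suc k"
begin

definition "common = filter (\<lambda>i. i \<in> set ys) (xss ! i0)"

definition no_survivor :: "nat list \<Rightarrow> bool" where
  "no_survivor sd \<longleftrightarrow> (\<forall>r<L. level (min (tau (length (xss ! i0))) (tau (length ys))) common sd r k = [])"

lemma not_finds_le:
  assumes "length sd = n_seeds"
  shows "of_bool (\<not> finds sd f xss ys) \<le> of_bool (no_survivor sd) + real (tree_size sd (xss ! i0)) / real cap +
    real (tree_size sd ys) / real cap + real (reject_count sd f xss ys) / (40 * real cap)"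
proof -
  have cap_pos: "0 < real cap" using memory_bounds by simp
  consider "finds sd f xss ys" | "no_survivor sd" | "cap \<le> tree_size sd (xss ! i0)" | "cap \<le> tree_size sd ys" |
    "40 * cap \<le> reject_count sd f xss ys"
    using finds_of_survivor[OF assms planted, where common = common and f = f]
    by (force simp: no_survivor_def common_def not_le)
  then show ?thesis
  proof cases
    case 1
    then show ?thesis by simp
  next
    case 2
    then show ?thesis by simp
  next
    case 3
    then have "1 \<le> real (tree_size sd (xss ! i0)) / real cap" using cap_pos by simp
    then show ?thesis by (smt (verit) of_bool_def divide_nonneg_nonneg of_nat_0_le_iff)
  next
    case 4
    then have "1 \<le> real (tree_size sd ys) / real cap" using cap_pos by simp
    then show ?thesis by (smt (verit) of_bool_def divide_nonneg_nonneg of_nat_0_le_iff)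
  next
    case 5
    then have "1 \<le> real (reject_count sd f xss ys) / (40 * real cap)" using cap_pos by (simp add: field_simps)
    then show ?thesis by (smt (verit) of_bool_def divide_nonneg_nonneg of_nat_0_le_iff)
  qed
qed

lemma expect_no_survivor_planted: "expect w n_seeds (\<lambda>sd. of_bool (no_survivor sd)) \<le> 1 / 16"
proof -
  have "set common = set (xss ! i0) \<inter> set ys" by (auto simp: common_def)
  moreover have "distinct common" using sets[OF planted(1)] by (simp add: common_def)
  ultimately have "length common = card (set (xss ! i0) \<inter> set ys)" by (metis distinct_card)
  then show ?thesis
    unfolding no_survivor_def using sets[OF planted(1)] close \<epsilon> reps \<open>distinct common\<close> \<open>set common = _\<close>
    by (intro expect_no_survivor) (auto simp: Z_def)
qed

lemma expect_tree_size_planted: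
  assumes "length xs \<le> d"
  shows "expect w n_seeds (\<lambda>sd. real (tree_size sd xs)) / real cap \<le> 1 / 10"
  using expect_tree_size[OF M(2)[OF assms]] cap_tree memory_bounds by (simp add: field_simps)

lemma expect_coll_level:
  assumes i: "i < n" "\<not> accept ys (xss ! i)" and r: "r < L"
  shows "expect w n_seeds (\<lambda>sd. coll (set_level ys sd r k) (set_level (xss ! i) sd r k)) \<le>
    \<eta> ^ k + real k * (2 * M * M) ^ k * (real d * real d / 2 ^ z)"
proof -
  define xs where "xs = xss ! i"
  have xs: "set xs \<subseteq> {..<2 ^ z}" "length xs \<le> d" using sets[OF i(1)] by (auto simp: xs_def Z_def)
  have "real (length ys) * real (length xs) * pass_prob z (min (tau (length ys)) (tau (length xs))) \<le>
      real d * real d * 1"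
    using xs query by (intro mult_mono) (auto simp: pass_prob_nonneg pass_prob_le_1)
  then have pairs: "real (length ys) * real (length xs) *
    pass_prob z (min (tau (length ys)) (tau (length xs))) / 2 ^ z \<le>
    real d * real d / 2 ^ z"
    by (simp add: divide_right_mono)
  have "1 \<le> M * M" "M \<le> M * M" using M(1) mult_mono[of 1 M 1 M] mult_right_mono[of 1 M M] by auto
  moreover have "(real (length ys) * pass_prob z (tau (length ys))) *
    (real (length xs) * pass_prob z (tau (length xs))) \<le> M * M"
    using M xs query by (intro mult_mono) (auto simp: pass_prob_nonneg)
  ultimately have "expect w (2 * k) (\<lambda>ws. coll (grow w z (tau (length ys)) ys [0] ws)
    (grow w z (tau (length xs)) xs [0] ws)) \<le>
    \<eta> ^ k * coll [0] [0 :: nat] + real k * (2 * M * M) ^ k * (real d * real d / 2 ^ z) *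
      (real (length [0::nat]) * real (length [0::nat]))"
    using xs query zw \<eta> \<eta>(3)[OF i, folded xs_def] pairs by (intro expect_coll_grow) (auto simp: Z_def)
  then show ?thesis
    using expect_level[OF r order_refl, where f = coll] by (simp add: xs_def)
qed

lemma expect_reject_count_planted:
  "expect w n_seeds (\<lambda>sd. expect w 2 (\<lambda>f. real (reject_count sd f xss ys))) \<le> 3 * real cap"
proof -
  define I where "I = filter (\<lambda>i. \<not> accept ys (xss ! i)) [0..<n]"
  define K where "K = \<eta> ^ k + real k * (2 * M * M) ^ k * (real d * real d / 2 ^ z)"
  have "0 \<le> K" using \<eta>(1) M(1) by (simp add: K_def)
  have "expect w n_seeds (\<lambda>sd. expect w 2 (\<lambda>f. real (reject_count sd f xss ys))) \<le>
    expect w n_seeds (\<lambda>sd. (\<Sum>i\<leftarrow>I. \<Sum>r<L. coll (set_level ys sd r k) (set_level (xss ! i) sd r k)) + 2 * real cap)"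
    unfolding I_def by (intro expect_mono expect_reject_count)
  also have "\<dots> = (\<Sum>i\<leftarrow>I. \<Sum>r<L. expect w n_seeds (\<lambda>sd. coll (set_level ys sd r k) (set_level (xss ! i) sd r k))) +
    2 * real cap"
    by (simp add: integral_sum_list)
  also have "\<dots> \<le> (\<Sum>i\<leftarrow>I. \<Sum>r<L. K) + 2 * real cap"
    unfolding K_def by (intro add_right_mono sum_list_mono sum_mono expect_coll_level) (auto simp: I_def)
  also have "(\<Sum>i\<leftarrow>I. \<Sum>r<L. K) = real (length I) * (real L * K)" by (simp add: sum_list_triv)
  also have "\<dots> \<le> real n * (real L * K)"
    using \<open>0 \<le> K\<close> length_filter_le[of _ "[0..<n]"] by (intro mult_right_mono) (auto simp: I_def)
  also have "\<dots> \<le> real cap" using cap_reject by (simp add: K_def mult_ac)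
  finally show ?thesis by simp
qed

lemma success_probability:
  "1 / 2 \<le> expect w (n_seeds + 2) (\<lambda>ws. of_bool (finds (take n_seeds ws) (drop n_seeds ws) xss ys))"
proof -
  have cap_pos: "0 < real cap" using memory_bounds by simp
  have "expect w (n_seeds + 2) (\<lambda>ws. of_bool (\<not> finds (take n_seeds ws) (drop n_seeds ws) xss ys)) =
    expect w n_seeds (\<lambda>sd. expect w 2 (\<lambda>f. of_bool (\<not> finds sd f xss ys)))"
    unfolding expect_append by (intro expect_cong) simp
  also have "\<dots> \<le>
      expect w n_seeds (\<lambda>sd. expect w 2 (\<lambda>f. of_bool (no_survivor sd) + real (tree_size sd (xss ! i0)) / real cap +
    real (tree_size sd ys) / real cap + real (reject_count sd f xss ys) / (40 * real cap)))"
    by (intro expect_mono not_finds_le)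
  also have "\<dots> = expect w n_seeds (\<lambda>sd. of_bool (no_survivor sd)) +
    expect w n_seeds (\<lambda>sd. real (tree_size sd (xss ! i0))) / real cap +
    expect w n_seeds (\<lambda>sd. real (tree_size sd ys)) / real cap +
    expect w n_seeds (\<lambda>sd. expect w 2 (\<lambda>f. real (reject_count sd f xss ys))) / (40 * real cap)"
    by simp
  also have "\<dots> \<le> 1 / 16 + 1 / 10 + 1 / 10 + 3 * real cap / (40 * real cap)"
    using sets[OF planted(1)] query cap_pos
    by (intro add_mono divide_right_mono expect_no_survivor_planted expect_tree_size_planted
      expect_reject_count_planted) auto
  also have "\<dots> \<le> 1 / 2" using cap_pos by simp
  finally show ?thesis by (simp add: of_bool_not_iff)
qed

end

subsection \<open>Pass probabilities\<close>

context layout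
begin

lemma mult_pass_prob_tau_le:
  assumes "m \<le> d"
  shows "real m * pass_prob z (tau m) \<le> real Z / real B1 + real d / real Z"
proof (cases "m = 0")
  case False
  have "real (Z * Z div (B1 * m)) \<le> real (Z * Z) / real (B1 * m)" by (rule of_nat_div_le_of_nat)
  then have "real (tau m) \<le> real Z * real Z / (real B1 * real m) + 1" by (simp add: tau_def)
  moreover have "pass_prob z (tau m) \<le> real (tau m) / 2 ^ z" by (simp add: pass_prob_def divide_right_mono)
  ultimately have "pass_prob z (tau m) \<le> (real Z * real Z / (real B1 * real m) + 1) / real Z"
    by (simp add: Z_def divide_right_mono order_trans)
  then have "real m * pass_prob z (tau m) \<le> real m * ((real Z * real Z / (real B1 * real m) + 1) / real Z)"
    by (intro mult_left_mono) auto
  also have "\<dots> = real Z / real B1 + real m / real Z" using False B1 Z_ge by (simp add: field_simps)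
  also have "\<dots> \<le> real Z / real B1 + real d / real Z" using assms by (intro add_left_mono divide_right_mono) auto
  finally show ?thesis .
qed simp

lemma coll_pass_prob_tau_le:
  assumes xs: "distinct xs" "length xs \<le> d" and ys: "distinct ys" "length ys \<le> d" and reject: "\<not> accept ys xs"
  shows "coll ys xs * pass_prob z (min (tau (length ys)) (tau (length xs))) \<le>
    real B2 / real Z * (real Z / real B1 + real d / real Z)"
proof -
  define m where "m = max (length xs) (length ys)"
  have m: "m \<le> d" using assms by (simp add: m_def)
  have "B2 * length xs \<le> B2 * m" "B2 * length ys \<le> B2 * m" by (auto simp: m_def)
  then have "card (set xs \<inter> set ys) * Z \<le> B2 * m" using reject unfolding accept_def by linarith
  then have "real (card (set xs \<inter> set ys)) * real Z \<le> real B2 * real m" by (metis of_nat_le_iff of_nat_mult)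
  then have "coll ys xs \<le> real B2 / real Z * real m"
    using xs ys Z_ge by (simp add: coll_distinct Int_commute field_simps)
  moreover have "pass_prob z (min (tau (length ys)) (tau (length xs))) \<le> pass_prob z (tau m)"
    by (auto simp: pass_prob_def m_def max_def intro!: divide_right_mono)
  ultimately have "coll ys xs * pass_prob z (min (tau (length ys)) (tau (length xs))) \<le>
    real B2 / real Z * real m * pass_prob z (tau m)"
    using pass_prob_nonneg coll_nonneg by (intro mult_mono) auto
  also have "\<dots> = real B2 / real Z * (real m * pass_prob z (tau m))" by simp
  also have "\<dots> \<le> real B2 / real Z * (real Z / real B1 + real d / real Z)"
    using mult_pass_prob_tau_le[OF m] by (intro mult_left_mono) auto
  finally show ?thesis .
qed

lemma tau_ge:
  assumes "0 < m" "m \<le> m'"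
  shows "real Z * real Z / (real B1 * real m') \<le> real (tau m)"
proof -
  have "Z * Z < (Z * Z div (B1 * m) + 1) * (B1 * m)"
    using assms B1 dividend_less_div_times[of "B1 * m" "Z * Z"] by (simp add: algebra_simps)
  then have "real Z * real Z \<le> real (tau m) * (real B1 * real m)"
    unfolding tau_def by (metis less_imp_le of_nat_le_iff of_nat_mult)
  also have "\<dots> \<le> real (tau m) * (real B1 * real m')" using assms by (intro mult_left_mono) auto
  finally show ?thesis using assms B1 by (simp add: field_simps)
qed

lemma pass_prob_min_tau_ge:
  assumes "0 < l" "0 < m"
  shows "min 1 (real Z / (real B1 * real (max l m))) \<le> pass_prob z (min (tau l) (tau m))"
proof -
  define \<tau> where "\<tau> = min (tau l) (tau m)"
  have Z_pos: "0 < real Z" using Z_ge by simp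
  have "real Z * real Z / (real B1 * real (max l m)) \<le> real \<tau>"
    using tau_ge[of l "max l m"] tau_ge[of m "max l m"] assms by (auto simp: \<tau>_def min_def)
  then have "real Z / (real B1 * real (max l m)) \<le> real \<tau> / real Z" using Z_pos by (simp add: field_simps)
  moreover have "pass_prob z \<tau> = min 1 (real \<tau> / real Z)"
    using Z_pos by (simp add: pass_prob_def Z_def min_def field_simps)
  ultimately show ?thesis unfolding \<tau>_def[symmetric] by linarith
qed

lemma mult_pass_prob_min_tau_ge_1:
  fixes b c :: real
  assumes B1_le: "real B1 \<le> b * real Z" and pos: "0 < l" "0 < m" and c: "b * real (max l m) \<le> c" "1 \<le> c"
  shows "1 \<le> c * pass_prob z (min (tau l) (tau m))"
proof -
  define u where "u = real (max l m)"
  have "0 < u" "0 < real B1" "0 < real Z" using pos B1 Z_ge by (auto simp: u_def)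
  have "real B1 * u \<le> (b * real Z) * u" using B1_le by (intro mult_right_mono) (auto simp: u_def)
  also have "\<dots> = (b * u) * real Z" by simp
  also have "\<dots> \<le> c * real Z" using c by (intro mult_right_mono) (auto simp: u_def)
  finally have "1 \<le> c * (real Z / (real B1 * u))" using \<open>0 < u\<close> \<open>0 < real B1\<close> by (simp add: field_simps)
  then have "1 \<le> c * min 1 (real Z / (real B1 * u))" using c(2) by (auto simp: min_def)
  also have "\<dots> \<le> c * pass_prob z (min (tau l) (tau m))"
    using pass_prob_min_tau_ge[OF pos] c(2) unfolding u_def by (intro mult_left_mono) auto
  finally show ?thesis .
qed

lemma pass_prob_min_tau_mult_ge_1:
  assumes "0 < l" "l \<le> d" "0 < m" "m \<le> d"
  shows "1 \<le> pass_prob z (min (tau l) (tau m)) * real d"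
proof -
  define u where "u = real (max l m)"
  have u: "0 < u" "u \<le> real d" using assms by (auto simp: u_def)
  have "real B1 \<le> real Z" "0 < real B1" using B1 by auto
  then have "real B1 * u \<le> real Z * real d" using u by (intro mult_mono) auto
  then have "1 \<le> real Z / (real B1 * u) * real d" using u \<open>0 < real B1\<close> by (simp add: field_simps)
  then have "1 \<le> min 1 (real Z / (real B1 * u)) * real d" using assms by (auto simp: min_def)
  also have "\<dots> \<le> pass_prob z (min (tau l) (tau m)) * real d"
    using pass_prob_min_tau_ge[OF assms(1,3)] unfolding u_def by (intro mult_right_mono) auto
  finally show ?thesis .
qed

end

subsection \<open>Depth and branching factor\<close>

lemma fixed_point_div:
  assumes "0 \<le> b" "z \<le> w"
  shows "fixed_point w b div 2 ^ (w - z) = fixed_point z b"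
proof -
  have "b * 2 ^ w / 2 ^ (w - z) = b * 2 ^ z" using assms(2) by (simp add: power_diff)
  then have "\<lfloor>b * 2 ^ w\<rfloor> div 2 ^ (w - z) = \<lfloor>b * 2 ^ z\<rfloor>"
    using floor_divide_real_eq_div[of "2 ^ (w - z)" "b * 2 ^ w"] by simp
  moreover have "nat (\<lfloor>b * 2 ^ w\<rfloor> div 2 ^ (w - z)) = nat \<lfloor>b * 2 ^ w\<rfloor> div 2 ^ (w - z)"
    using assms(1) by (subst nat_div_distrib) (auto simp: nat_power_eq)
  ultimately show ?thesis by (simp add: fixed_point_def)
qed

lemma fixed_point_bounds:
  assumes "0 \<le> b"
  shows "real (fixed_point z b) \<le> b * 2 ^ z" "b * 2 ^ z < real (fixed_point z b) + 1"
  using assms by (auto simp: fixed_point_def)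

lemma scaled_pow_le:
  assumes "0 < B"
  shows "real (scaled_pow Z B j) \<le> real Z * (real Z / real B) ^ j"
proof (induction j)
  case (Suc j)
  have "real (scaled_pow Z B j * Z div B) \<le> real (scaled_pow Z B j * Z) / real B" by (rule of_nat_div_le_of_nat)
  also have "\<dots> \<le> (real Z * (real Z / real B) ^ j) * real Z / real B"
    using Suc assms by (auto intro!: divide_right_mono mult_right_mono)
  finally show ?case by (simp add: mult_ac)
qed simp

lemma scaled_pow_ge:
  assumes "0 < B" "B \<le> Z"
  shows "(real Z - real j) * (real Z / real B) ^ j \<le> real (scaled_pow Z B j)"
proof (induction j)
  case (Suc j)
  have power_ge_1: "1 \<le> (real Z / real B) ^ Suc j" using assms by (intro one_le_power) simp
  define m where "m = scaled_pow Z B j * Z"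
  have "m < (m div B + 1) * B" using dividend_less_div_times[of B m] assms by (simp add: algebra_simps)
  then have "real m \<le> (real (m div B) + 1) * real B"
    by (metis less_imp_le of_nat_1 of_nat_add of_nat_le_iff of_nat_mult)
  then have "real m / real B - 1 \<le> real (m div B)" using assms by (simp add: field_simps)
  moreover have "(real Z - real j) * (real Z / real B) ^ Suc j \<le> real m / real B"
  proof -
    have "(real Z - real j) * (real Z / real B) ^ j * (real Z / real B) \<le>
        real (scaled_pow Z B j) * (real Z / real B)"
      using Suc by (intro mult_right_mono) auto
    then show ?thesis by (simp add: m_def mult_ac)
  qed
  ultimately have "(real Z - real j) * (real Z / real B) ^ Suc j - (real Z / real B) ^ Suc j \<le> real (m div B)"
    using power_ge_1 by linarith
  then have "(real Z - real (Suc j)) * (real Z / real B) ^ Suc j \<le> real (m div B)"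
    by (simp only: of_nat_Suc left_diff_distrib distrib_right mult_1_left)
  then show ?case by (simp only: m_def scaled_pow.simps)
qed simp

lemma half_power_le_scaled_pow:
  assumes "0 < B" "B \<le> Z" "2 * j \<le> Z"
  shows "real Z / 2 * (real Z / real B) ^ j \<le> real (scaled_pow Z B j)"
proof -
  have "real (2 * j) \<le> real Z" using assms(3) by (simp only: of_nat_le_iff)
  then have "real Z / 2 \<le> real Z - real j" by simp
  then have "real Z / 2 * (real Z / real B) ^ j \<le> (real Z - real j) * (real Z / real B) ^ j"
    by (intro mult_right_mono) auto
  then show ?thesis using scaled_pow_ge[OF assms(1,2), of j] by linarith
qed

lemma scaled_pow_reaches:
  fixes \<gamma> :: real
  assumes B: "0 < B" "real B \<le> \<gamma> * real Z" and \<gamma>: "0 < \<gamma>" "\<gamma> < 1" and n: "0 < n"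
    and J: "log (1 / \<gamma>) (2 * real n) \<le> real J" "2 * J \<le> Z"
  shows "n * Z \<le> scaled_pow Z B J"
proof -
  have Z_pos: "0 < real Z" using B by (cases Z) auto
  have "real B \<le> 1 * real Z" using B \<gamma> Z_pos by (meson less_imp_le mult_right_mono of_nat_0_le_iff order_trans)
  then have B_le: "B \<le> Z" by simp
  have base: "1 < 1 / \<gamma>" using \<gamma> by simp
  have "2 * real n \<le> (1 / \<gamma>) powr real J" using base n J(1) by (simp add: log_le_iff)
  also have "\<dots> = (1 / \<gamma>) ^ J" using base by (intro powr_realpow) linarith
  also have "\<dots> \<le> (real Z / real B) ^ J" using B \<gamma> Z_pos by (intro power_mono) (auto simp: field_simps)
  finally have "real Z / 2 * (2 * real n) \<le> real Z / 2 * (real Z / real B) ^ J" by (intro mult_left_mono) auto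
  also have "\<dots> \<le> real (scaled_pow Z B J)" by (rule half_power_le_scaled_pow[OF B(1) B_le J(2)])
  finally have "real (n * Z) \<le> real (scaled_pow Z B J)" by (simp add: mult_ac)
  then show ?thesis by (simp only: of_nat_le_iff)
qed

lemma power_one_plus_le_3:
  fixes x :: real
  assumes "0 \<le> x" "real k * x \<le> 1"
  shows "(1 + x) ^ k \<le> 3"
proof -
  have "(1 + x) ^ k \<le> exp x ^ k" using assms exp_ge_add_one_self[of x] by (intro power_mono) auto
  also have "\<dots> = exp (real k * x)" by (simp add: exp_of_nat_mult)
  also have "\<dots> \<le> exp 1" using assms by simp
  also have "\<dots> \<le> 3" by (rule exp_le)
  finally show ?thesis .
qed

text \<open>\<open>B1\<close> is \<open>b1 * Z\<close> rounded down and \<open>B2\<close> is \<open>b2 * Z\<close> rounded up; \<open>k\<close> is the depth. The scale \<open>Z\<close> is so large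
  that the \<open>k\<close>-th powers of the rounded quotients are within constant factors of the exact ones.\<close>

locale depth_params =
  fixes b1 b2 \<rho> :: real and n d Z B1 B2 k :: nat
  assumes b: "0 < b2" "b2 < b1" "b1 < 1" and \<rho>: "\<rho> = ln (1 / b1) / ln (1 / b2)"
    and n: "2 \<le> n" and k: "1 \<le> k" and Z_pos: "0 < Z"
    and B1: "real B1 \<le> b1 * real Z" "b1 * real Z < real B1 + 1" "2 \<le> b1 * real Z"
    and B2: "b2 * real Z < real B2" "real B2 \<le> b2 * real Z + 1" "B2 \<le> Z"
    and scale: "2 * real k \<le> real Z" "real k \<le> b2 * real Z" "real k * (2 / b1 + real d) \<le> real Z"
    and depth: "scaled_pow Z B2 (k - 1) < n * Z" "n * Z \<le> scaled_pow Z B2 k"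
begin

definition "branching = real Z / real B1 + real d / real Z"

lemma B_pos: "0 < B1" "0 < B2" "B1 \<le> Z"
proof -
  show "0 < B1" using B1(2) B1(3) by (cases B1) auto
  show "0 < B2" using B2(1) b Z_pos by (cases B2) (auto simp: mult_less_0_iff)
  have "b1 * real Z \<le> 1 * real Z" using b by (intro mult_right_mono) auto
  then show "B1 \<le> Z" using B1(1) by simp
qed

lemma branching_ge: "1 / b1 \<le> branching" "1 \<le> branching"
proof -
  have "1 / b1 \<le> real Z / real B1" using B1(1) B_pos b Z_pos by (simp add: field_simps)
  then show "1 / b1 \<le> branching" by (simp add: branching_def add_increasing2)
  moreover have "1 \<le> 1 / b1" using b by simp
  ultimately show "1 \<le> branching" by linarith
qed

lemma reject_decay: "real n * (real B2 / real Z) ^ k \<le> 1"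
proof -
  have "real n * real Z \<le> real (scaled_pow Z B2 k)" using depth(2) by (metis of_nat_le_iff of_nat_mult)
  also have "\<dots> \<le> real Z * (real Z / real B2) ^ k" by (rule scaled_pow_le[OF B_pos(2)])
  finally have "real n \<le> (real Z / real B2) ^ k" using Z_pos by simp
  then have "real n * (real B2 / real Z) ^ k \<le> (real Z / real B2) ^ k * (real B2 / real Z) ^ k"
    by (intro mult_right_mono) auto
  also have "\<dots> = 1" using B_pos Z_pos by (simp flip: power_mult_distrib)
  finally show ?thesis .
qed

lemma inverse_b2_power_le: "(1 / b2) ^ (k - 1) \<le> 6 * real n"
proof -
  have "real Z / 2 * (real Z / real B2) ^ (k - 1) \<le> real (scaled_pow Z B2 (k - 1))"
    using B_pos B2(3) scale(1) by (intro half_power_le_scaled_pow) auto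
  also have "\<dots> \<le> real n * real Z" using depth(1) by (metis less_imp_le of_nat_le_iff of_nat_mult)
  finally have "real Z * (real Z / real B2) ^ (k - 1) \<le> real Z * (2 * real n)" by (simp add: mult_ac)
  then have quotient: "(real Z / real B2) ^ (k - 1) \<le> 2 * real n" using Z_pos by simp
  have "real B2 / (b2 * real Z) \<le> 1 + 1 / (b2 * real Z)" using B2(2) b Z_pos by (simp add: field_simps)
  moreover have "(1 + 1 / (b2 * real Z)) ^ (k - 1) \<le> 3"
    using b Z_pos scale(2) k by (intro power_one_plus_le_3) (auto simp: field_simps of_nat_diff)
  ultimately have error: "(real B2 / (b2 * real Z)) ^ (k - 1) \<le> 3"
    using b by (meson divide_nonneg_nonneg less_imp_le mult_nonneg_nonneg of_nat_0_le_iff order_trans power_mono)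
  have "1 / b2 = (real Z / real B2) * (real B2 / (b2 * real Z))" using B_pos Z_pos by simp
  then have "(1 / b2) ^ (k - 1) = (real Z / real B2) ^ (k - 1) * (real B2 / (b2 * real Z)) ^ (k - 1)"
    by (simp only: power_mult_distrib)
  also have "\<dots> \<le> (2 * real n) * 3" using quotient error b by (intro mult_mono) auto
  finally show ?thesis by simp
qed

lemma \<rho>_bounds: "0 < \<rho>" "\<rho> < 1"
proof -
  have "0 < ln (1 / b1)" "ln (1 / b1) < ln (1 / b2)" using b by (auto simp: ln_div)
  then show "0 < \<rho>" "\<rho> < 1" by (auto simp: \<rho>)
qed

lemma inverse_b1_power_le: "(1 / b1) ^ k \<le> 6 / b1 * real n powr \<rho>"
proof -
  have "(1 / b1) = (1 / b2) powr \<rho>"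
    using b by (simp add: \<rho> powr_def)
  then have "(1 / b1) ^ (k - 1) = ((1 / b2) powr \<rho>) powr real (k - 1)" using b by (simp add: powr_realpow)
  also have "\<dots> = ((1 / b2) ^ (k - 1)) powr \<rho>" using b by (simp add: powr_powr mult.commute flip: powr_realpow)
  also have "\<dots> \<le> (6 * real n) powr \<rho>" using inverse_b2_power_le \<rho>_bounds b by (intro powr_mono2) auto
  also have "\<dots> = 6 powr \<rho> * real n powr \<rho>" by (simp add: powr_mult)
  also have "\<dots> \<le> 6 powr 1 * real n powr \<rho>" using \<rho>_bounds by (intro mult_right_mono powr_mono) auto
  finally have "(1 / b1) ^ (k - 1) \<le> 6 * real n powr \<rho>" by simp
  then have "(1 / b1) * (1 / b1) ^ (k - 1) \<le> (1 / b1) * (6 * real n powr \<rho>)"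
    using b by (intro mult_left_mono) auto
  moreover have "(1 / b1) ^ k = (1 / b1) * (1 / b1) ^ (k - 1)"
    using k by (metis Suc_diff_1 less_le_trans power_Suc zero_less_one)
  ultimately show ?thesis by simp
qed

lemma branching_le: "branching \<le> (1 / b1) * (1 + (2 / b1 + real d) / real Z)"
proof -
  have "real Z / real B1 \<le> (1 / b1) * (1 + 2 / (b1 * real Z))"
  proof -
    have "(b1 * real Z) * (b1 * real Z) \<le> (b1 * real Z + 2) * (b1 * real Z - 1)"
      using B1(3) by (simp add: algebra_simps)
    also have "\<dots> \<le> (b1 * real Z + 2) * real B1" using B1(2) B1(3) by (intro mult_left_mono) auto
    finally have "(b1 * real Z) * (b1 * real Z) \<le> (b1 * real Z + 2) * real B1" .
    then show ?thesis using b Z_pos B_pos by (simp add: field_simps)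
  qed
  moreover have "real d / real Z \<le> (1 / b1) * (real d / real Z)"
    using b mult_right_mono[of 1 "1 / b1" "real d / real Z"] by simp
  ultimately have "branching \<le> (1 / b1) * (1 + 2 / (b1 * real Z)) + (1 / b1) * (real d / real Z)"
    by (simp add: branching_def)
  also have "\<dots> = (1 / b1) * (1 + (2 / b1 + real d) / real Z)" using b Z_pos by (simp add: field_simps)
  finally show ?thesis .
qed

lemma branching_power_le: "branching ^ k \<le> 18 / b1 * real n powr \<rho>"
proof -
  have "branching ^ k \<le> ((1 / b1) * (1 + (2 / b1 + real d) / real Z)) ^ k"
    using branching_le branching_ge by (intro power_mono) auto
  also have "\<dots> = (1 / b1) ^ k * (1 + (2 / b1 + real d) / real Z) ^ k" by (simp only: power_mult_distrib)
  also have "\<dots> \<le> (6 / b1 * real n powr \<rho>) * 3"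
    using inverse_b1_power_le b scale(3) Z_pos by (intro mult_mono power_one_plus_le_3) (auto simp: field_simps)
  finally show ?thesis by simp
qed

lemma sum_branching_power_le: "(\<Sum>j\<le>i. branching ^ j) \<le> branching ^ i / (1 - b1)"
proof (induction i)
  case 0
  show ?case using b by (simp add: field_simps)
next
  case (Suc i)
  have "1 \<le> b1 * branching" using branching_ge(1) b by (simp add: field_simps)
  then have "branching ^ i * 1 \<le> branching ^ i * (b1 * branching)"
    using branching_ge by (intro mult_left_mono) auto
  then have "branching ^ i \<le> b1 * branching ^ Suc i" by (simp add: mult_ac)
  then have "branching ^ i / (1 - b1) \<le> b1 * branching ^ Suc i / (1 - b1)"
    using b by (intro divide_right_mono) auto
  then have "(\<Sum>j\<le>Suc i. branching ^ j) \<le> b1 * branching ^ Suc i / (1 - b1) + branching ^ Suc i" using Suc by simp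
  also have "\<dots> = branching ^ Suc i / (1 - b1)" using b by (simp add: field_simps)
  finally show ?case .
qed

lemma scaled_pow_B1_le: "real (scaled_pow Z B1 j) \<le> real Z * branching ^ j"
proof -
  have "real Z * (real Z / real B1) ^ j \<le> real Z * branching ^ j"
    by (intro mult_left_mono power_mono) (auto simp: branching_def)
  then show ?thesis using scaled_pow_le[OF B_pos(1), of Z j] by linarith
qed

lemma branching_power_le_scaled_pow: "branching ^ k \<le> 6 * real (scaled_pow Z B1 k div Z + 1)"
proof -
  have "branching = (real Z / real B1) * (1 + real B1 / real Z * (real d / real Z))"
    using B_pos Z_pos by (simp add: branching_def field_simps)
  also have "\<dots> \<le> (real Z / real B1) * (1 + real d / real Z)"
    using B_pos Z_pos mult_right_mono[of "real B1 / real Z" 1 "real d / real Z"] by (intro mult_left_mono) auto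
  finally have "branching ^ k \<le> ((real Z / real B1) * (1 + real d / real Z)) ^ k"
    using branching_ge by (intro power_mono) auto
  also have "\<dots> = (real Z / real B1) ^ k * (1 + real d / real Z) ^ k" by (simp only: power_mult_distrib)
  also have "\<dots> \<le> (real Z / real B1) ^ k * 3"
  proof (intro mult_left_mono power_one_plus_le_3)
    have "real k * real d \<le> real k * (2 / b1 + real d)" using b by (intro mult_left_mono) auto
    then have "real k * real d \<le> real Z" using scale(3) by linarith
    then show "real k * (real d / real Z) \<le> 1" using Z_pos by (simp add: field_simps)
  qed auto
  finally have branching_pow: "branching ^ k \<le> 3 * (real Z / real B1) ^ k" by simp
  have "real Z / 2 * (real Z / real B1) ^ k \<le> real (scaled_pow Z B1 k)"
    using B_pos scale by (intro half_power_le_scaled_pow) auto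
  also have "\<dots> \<le> real ((scaled_pow Z B1 k div Z + 1) * Z)"
    using dividend_less_div_times[of Z "scaled_pow Z B1 k"] Z_pos
      by (simp only: of_nat_le_iff) (simp add: algebra_simps)
  finally have "real Z * (real Z / real B1) ^ k \<le> real Z * (2 * real (scaled_pow Z B1 k div Z + 1))"
    by (simp add: algebra_simps)
  then have "(real Z / real B1) ^ k \<le> 2 * real (scaled_pow Z B1 k div Z + 1)" using Z_pos by simp
  then show ?thesis using branching_pow by linarith
qed

end

subsection \<open>Solving an instance\<close>

lemma prob_random_words: "measure_pmf.prob (random_words w R) A = expect w R (\<lambda>ws. of_bool (ws \<in> A))"
proof -
  have "measure_pmf.prob (random_words w R) A = expect w R (indicator A)" by simp
  also have "\<dots> = expect w R (\<lambda>ws. of_bool (ws \<in> A))"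
    by (intro expect_cong) (simp add: indicator_def)
  finally show ?thesis .
qed

lemma solves_similarity_searchI:
  assumes build: "run w (encode_instance w d s1 s2 ps) T ([build], init (\<lambda>_. 0)) =
      map_pmf (\<lambda>ws. ([], F ws)) (random_words w R)"
    and cells: "\<And>ws a. length ws = R \<Longrightarrow> cells \<le> a \<Longrightarrow> mem (F ws) a = 0"
    and query: "\<And>q ws. q \<subseteq> {1..d} \<Longrightarrow> length ws = R \<Longrightarrow>
      \<exists>s. run w (encode_set q) (qtime (card q)) ([query], init (mem (F ws))) = return_pmf ([], s) \<and>
        (good q ws \<longrightarrow> (\<exists>x\<in>set ps. s2 < braun_blanquet x q \<and> returns s x))"
    and success: "\<And>q. q \<subseteq> {1..d} \<Longrightarrow> \<exists>x\<in>set ps. s1 \<le> braun_blanquet x q \<Longrightarrow>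
      1 / 2 \<le> expect w R (\<lambda>ws. of_bool (good q ws))"
  shows "solves_similarity_search w d s1 s2 ps build query cells qtime"
proof -
  define D where "D = map_pmf (\<lambda>ws. mem (F ws)) (random_words w R)"
  have halts_build: "halts_within w (encode_instance w d s1 s2 ps) build (\<lambda>_. 0) T"
    by (auto simp: halts_within_def build)
  have D: "D = map_pmf mem (result w (encode_instance w d s1 s2 ps) build (\<lambda>_. 0) T)"
    by (simp add: D_def result_def build map_pmf_comp)
  have bounded: "\<forall>m\<in>set_pmf D. \<forall>a\<ge>cells. m a = 0" using cells by (auto simp: D_def set_random_words)
  have halts_query: "\<forall>m\<in>set_pmf D. halts_within w (encode_set q) query m (qtime (card q))" if "q \<subseteq> {1..d}" for q
    using query[OF that] by (fastforce simp: D_def set_random_words halts_within_def)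
  have "1 / 2 \<le> measure_pmf.prob (bind_pmf D (\<lambda>m. result w (encode_set q) query m (qtime (card q))))
      {s. \<exists>x\<in>set ps. s2 < braun_blanquet x q \<and> returns s x}"
    if q: "q \<subseteq> {1..d}" and similar: "\<exists>x\<in>set ps. s1 \<le> braun_blanquet x q" for q
  proof -
    define A where "A = {s. \<exists>x\<in>set ps. s2 < braun_blanquet x q \<and> returns s x}"
    have "\<forall>ws. \<exists>s. length ws = R \<longrightarrow> run w (encode_set q) (qtime (card q)) ([query], init (mem (F ws)))
      = return_pmf ([], s) \<and>
      (good q ws \<longrightarrow> s \<in> A)"
      using query[OF q] unfolding A_def mem_Collect_eq by blast
    from choice[OF this] obtain S where "\<forall>ws. length ws = R \<longrightarrow>
      run w (encode_set q) (qtime (card q)) ([query], init (mem (F ws))) = return_pmf ([], S ws) \<and>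
      (good q ws \<longrightarrow> S ws \<in> A)" ..
    then have S: "run w (encode_set q) (qtime (card q)) ([query], init (mem (F ws))) = return_pmf ([], S ws)"
      "good q ws \<Longrightarrow> S ws \<in> A" if "length ws = R" for ws
      using that by blast+
    have "bind_pmf D (\<lambda>m. result w (encode_set q) query m (qtime (card q))) =
      bind_pmf (random_words w R) (\<lambda>ws. return_pmf (S ws))"
      unfolding D_def bind_map_pmf by (intro bind_pmf_cong refl) (auto simp: set_random_words result_def S(1))
    also have "\<dots> = map_pmf S (random_words w R)" by (simp add: map_pmf_def)
    finally have "measure_pmf.prob (bind_pmf D (\<lambda>m. result w (encode_set q) query m (qtime (card q)))) A =
      expect w R (\<lambda>ws. of_bool (S ws \<in> A))"
      by (simp only: measure_map_pmf prob_random_words vimage_eq)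
    also have "\<dots> \<ge> expect w R (\<lambda>ws. of_bool (good q ws))"
      using S(2) by (intro expect_mono) auto
    finally show ?thesis using success[OF q similar] unfolding A_def by linarith
  qed
  then show ?thesis unfolding solves_similarity_search_def
    using halts_build D bounded halts_query by (intro exI[of _ T] exI[of _ D]) simp
qed

lemma length_encode_set: "length (encode_set x) = Suc (card x)"
  by (simp add: encode_set_def)

lemma set_pos_sorted_lists:
  "i \<le> length ps \<Longrightarrow> set_pos (map sorted_list_of_set ps) i = 4 + length (concat (map encode_set (take i ps)))"
  by (induction i) (auto simp: take_Suc_conv_app_nth length_encode_set)

lemma encode_instance_nth:
  assumes "i < length ps" "j < length (encode_set (ps ! i))"
  shows "encode_instance w d s1 s2 ps ! (set_pos (map sorted_list_of_set ps) i + j) = encode_set (ps ! i) ! j"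
proof -
  define before where
    "before = [length ps, d, fixed_point w s1, fixed_point w s2] @ concat (map encode_set (take i ps))"
  have "concat (map encode_set ps) =
    concat (map encode_set (take i ps)) @ encode_set (ps ! i) @ concat (map encode_set (drop (Suc i) ps))"
    by (subst id_take_nth_drop[OF assms(1)]) simp
  then have "encode_instance w d s1 s2 ps =
      before @ encode_set (ps ! i) @ concat (map encode_set (drop (Suc i) ps))"
    by (simp add: encode_instance_def before_def)
  moreover have "set_pos (map sorted_list_of_set ps) i = length before"
    using set_pos_sorted_lists[of i ps] assms(1) by (simp add: before_def)
  ultimately show ?thesis using assms(2) by (simp only: nth_append_length_plus nth_append_left)
qed

lemma length_encode_instance:
  "length (encode_instance w d s1 s2 ps) = set_pos (map sorted_list_of_set ps) (length ps)"
  using set_pos_sorted_lists[OF le_refl] by (simp add: encode_instance_def)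

lemma (in layout) candidates_entries_less:
  assumes "i \<in> set (candidates (entries sd f xss m) f Q)"
  shows "i < m"
proof -
  obtain b where "i \<in># mset (chain (entries sd f xss m) b (length (entries sd f xss m)))"
    using assms by (auto simp: candidates_def split: if_splits)
  then show ?thesis unfolding mset_chain[OF le_refl] by (auto dest: snd_entries_less)
qed

locale similarity_instance = tuned_layout w z Z B1 B2 k L cap n N cap_factor +
  rates: depth_params b1 b2 \<rho> n d Z B1 B2 k
  for w z Z B1 B2 k L cap n N cap_factor :: nat and b1 b2 \<rho> :: real and d :: nat +
  fixes ps :: "nat set list" and size_ratio :: nat
  assumes ps: "length ps = n" "\<forall>x\<in>set ps. x \<subseteq> {1..d}" "d < Z"
    and N_eq: "N = length (encode_instance w d b1 b2 ps)"
    and B1_eq: "B1 = fixed_point z b1" and B2_eq: "B2 = fixed_point z b2 + 1"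
    and gap: "real B2 < b1 * real Z"
    and variance: "real d * (real k)\<^sup>2 \<le> real Z"
    and cap_tree: "10 * (real L * (\<Sum>j\<le>k. rates.branching ^ j)) \<le> real cap"
    and cap_reject: "real L * (real n * ((real B2 / real Z * rates.branching) ^ k +
      real k * (2 * rates.branching * rates.branching) ^ k * (real d * real d / 2 ^ z))) \<le> real cap"
    and size_ratio: "Z \<le> size_ratio * B2"
begin

abbreviation "input \<equiv> encode_instance w d b1 b2 ps"
abbreviation "xss \<equiv> map sorted_list_of_set ps"

lemma set_of_instance:
  assumes "i < n"
  shows "ps ! i \<in> set ps" "finite (ps ! i)" "card (ps ! i) \<le> d" "ps ! i \<subseteq> {..<Z}"
proof -
  show "ps ! i \<in> set ps" using assms ps(1) by simp
  then have x_subset: "ps ! i \<subseteq> {1..d}" using ps(2) by blast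
  then show "finite (ps ! i)" "card (ps ! i) \<le> d" using finite_subset card_mono[OF _ x_subset] by auto
  show "ps ! i \<subseteq> {..<Z}" using x_subset ps(3) by force
qed

lemma header_in_input: "header_in input"
  unfolding header_in_def using N_eq B1_eq B2_eq ps(1) rates.b z_le
  by (auto simp: encode_instance_def fixed_point_div)

lemma sets_in_input: "sets_in input xss"
proof -
  have end_pos: "set_pos xss n = N" unfolding N_eq length_encode_instance ps(1) ..
  have "input ! set_pos xss i = length (xss ! i) \<and> reads input (set_pos xss i + 1) (xss ! i)" if i: "i < n" for i
  proof -
    have code: "encode_set (ps ! i) = length (xss ! i) # xss ! i" using i ps(1) by (simp add: encode_set_def)
    have nth: "input ! (set_pos xss i + j) = encode_set (ps ! i) ! j" if "j < length (encode_set (ps ! i))" for j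
      using encode_instance_nth[OF _ that] i ps(1) by simp
    have "set_pos xss i + Suc (length (xss ! i)) \<le> N" using set_pos_mono[of "Suc i" n xss] i end_pos by simp
    moreover have "N \<le> Z" using memory_bounds by linarith
    moreover have "set (xss ! i) \<subseteq> {..<Z}" using set_of_instance[OF i] i ps(1) by simp
    moreover have "input ! set_pos xss i = length (xss ! i)" using nth[of 0] code by simp
    moreover have "input ! (set_pos xss i + 1 + j) = xss ! i ! j" if "j < length (xss ! i)" for j
      using nth[of "Suc j"] code that by simp
    ultimately show ?thesis unfolding reads_def N_eq[symmetric] by simp
  qed
  then show ?thesis unfolding sets_in_def using end_pos ps(1) N_eq by simp
qed

lemma returns_stored_set:
  assumes stored: "structure_in m sd f input xss n" and i: "i < n"
    and state_s: "\<And>a. heads_at \<le> a \<Longrightarrow> mem s a = m a" "regs s 0 = set_at xss i"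
  shows "returns s (ps ! i)"
proof -
  have "length (encode_set (ps ! i)) = Suc (length (xss ! i))" using i ps(1) by (simp add: length_encode_set)
  then have "m (set_at xss i + j) = encode_set (ps ! i) ! j" if "j < length (encode_set (ps ! i))" for j
    using structure_in_copied[OF stored sets_in_input i, of j] encode_instance_nth[of i ps j w d b1 b2] i
      ps(1) that by simp
  moreover have "heads_at \<le> set_at xss i" using memory_bounds by linarith
  ultimately show ?thesis using state_s by (simp add: returns_def)
qed

lemma similar_if_accept:
  assumes "finite x" "finite q" "accept (sorted_list_of_set q) (sorted_list_of_set x)"
  shows "b2 < braun_blanquet x q"
proof -
  define common size where "common = card (x \<inter> q)" and "size = max (card x) (card q)"
  have "B2 * size < common * Z" using assms unfolding accept_def common_def size_def max_def by simp
  then have less: "real B2 * real size < real common * real Z" by (metis of_nat_less_iff of_nat_mult)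
  then have "0 < common" by (cases "common = 0") (auto simp: mult_less_0_iff)
  then have "x \<noteq> {}" by (auto simp: common_def)
  then have "0 < size" using assms(1) by (auto simp: size_def card_gt_0_iff less_max_iff_disj)
  have "b2 * real Z * real size \<le> real B2 * real size" using rates.B2(1) by (intro mult_right_mono) auto
  then have "(b2 * real size) * real Z < real common * real Z" using less by (simp add: mult_ac)
  then have "b2 * real size < real common" using rates.Z_pos by simp
  then show ?thesis using \<open>0 < size\<close> by (simp add: braun_blanquet_def common_def size_def field_simps)
qed

lemma similar_common:
  assumes "finite x" "finite q" "b1 \<le> braun_blanquet x q"
  shows "0 < card (x \<inter> q)" "0 < card x" "0 < card q"
    and "b1 * real (max (card x) (card q)) \<le> real (card (x \<inter> q))"
proof -
  have quotient: "b1 \<le> real (card (x \<inter> q)) / real (max (card x) (card q))"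
    using assms(3) by (simp add: braun_blanquet_def)
  then show "0 < card (x \<inter> q)" using rates.b by (cases "card (x \<inter> q) = 0") auto
  then have "x \<inter> q \<noteq> {}" by auto
  then show "0 < card x" "0 < card q" using assms(1,2) by (auto simp: card_gt_0_iff)
  then show "b1 * real (max (card x) (card q)) \<le> real (card (x \<inter> q))"
    using quotient by (simp add: pos_le_divide_eq less_max_iff_disj)
qed

lemma accept_if_similar:
  assumes "finite x" "finite q" "b1 \<le> braun_blanquet x q"
  shows "accept (sorted_list_of_set q) (sorted_list_of_set x)"
proof -
  define size where "size = max (card x) (card q)"
  have "0 < real size" using similar_common[OF assms] by (auto simp: size_def)
  then have "real B2 * real size < b1 * real Z * real size" using gap by (intro mult_strict_right_mono) auto
  also have "\<dots> = (b1 * real size) * real Z" by simp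
  also have "\<dots> \<le> real (card (x \<inter> q)) * real Z"
    using similar_common(4)[OF assms] unfolding size_def by (intro mult_right_mono) auto
  finally have "B2 * size < card (x \<inter> q) * Z" by (metis of_nat_less_iff of_nat_mult)
  moreover have "B2 * card x \<le> B2 * size" "B2 * card q \<le> B2 * size" by (auto simp: size_def)
  ultimately have "B2 * card x < card (x \<inter> q) * Z" "B2 * card q < card (x \<inter> q) * Z" by linarith+
  then show ?thesis using assms by (simp add: accept_def)
qed

lemma query_correct:
  assumes stored: "structure_in m sd f input xss n" and q: "q \<subseteq> {1..d}"
    and time: "cap * (40 * (20 * (size_ratio + 1) * card q + 61) + 20 * card q + 140) + 200 \<le> T"
  shows "\<exists>s. run w (encode_set q) T ([query_prog], init m) = return_pmf ([], s) \<and>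
    (finds sd f xss (sorted_list_of_set q) \<longrightarrow> (\<exists>x\<in>set ps. b2 < braun_blanquet x q \<and> returns s x))"
proof -
  define ys where "ys = sorted_list_of_set q"
  define C where "C = candidates (entries sd f xss n) f (queue sd ys)"
  have "finite q" using q finite_subset by blast
  have "card q \<le> d" using card_mono[OF _ q] by simp
  then have ys: "reads (encode_set q) 1 ys" "encode_set q ! 0 = length ys" "sorted_wrt (<) ys"
    "length ys = card q"
    using q ps(3) \<open>finite q\<close> by (auto simp: reads_def encode_set_def ys_def)
  have "\<forall>i<n. sorted_wrt (<) (xss ! i)" using ps(1) by simp
  then have "wp w (encode_set q) query_prog (\<lambda>t s. t \<le> T \<and> (\<forall>a. heads_at \<le> a \<longrightarrow> mem s a = m a) \<and>
    search_outcome (set_at xss) xss ys C s) (init m)"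
    by (intro wp_conseq[OF wp_query[OF stored sets_in_input _ ys(1-3) size_ratio C_def]]) (use time ys(4) in auto)
  from wp_run[OF this] obtain s where
    run: "run w (encode_set q) T ([query_prog], init m) = return_pmf ([], s)" and
    state_s: "\<And>a. heads_at \<le> a \<Longrightarrow> mem s a = m a" and
    outcome: "search_outcome (set_at xss) xss ys C s"
    by blast
  have "\<exists>x\<in>set ps. b2 < braun_blanquet x q \<and> returns s x" if found: "finds sd f xss ys"
  proof -
    obtain i where i: "i \<in> set C" "accept ys (xss ! i)" "regs s 0 = set_at xss i"
      using outcome found unfolding finds_def search_outcome_def C_def[symmetric] by blast
    have "i < n" using i(1) candidates_entries_less unfolding C_def by blast
    then show ?thesis
      using set_of_instance i similar_if_accept[of "ps ! i" q] \<open>finite q\<close>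
        returns_stored_set[OF stored _ state_s] ps(1)
      by (auto simp: ys_def)
  qed
  then show ?thesis using run unfolding ys_def by blast
qed

lemma planted_query:
  assumes q: "q \<subseteq> {1..d}" and i: "i < n" "b1 \<le> braun_blanquet (ps ! i) q"
  shows "planted_query w z Z B1 B2 k L cap n N xss (sorted_list_of_set q) i d rates.branching
    (real B2 / real Z * rates.branching) (real d / real Z)"
proof -
  define ys where "ys = sorted_list_of_set q"
  have "finite q" using q finite_subset by blast
  have "card q \<le> d" using card_mono[OF _ q] by simp
  have ys: "distinct ys" "set ys \<subseteq> {..<Z}" "length ys \<le> d" "length ys = card q"
    using \<open>card q \<le> d\<close> q \<open>finite q\<close> ps(3) by (auto simp: ys_def)
  have lists: "distinct (xss ! j) \<and> set (xss ! j) \<subseteq> {..<Z} \<and> length (xss ! j) \<le> d" if "j < n" for j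
    using set_of_instance[OF that] that ps(1) by simp
  have common: "set (xss ! i) \<inter> set ys = ps ! i \<inter> q" "length (xss ! i) = card (ps ! i)" "card (ps ! i) \<le> d"
    using set_of_instance[OF i(1)] i(1) ps(1) \<open>finite q\<close> by (auto simp: ys_def)
  note similar = similar_common[OF set_of_instance(2)[OF i(1)] \<open>finite q\<close> i(2)]
  have ratio: "real B2 / real Z \<le> 1" using rates.B2(3) rates.Z_pos by simp
  show ?thesis unfolding ys_def[symmetric]
  proof unfold_locales
    show "accept ys (xss ! i)"
      using accept_if_similar[OF set_of_instance(2)[OF i(1)] \<open>finite q\<close> i(2)] i(1) ps(1) by (simp add: ys_def)
    show "real m * pass_prob z (tau m) \<le> rates.branching" if "m \<le> d" for m
      unfolding rates.branching_def using that by (rule mult_pass_prob_tau_le)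
    show "coll ys (xss ! j) * pass_prob z (min (tau (length ys)) (tau (length (xss ! j)))) \<le>
        real B2 / real Z * rates.branching"
      if "j < n" "\<not> accept ys (xss ! j)" for j
      unfolding rates.branching_def using lists[OF that(1)] ys that(2) by (intro coll_pass_prob_tau_le) auto
    show "1 \<le> real (card (set (xss ! i) \<inter> set ys)) * pass_prob z (min (tau (length (xss ! i))) (tau (length ys)))"
      unfolding common ys(4) using rates.B1(1) similar by (intro mult_pass_prob_min_tau_ge_1) auto
    have "1 \<le> pass_prob z (min (tau (length (xss ! i))) (tau (length ys))) * real d"
      unfolding common ys(4) using similar common(3) \<open>card q \<le> d\<close> by (intro pass_prob_min_tau_mult_ge_1)
    then show "1 \<le> pass_prob z (min (tau (length (xss ! i))) (tau (length ys))) * 2 ^ z * (real d / real Z)"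
      by (simp add: Z_def)
    show "0 \<le> real B2 / real Z * rates.branching" "real B2 / real Z * rates.branching \<le> rates.branching"
      using rates.branching_ge(2) mult_right_mono[OF ratio, of rates.branching] by auto
    show "real d / real Z * (real k)\<^sup>2 \<le> 1" using variance rates.Z_pos by (simp add: field_simps)
  qed (use lists ys i(1) rates.branching_ge(2) cap_tree cap_reject L_eq in auto)
qed

lemma solves:
  assumes "sets_at + N \<le> cells"
    and "\<And>l. cap * (40 * (20 * (size_ratio + 1) * l + 61) + 20 * l + 140) + 200 \<le> qtime l"
  shows "solves_similarity_search w d b1 b2 ps (build_prog cap_factor) query_prog cells qtime"
proof -
  obtain T F where build: "run w input T ([build_prog cap_factor], init (\<lambda>_. 0)) =
      map_pmf (\<lambda>ws. ([], F ws)) (random_words w (n_seeds + 2))"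
    and stored: "\<And>ws. length ws = n_seeds + 2 \<Longrightarrow>
      structure_in (mem (F ws)) (take n_seeds ws) (drop n_seeds ws) input xss n"
    using build_distribution[OF header_in_input sets_in_input] by blast
  show ?thesis
  proof (rule solves_similarity_searchI[where
        good = "\<lambda>q ws. finds (take n_seeds ws) (drop n_seeds ws) xss (sorted_list_of_set q)", OF build])
    fix ws :: "nat list" and a
    assume "length ws = n_seeds + 2" "cells \<le> a"
    then show "mem (F ws) a = 0"
      using stored[of ws] assms(1) sets_in_input by (simp add: structure_in_def sets_in_def)
  next
    fix q and ws :: "nat list"
    assume "q \<subseteq> {1..d}" "length ws = n_seeds + 2"
    then show "\<exists>s. run w (encode_set q) (qtime (card q)) ([query_prog], init (mem (F ws))) = return_pmf ([], s) \<and>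
      (finds (take n_seeds ws) (drop n_seeds ws) xss (sorted_list_of_set q) \<longrightarrow>
        (\<exists>x\<in>set ps. b2 < braun_blanquet x q \<and> returns s x))"
      using stored assms(2) by (intro query_correct)
  next
    fix q
    assume q: "q \<subseteq> {1..d}" and "\<exists>x\<in>set ps. b1 \<le> braun_blanquet x q"
    then obtain i where "i < n" "b1 \<le> braun_blanquet (ps ! i) q" using ps(1) by (auto simp: in_set_conv_nth)
    from planted_query.success_probability[OF planted_query[OF q this]]
    show "1 / 2 \<le> expect w (n_seeds + 2)
      (\<lambda>ws. of_bool (finds (take n_seeds ws) (drop n_seeds ws) xss (sorted_list_of_set q)))" .
  qed
qed

end

subsection \<open>Instances with long words\<close>

locale similarity_constants =
  fixes b1 b2 \<rho> :: real and \<kappa> :: nat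
  assumes b: "0 < b2" "b2 < b1" "b1 < 1" and \<rho>: "\<rho> = ln (1 / b1) / ln (1 / b2)"
begin

definition "\<gamma> = (1 + b2) / 2"
definition "depth_factor = 1 + 2 / log 2 (1 / \<gamma>)"
definition "cap_factor = nat \<lceil>60 / (1 - b1)\<rceil>"
definition "size_ratio = nat \<lceil>1 / b2\<rceil>"
definition "queue_factor = real cap_factor * (16 * depth_factor) * (36 / b1)"
definition "space_factor = 41 + 64 * depth_factor\<^sup>2 + 5 * queue_factor"
definition "time_factor = queue_factor * (800 * (real size_ratio + 1) + 2600) + 200"

text \<open>With \<open>n\<close> sets, \<open>pair_exponent\<close> is such that the number of pairs of nodes at depth \<open>k\<close> is at most
  \<open>n ^ pair_exponent\<close> in expectation, and the scale \<open>Z\<close> has to be at least \<open>scale_factor * n ^ scale_exponent\<close>. The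
  summands of \<open>scale_factor\<close> are the coefficients of the individual lower bounds on \<open>Z\<close>.\<close>

definition "pair_exponent = nat \<lceil>depth_factor * log 2 (2 * (2 / b1)\<^sup>2)\<rceil>"
definition "scale_exponent = 3 + pair_exponent + 2 * \<kappa>"
definition "scale_factor =
    2 + 2 * depth_factor + depth_factor / b2 + depth_factor * (2 / b1 + 1) + depth_factor\<^sup>2 +
  40 * queue_factor + (space_factor + 1) + 2 / (1 - b2) + 2 / b1 + 2 / (b1 - b2)"

lemma \<gamma>_bounds: "0 < \<gamma>" "\<gamma> < 1"
  using b by (auto simp: \<gamma>_def)

lemma depth_factor_ge: "1 \<le> depth_factor"
  using \<gamma>_bounds by (simp add: depth_factor_def)

lemma cap_factor_ge: "60 / (1 - b1) \<le> real cap_factor" "60 \<le> real cap_factor"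
proof -
  show "60 / (1 - b1) \<le> real cap_factor" unfolding cap_factor_def by (rule real_nat_ceiling_ge)
  moreover have "60 \<le> 60 / (1 - b1)" using b by (simp add: field_simps)
  ultimately show "60 \<le> real cap_factor" by linarith
qed

lemma size_ratio_ge: "1 / b2 \<le> real size_ratio"
  unfolding size_ratio_def by (rule real_nat_ceiling_ge)

lemma queue_factor_nonneg: "0 \<le> queue_factor"
  using depth_factor_ge b by (simp add: queue_factor_def)

lemma space_factor_ge: "1 \<le> space_factor"
  using queue_factor_nonneg by (simp add: space_factor_def add_increasing)

lemma time_factor_nonneg: "0 \<le> time_factor"
  using queue_factor_nonneg by (simp add: time_factor_def)

lemma scale_summands_nonneg:
  "0 \<le> depth_factor / b2" "0 \<le> depth_factor * (2 / b1 + 1)" "0 \<le> depth_factor\<^sup>2"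
  "0 \<le> 2 / (1 - b2)" "0 \<le> 2 / b1" "0 \<le> 2 / (b1 - b2)"
  using depth_factor_ge b by auto

lemma scale_factor_ge:
  "2 \<le> scale_factor" "depth_factor \<le> scale_factor" "2 * depth_factor \<le> scale_factor"
  "depth_factor / b2 \<le> scale_factor" "depth_factor * (2 / b1 + 1) \<le> scale_factor" "depth_factor\<^sup>2 \<le> scale_factor"
  "40 * queue_factor \<le> scale_factor" "space_factor + 1 \<le> scale_factor"
  "2 / (1 - b2) \<le> scale_factor" "2 / b1 \<le> scale_factor" "2 / (b1 - b2) \<le> scale_factor"
  using scale_summands_nonneg queue_factor_nonneg depth_factor_ge space_factor_ge unfolding scale_factor_def
  by linarith+

end

locale long_word_instance = similarity_constants +
  fixes n d w :: nat and ps :: "nat set list"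
  assumes n: "2 \<le> n" and d: "d \<le> n ^ \<kappa>" and ps: "length ps = n" "distinct ps" "\<forall>x\<in>set ps. x \<subseteq> {1..d}"
    and large: "scale_factor * real n ^ scale_exponent \<le> 2 ^ ((w - 1) div 8)"
begin

definition "z = (w - 1) div 8"
definition "Z = (2 :: nat) ^ z"
definition "B1 = fixed_point z b1"
definition "B2 = fixed_point z b2 + 1"
definition "k = (LEAST j. n * Z \<le> scaled_pow Z B2 j)"
definition "L = 8 * Suc k"
definition "cap = cap_factor * L * (scaled_pow Z B1 k div Z + 1)"
definition "N = length (encode_instance w d b1 b2 ps)"
definition "cells = 36 + 2 * (L * Suc k) + 2 * cap + 3 * (n * cap) + N"

abbreviation "log_n \<equiv> log 2 (real n)"
abbreviation "queue_bound \<equiv> real n powr \<rho> * log_n"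
abbreviation "total_size \<equiv> \<Sum>x\<in>set ps. card x"

lemma z_le: "z \<le> w" "8 * z \<le> w"
  unfolding z_def by linarith+

lemma log_n_bounds: "1 \<le> log_n" "log_n \<le> real n"
proof -
  have "log 2 2 \<le> log_n" using n by (subst log_le_cancel_iff) auto
  then show "1 \<le> log_n" by simp
  have "real n < 2 ^ n" using less_exp[of n] by (metis of_nat_less_iff of_nat_numeral of_nat_power)
  then have "real n \<le> 2 powr real n" by (simp add: powr_realpow)
  then show "log_n \<le> real n" using n by (simp add: log_le_iff)
qed

lemma polynomial_le_Z:
  assumes "0 \<le> c" "c \<le> scale_factor" "p \<le> scale_exponent"
  shows "c * real n ^ p \<le> real Z"
proof -
  have "c * real n ^ p \<le> scale_factor * real n ^ scale_exponent"
    using assms n by (intro mult_mono power_increasing) auto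
  then show ?thesis using large by (simp add: Z_def z_def)
qed

lemma constant_le_Z: "0 \<le> c \<Longrightarrow> c \<le> scale_factor \<Longrightarrow> c \<le> real Z"
  using polynomial_le_Z[of c 0] by simp

lemma Z_pos: "0 < Z"
  by (simp add: Z_def)

lemma real_d_le: "real d \<le> real n ^ \<kappa>"
  using d by (metis of_nat_le_iff of_nat_power)

lemma d_less: "d < Z"
proof -
  have "2 * real n ^ \<kappa> \<le> real Z" using scale_factor_ge by (intro polynomial_le_Z) (auto simp: scale_exponent_def)
  moreover have "0 < real n ^ \<kappa>" using n by simp
  ultimately have "real d < real Z" using real_d_le by linarith
  then show ?thesis by simp
qed

lemma B1_bounds: "real B1 \<le> b1 * real Z" "b1 * real Z < real B1 + 1" "2 \<le> b1 * real Z"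
proof -
  show "real B1 \<le> b1 * real Z" "b1 * real Z < real B1 + 1"
    using fixed_point_bounds[of b1 z] b by (auto simp: B1_def Z_def)
  have "2 / b1 \<le> real Z" using scale_factor_ge b by (intro constant_le_Z) auto
  then show "2 \<le> b1 * real Z" using b by (simp add: field_simps)
qed

lemma B2_bounds:
  "0 < B2" "b2 * real Z < real B2" "real B2 \<le> b2 * real Z + 1" "real B2 \<le> \<gamma> * real Z" "B2 \<le> Z"
    "real B2 < b1 * real Z"
proof -
  show "0 < B2" by (simp add: B2_def)
  show "b2 * real Z < real B2" and upper: "real B2 \<le> b2 * real Z + 1"
    using fixed_point_bounds[of b2 z] b by (auto simp: B2_def Z_def)
  have "2 / (1 - b2) \<le> real Z" "2 / (b1 - b2) \<le> real Z" using scale_factor_ge b by (auto intro!: constant_le_Z)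
  then have "2 \<le> (1 - b2) * real Z" "2 \<le> (b1 - b2) * real Z" using b by (auto simp: field_simps)
  then show gamma: "real B2 \<le> \<gamma> * real Z" and "real B2 < b1 * real Z"
    using upper by (auto simp: \<gamma>_def algebra_simps)
  have "\<gamma> * real Z \<le> 1 * real Z" using \<gamma>_bounds by (intro mult_right_mono) auto
  then show "B2 \<le> Z" using gamma by simp
qed

lemma depth_bound_reached:
  obtains J where "real J \<le> depth_factor * log_n" "n * Z \<le> scaled_pow Z B2 J"
proof -
  define J where "J = nat \<lceil>log (1 / \<gamma>) (2 * real n)\<rceil>"
  have base: "0 < log 2 (1 / \<gamma>)" using \<gamma>_bounds by simp
  have log_eq: "log (1 / \<gamma>) (2 * real n) = (1 + log_n) / log 2 (1 / \<gamma>)"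
    using n \<gamma>_bounds by (simp add: log_base_change[of 2 "1 / \<gamma>"] log_mult add_divide_distrib)
  have "0 \<le> (1 + log_n) / log 2 (1 / \<gamma>)" using log_n_bounds base by simp
  then have "real J \<le> 1 + (1 + log_n) / log 2 (1 / \<gamma>)" unfolding J_def log_eq by linarith
  also have "\<dots> \<le> 1 * log_n + (2 * log_n) / log 2 (1 / \<gamma>)"
    using log_n_bounds base by (intro add_mono divide_right_mono) auto
  also have "\<dots> = depth_factor * log_n" by (simp add: depth_factor_def algebra_simps)
  finally have J_le: "real J \<le> depth_factor * log_n" .
  also have "\<dots> \<le> depth_factor * real n" using log_n_bounds depth_factor_ge by (intro mult_left_mono) auto
  finally have "2 * real J \<le> 2 * depth_factor * real n ^ 1" by simp
  also have "\<dots> \<le> real Z"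
    using scale_factor_ge depth_factor_ge by (intro polynomial_le_Z) (auto simp: scale_exponent_def)
  finally have "2 * J \<le> Z" by linarith
  moreover have "log (1 / \<gamma>) (2 * real n) \<le> real J" unfolding J_def by linarith
  ultimately have "n * Z \<le> scaled_pow Z B2 J"
    using B2_bounds \<gamma>_bounds n by (intro scaled_pow_reaches) auto
  with J_le show thesis by (rule that)
qed

lemma depth:
  "\<And>j. j < k \<Longrightarrow> scaled_pow Z B2 j < n * Z" "n * Z \<le> scaled_pow Z B2 k" "1 \<le> k"
  "real k \<le> depth_factor * log_n" "real k \<le> depth_factor * real n"
proof -
  obtain J where J: "real J \<le> depth_factor * log_n" "n * Z \<le> scaled_pow Z B2 J" by (rule depth_bound_reached)
  show "scaled_pow Z B2 j < n * Z" if "j < k" for j using that not_less_Least unfolding k_def by force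
  show k: "n * Z \<le> scaled_pow Z B2 k" unfolding k_def using J(2) by (rule LeastI)
  then show "1 \<le> k" using n Z_pos by (cases "k = 0") auto
  have "k \<le> J" unfolding k_def using J(2) by (rule Least_le)
  then show k_le: "real k \<le> depth_factor * log_n" using J(1) by linarith
  have "depth_factor * log_n \<le> depth_factor * real n"
    using log_n_bounds depth_factor_ge by (intro mult_left_mono) auto
  then show "real k \<le> depth_factor * real n" using k_le by linarith
qed

lemma k_mult_le: "real k * (2 / b1 + real d) \<le> real Z"
proof -
  have power_ge: "1 \<le> real n ^ \<kappa>" using n by (intro one_le_power) auto
  then have "2 / b1 * 1 + real d \<le> 2 / b1 * real n ^ \<kappa> + 1 * real n ^ \<kappa>"
    using real_d_le b by (intro add_mono mult_left_mono) auto
  then have "2 / b1 + real d \<le> (2 / b1 + 1) * real n ^ \<kappa>" by (simp add: distrib_right)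
  then have "real k * (2 / b1 + real d) \<le> (depth_factor * real n) * ((2 / b1 + 1) * real n ^ \<kappa>)"
    using depth(5) b depth_factor_ge by (intro mult_mono) auto
  also have "\<dots> = depth_factor * (2 / b1 + 1) * real n ^ Suc \<kappa>" by simp
  also have "\<dots> \<le> real Z"
    using scale_factor_ge depth_factor_ge b by (intro polynomial_le_Z) (auto simp: scale_exponent_def)
  finally show ?thesis .
qed

sublocale rates: depth_params b1 b2 \<rho> n d Z B1 B2 k
proof
  have "2 * real k \<le> 2 * depth_factor * real n ^ 1" using depth(5) by simp
  also have "\<dots> \<le> real Z"
    using scale_factor_ge depth_factor_ge by (intro polynomial_le_Z) (auto simp: scale_exponent_def)
  finally show "2 * real k \<le> real Z" .
  have "depth_factor / b2 * real n ^ 1 \<le> real Z"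
    using scale_factor_ge depth_factor_ge b by (intro polynomial_le_Z) (auto simp: scale_exponent_def)
  then have "depth_factor * real n \<le> b2 * real Z" using b by (simp add: field_simps)
  then show "real k \<le> b2 * real Z" using depth(5) by linarith
  show "scaled_pow Z B2 (k - 1) < n * Z" using depth(3) by (intro depth(1)) simp
qed (use b \<rho> n depth Z_pos B1_bounds B2_bounds k_mult_le in auto)

lemma branching_le: "rates.branching \<le> 2 / b1"
proof -
  have "1 * (2 / b1 + real d) \<le> real k * (2 / b1 + real d)" using depth(3) b by (intro mult_right_mono) auto
  then have "(2 / b1 + real d) / real Z \<le> 1" using k_mult_le Z_pos by simp
  then have "(1 / b1) * (1 + (2 / b1 + real d) / real Z) \<le> (1 / b1) * (1 + 1)"
    using b by (intro mult_left_mono add_left_mono) auto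
  then show ?thesis using rates.branching_le by simp
qed

lemma pairs_le: "(2 * rates.branching * rates.branching) ^ k \<le> real n ^ pair_exponent"
proof -
  define c where "c = 2 * (2 / b1)\<^sup>2"
  have "2 \<le> 2 / b1" using b by (simp add: field_simps)
  from power_mono[OF this, of 2] have c: "1 \<le> c" by (simp add: c_def)
  have "rates.branching * rates.branching \<le> (2 / b1) * (2 / b1)"
    using rates.branching_ge branching_le b by (intro mult_mono) auto
  then have "2 * rates.branching * rates.branching \<le> c" by (simp add: c_def power2_eq_square)
  then have "(2 * rates.branching * rates.branching) ^ k \<le> c ^ k"
    using rates.branching_ge by (intro power_mono) auto
  also have "\<dots> = c powr real k" using c by (simp add: powr_realpow)
  also have "\<dots> \<le> c powr (depth_factor * log_n)" using c depth(4) by (intro powr_mono) auto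
  also have "\<dots> = real n powr (depth_factor * log 2 c)"
  proof -
    have "c = 2 powr (log 2 c)" "real n = 2 powr log_n" using c n by auto
    then show ?thesis by (metis mult.commute mult.assoc powr_powr)
  qed
  also have "\<dots> \<le> real n powr real pair_exponent"
    using n real_nat_ceiling_ge by (intro powr_mono) (auto simp: pair_exponent_def c_def)
  also have "\<dots> = real n ^ pair_exponent" using n by (simp add: powr_realpow)
  finally show ?thesis .
qed

lemma growth_le:
  assumes "j \<le> k"
  shows "scaled_pow Z B1 j \<le> Z * Z"
proof -
  have "rates.branching ^ j \<le> rates.branching ^ k" using rates.branching_ge assms by (intro power_increasing) auto
  also have "\<dots> \<le> (2 * rates.branching * rates.branching) ^ k" using rates.branching_ge by (intro power_mono) auto
  also have "\<dots> \<le> 1 * real n ^ pair_exponent" using pairs_le by simp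
  also have "\<dots> \<le> real Z" using scale_factor_ge by (intro polynomial_le_Z) (auto simp: scale_exponent_def)
  finally have "real Z * rates.branching ^ j \<le> real Z * real Z" by (intro mult_left_mono) auto
  then have "real (scaled_pow Z B1 j) \<le> real Z * real Z" using rates.scaled_pow_B1_le[of j] by linarith
  then show ?thesis by (metis of_nat_le_iff of_nat_mult)
qed

lemma n_powr_bounds: "1 \<le> real n powr \<rho>" "real n powr \<rho> \<le> real n"
  using n rates.\<rho>_bounds powr_mono[of \<rho> 1 "real n"] by (auto simp: ge_one_powr_ge_zero)

lemma queue_bound_bounds: "1 \<le> queue_bound" "log_n \<le> queue_bound" "queue_bound \<le> real n * real n"
proof -
  show "log_n \<le> queue_bound" using n_powr_bounds log_n_bounds by simp
  then show "1 \<le> queue_bound" using log_n_bounds by linarith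
  show "queue_bound \<le> real n * real n" using n_powr_bounds log_n_bounds by (intro mult_mono) auto
qed

lemma L_le: "real L \<le> 16 * depth_factor * log_n"
  using depth(3,4) by (simp add: L_def)

lemma repetitions_le_cap: "real cap_factor * (real L * rates.branching ^ k) \<le> 6 * real cap"
proof -
  have "real cap_factor * (real L * rates.branching ^ k) \<le>
    real cap_factor * (real L * (6 * real (scaled_pow Z B1 k div Z + 1)))"
    using rates.branching_power_le_scaled_pow by (intro mult_left_mono) auto
  then show ?thesis unfolding cap_def of_nat_mult by (simp only: mult_ac)
qed

lemma cap_le: "real cap \<le> queue_factor * queue_bound"
proof -
  have "real (scaled_pow Z B1 k div Z) \<le> real (scaled_pow Z B1 k) / real Z" by (rule of_nat_div_le_of_nat)
  also have "\<dots> \<le> rates.branching ^ k" using rates.scaled_pow_B1_le[of k] Z_pos by (simp add: field_simps)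
  finally have "real (scaled_pow Z B1 k div Z + 1) \<le> rates.branching ^ k + 1" by simp
  also have "\<dots> \<le> 2 * rates.branching ^ k" using rates.branching_ge by (simp add: one_le_power)
  also have "\<dots> \<le> 36 / b1 * real n powr \<rho>" using rates.branching_power_le by simp
  finally have "real cap \<le> real cap_factor * (16 * depth_factor * log_n) * (36 / b1 * real n powr \<rho>)"
    unfolding cap_def of_nat_mult using L_le depth_factor_ge log_n_bounds b by (intro mult_mono) auto
  also have "\<dots> = queue_factor * queue_bound" by (simp add: queue_factor_def)
  finally show ?thesis .
qed

lemma cap_le_square: "real cap \<le> queue_factor * (real n * real n)"
  using cap_le mult_left_mono[OF queue_bound_bounds(3) queue_factor_nonneg] by linarith

lemma N_eq: "N = 4 + n + total_size"
proof -
  have "length (concat (map encode_set ps)) = n + (\<Sum>x\<leftarrow>ps. card x)"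
    unfolding ps(1)[symmetric] by (induction ps) (auto simp: length_encode_set)
  then show ?thesis using ps by (simp add: N_def encode_instance_def sum_list_distinct_conv_sum_set)
qed

lemma total_size_le: "real total_size \<le> real n ^ Suc \<kappa>"
proof -
  have "card x \<le> d" if "x \<in> set ps" for x using ps(3) that card_mono[of "{1..d}" x] by simp
  then have "total_size \<le> n * d" using sum_bounded_above[of "set ps" card d] ps by (simp add: distinct_card)
  also have "\<dots> \<le> n * n ^ \<kappa>" using d by simp
  finally show ?thesis by (metis of_nat_le_iff of_nat_power power_Suc)
qed

lemma seeds_le: "real (L * Suc k) \<le> 32 * depth_factor\<^sup>2 * log_n\<^sup>2"
proof -
  have "real (Suc k) \<le> 2 * (depth_factor * log_n)" using depth(3,4) by simp
  then have "real (Suc k) * real (Suc k) \<le> (2 * (depth_factor * log_n)) * (2 * (depth_factor * log_n))"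
    by (intro mult_mono) auto
  also have "\<dots> = 4 * depth_factor\<^sup>2 * log_n\<^sup>2" by (simp add: power2_eq_square)
  finally have "8 * (real (Suc k) * real (Suc k)) \<le> 32 * depth_factor\<^sup>2 * log_n\<^sup>2" by linarith
  moreover have "real (L * Suc k) = 8 * (real (Suc k) * real (Suc k))"
    by (simp only: L_def of_nat_mult of_nat_numeral mult.assoc)
  ultimately show ?thesis by linarith
qed

lemma cells_le: "real cells \<le> space_factor * (real n * queue_bound) + real total_size"
proof -
  define u where "u = real n * queue_bound"
  have u: "real n \<le> u" "queue_bound \<le> u"
    using queue_bound_bounds(1) n mult_left_mono[of 1 queue_bound "real n"]
      mult_right_mono[of 1 "real n" queue_bound]
    by (auto simp: u_def)
  have u_ge: "1 \<le> u" using u n by linarith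
  have "log_n\<^sup>2 \<le> u" unfolding power2_eq_square u_def
    using log_n_bounds queue_bound_bounds(2) by (intro mult_mono) auto
  then have "32 * depth_factor\<^sup>2 * log_n\<^sup>2 \<le> 32 * depth_factor\<^sup>2 * u" by (intro mult_left_mono) auto
  then have seeds: "real (L * Suc k) \<le> 32 * depth_factor\<^sup>2 * u" using seeds_le by linarith
  have queue: "real cap \<le> queue_factor * u" using cap_le mult_left_mono[OF u(2) queue_factor_nonneg] by linarith
  have "real n * real cap \<le> real n * (queue_factor * queue_bound)" using cap_le by (intro mult_left_mono) auto
  then have table: "real n * real cap \<le> queue_factor * u" by (simp add: u_def mult_ac)
  have "real cells =
      36 + 2 * real (L * Suc k) + 2 * real cap + 3 * (real n * real cap) + (4 + real n + real total_size)"
    unfolding cells_def N_eq by (simp only: of_nat_add of_nat_mult of_nat_numeral)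
  also have "\<dots> \<le> 36 * u + 2 * (32 * depth_factor\<^sup>2 * u) + 2 * (queue_factor * u) + 3 * (queue_factor * u) +
    (4 * u + u + real total_size)"
    using seeds queue table u u_ge by linarith
  also have "\<dots> = space_factor * u + real total_size" by (simp add: space_factor_def algebra_simps)
  finally show ?thesis unfolding u_def .
qed

lemma cells_le_Z: "cells \<le> Z"
proof -
  define t where "t = real n ^ (3 + \<kappa>)"
  have power_le: "real n ^ p \<le> t" if "p \<le> 3 + \<kappa>" for p
    unfolding t_def using that n by (intro power_increasing) auto
  have "real n * queue_bound \<le> real n * (real n * real n)"
    using queue_bound_bounds(3) by (intro mult_left_mono) auto
  also have "\<dots> = real n ^ 3" by (simp add: power3_eq_cube)
  also have "\<dots> \<le> t" by (rule power_le) simp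
  finally have "space_factor * (real n * queue_bound) \<le> space_factor * t"
    using space_factor_ge by (intro mult_left_mono) auto
  moreover have "real total_size \<le> t" using total_size_le power_le[of "Suc \<kappa>"] by linarith
  ultimately have "real cells \<le> (space_factor + 1) * t" using cells_le by (simp add: algebra_simps)
  also have "\<dots> \<le> real Z" unfolding t_def
    using scale_factor_ge space_factor_ge by (intro polynomial_le_Z) (auto simp: scale_exponent_def)
  finally show ?thesis by simp
qed

lemma cap_le_Z: "40 * cap \<le> Z"
proof -
  have "40 * real cap \<le> 40 * queue_factor * real n ^ 2" using cap_le_square by (simp add: power2_eq_square)
  also have "\<dots> \<le> real Z"
    using scale_factor_ge queue_factor_nonneg by (intro polynomial_le_Z) (auto simp: scale_exponent_def)
  finally show ?thesis by linarith
qed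

lemma cap_tree: "10 * (real L * (\<Sum>j\<le>k. rates.branching ^ j)) \<le> real cap"
proof -
  have "real L * (\<Sum>j\<le>k. rates.branching ^ j) \<le> real L * (rates.branching ^ k / (1 - b1))"
    using rates.sum_branching_power_le by (intro mult_left_mono) auto
  moreover have "10 * (real L * (rates.branching ^ k / (1 - b1))) =
      (60 / (1 - b1)) * (real L * rates.branching ^ k) / 6"
    using b by (simp add: field_simps)
  moreover have "\<dots> \<le> real cap_factor * (real L * rates.branching ^ k) / 6"
    using cap_factor_ge(1) rates.branching_ge by (intro divide_right_mono mult_right_mono) auto
  ultimately show ?thesis using repetitions_le_cap by linarith
qed

lemma pair_error_le_1:
  "real n * (real k * (2 * rates.branching * rates.branching) ^ k * (real d * real d / 2 ^ z)) \<le> 1"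
proof -
  have "real n * (real k * (2 * rates.branching * rates.branching) ^ k * (real d * real d)) \<le>
    real n * ((depth_factor * real n) * real n ^ pair_exponent * (real n ^ \<kappa> * real n ^ \<kappa>))"
    using depth(5) pairs_le real_d_le rates.branching_ge depth_factor_ge by (intro mult_mono) auto
  also have "\<dots> = depth_factor * real n ^ (2 + pair_exponent + 2 * \<kappa>)"
    by (simp add: power_add power_mult power2_eq_square mult_ac power_mult_distrib)
  also have "\<dots> \<le> real Z"
    using scale_factor_ge depth_factor_ge by (intro polynomial_le_Z) (auto simp: scale_exponent_def)
  finally show ?thesis by (simp add: Z_def field_simps)
qed

lemma cap_reject: "real L * (real n * ((real B2 / real Z * rates.branching) ^ k +
  real k * (2 * rates.branching * rates.branching) ^ k * (real d * real d / 2 ^ z))) \<le> real cap"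
proof -
  have "real n * (real B2 / real Z * rates.branching) ^ k =
      (real n * (real B2 / real Z) ^ k) * rates.branching ^ k"
    by (simp only: power_mult_distrib mult.assoc)
  also have "\<dots> \<le> 1 * rates.branching ^ k"
    using rates.reject_decay rates.branching_ge by (intro mult_right_mono) auto
  finally have "real n * ((real B2 / real Z * rates.branching) ^ k +
      real k * (2 * rates.branching * rates.branching) ^ k * (real d * real d / 2 ^ z)) \<le> rates.branching ^ k + 1"
    using pair_error_le_1 unfolding distrib_left by linarith
  also have "\<dots> \<le> 2 * rates.branching ^ k" using rates.branching_ge by (simp add: one_le_power)
  finally have "real L * (real n * ((real B2 / real Z * rates.branching) ^ k +
      real k * (2 * rates.branching * rates.branching) ^ k * (real d * real d / 2 ^ z))) \<le>
    real L * (2 * rates.branching ^ k)"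
    by (intro mult_left_mono) auto
  also have "\<dots> = 12 * (real L * rates.branching ^ k) / 6" by simp
  also have "\<dots> \<le> real cap_factor * (real L * rates.branching ^ k) / 6"
    using cap_factor_ge(2) rates.branching_ge by (intro divide_right_mono mult_right_mono) auto
  finally show ?thesis using repetitions_le_cap by linarith
qed

lemma variance_le: "real d * (real k)\<^sup>2 \<le> real Z"
proof -
  have "real d * (real k)\<^sup>2 \<le> real n ^ \<kappa> * (depth_factor * real n)\<^sup>2"
    using real_d_le depth(5) by (intro mult_mono power_mono) auto
  also have "\<dots> = depth_factor\<^sup>2 * real n ^ (2 + \<kappa>)"
    by (simp add: power_add power_mult_distrib power2_eq_square mult_ac)
  also have "\<dots> \<le> real Z" using scale_factor_ge by (intro polynomial_le_Z) (auto simp: scale_exponent_def)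
  finally show ?thesis .
qed

lemma Z_le_size_ratio: "Z \<le> size_ratio * B2"
proof -
  have "real Z = (1 / b2) * (b2 * real Z)" using b by simp
  also have "\<dots> \<le> real size_ratio * real B2"
    using size_ratio_ge B2_bounds(2) b by (intro mult_mono) auto
  finally show ?thesis by (metis of_nat_le_iff of_nat_mult)
qed

sublocale inst: similarity_instance w z Z B1 B2 k L cap n N cap_factor b1 b2 \<rho> d ps size_ratio
proof unfold_locales
  show "0 < cap_factor" using cap_factor_ge(2) by (cases cap_factor) auto
  then have "1 * L * 1 \<le> cap" unfolding cap_def by (intro mult_mono) auto
  then show "L \<le> cap" by simp
  show "36 + 2 * (L * Suc k) + 2 * cap + 3 * (n * cap) + N \<le> Z" using cells_le_Z unfolding cells_def .
  show "0 < L" "0 < n" using n by (simp_all add: L_def)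
  show "L = 8 * Suc k" by (rule L_def)
qed (fact z_le rates.B_pos B2_bounds ps d_less cap_le_Z depth growth_le cap_tree cap_reject variance_le
  Z_le_size_ratio
    Z_def z_def cap_def N_def B1_def B2_def)+

lemma query_time_le:
  "cap * (40 * (20 * (size_ratio + 1) * l + 61) + 20 * l + 140) + 200 \<le>
    nat \<lfloor>(space_factor + time_factor) * real (max 1 l) * real n powr \<rho> * log_n\<rfloor>"
proof -
  define m where "m = real (max 1 l)"
  have m: "1 \<le> m" "real l \<le> m" by (auto simp: m_def)
  have "real (40 * (20 * (size_ratio + 1) * l + 61) + 20 * l + 140) =
      800 * (real size_ratio + 1) * real l + 20 * real l + 2580"
    by simp
  also have "\<dots> \<le> 800 * (real size_ratio + 1) * m + 20 * m + 2580 * m"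
    using m by (intro add_mono mult_left_mono) auto
  also have "\<dots> = (800 * (real size_ratio + 1) + 2600) * m" by (simp add: algebra_simps)
  finally have "real cap * real (40 * (20 * (size_ratio + 1) * l + 61) + 20 * l + 140) \<le>
    (queue_factor * queue_bound) * ((800 * (real size_ratio + 1) + 2600) * m)"
    using cap_le queue_factor_nonneg queue_bound_bounds(1) by (intro mult_mono) auto
  moreover have "200 * 1 \<le> 200 * (queue_bound * m)"
    using m queue_bound_bounds(1) mult_mono[of 1 queue_bound 1 m] by simp
  ultimately have "real cap * real (40 * (20 * (size_ratio + 1) * l + 61) + 20 * l + 140) + 200 \<le>
    time_factor * (queue_bound * m)"
    by (simp add: time_factor_def algebra_simps)
  also have "\<dots> \<le> (space_factor + time_factor) * (queue_bound * m)"
    using space_factor_ge queue_bound_bounds(1) m by (intro mult_right_mono) auto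
  also have "\<dots> = (space_factor + time_factor) * real (max 1 l) * real n powr \<rho> * log_n"
    by (simp add: m_def mult_ac)
  finally show ?thesis by (intro le_nat_floor) (simp only: of_nat_add of_nat_mult of_nat_numeral)
qed

lemma cells_le_floor:
  "cells \<le> nat \<lfloor>(space_factor + time_factor) * (real n powr (1 + \<rho>) * log_n + real total_size)\<rfloor>"
proof -
  have "real cells \<le> space_factor * (real n * queue_bound) + 1 * real total_size" using cells_le by simp
  also have "\<dots> \<le>
      (space_factor + time_factor) * (real n * queue_bound) + (space_factor + time_factor) * real total_size"
    using space_factor_ge time_factor_nonneg queue_bound_bounds(1)
      by (intro add_mono mult_right_mono) (auto simp: sum_nonneg)
  also have "\<dots> = (space_factor + time_factor) * (real n powr (1 + \<rho>) * log_n + real total_size)"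
    using n by (simp add: powr_add algebra_simps)
  finally show ?thesis by (rule le_nat_floor)
qed

lemma solves:
  "solves_similarity_search w d b1 b2 ps (build_prog cap_factor) query_prog
    (nat \<lfloor>(space_factor + time_factor) * (real n powr (1 + \<rho>) * log_n + real total_size)\<rfloor>)
    (\<lambda>l. nat \<lfloor>(space_factor + time_factor) * real (max 1 l) * real n powr \<rho> * log_n\<rfloor>)"
proof (rule inst.solves)
  have "inst.sets_at + N = cells"
    by (simp add: inst.sets_at_def inst.entries_at_def inst.heads_at_def inst.queue_at_def inst.n_seeds_def
        inst.buckets_def cells_def)
  then show "inst.sets_at + N \<le>
      nat \<lfloor>(space_factor + time_factor) * (real n powr (1 + \<rho>) * log_n + real total_size)\<rfloor>"
    using cells_le_floor by simp
qed (rule query_time_le)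

end

context similarity_constants
begin

definition "word_factor = 8 * (real (scale_exponent + nat \<lceil>scale_factor\<rceil>) + 1)"

lemma scale_le_if_long_words:
  assumes n: "2 \<le> n" and w: "word_factor * log 2 (real n) \<le> real w"
  shows "scale_factor * real n ^ scale_exponent \<le> 2 ^ ((w - 1) div 8)"
proof -
  define z e where "z = (w - 1) div 8" and "e = scale_exponent + nat \<lceil>scale_factor\<rceil>"
  have "w \<le> 8 * z + 8" unfolding z_def by presburger
  then have "8 * ((real e + 1) * log 2 (real n)) \<le> 8 * (real z + 1)"
    using w by (simp add: word_factor_def e_def algebra_simps)
  then have "log 2 (real n ^ (e + 1)) \<le> real (z + 1)"
    using n by (subst log_nat_power) (auto simp: algebra_simps)
  then have "real n ^ (e + 1) \<le> 2 powr real (z + 1)" using n by (subst (asm) log_le_iff) auto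
  also have "\<dots> = 2 ^ z * 2" by (subst powr_realpow) auto
  finally have "real n ^ e * real n \<le> 2 ^ z * 2" by (simp add: mult.commute)
  moreover have "real n ^ e * 2 \<le> real n ^ e * real n" using n by (intro mult_left_mono) auto
  ultimately have power_le: "real n ^ e \<le> 2 ^ z" by linarith
  have "scale_factor \<le> real (nat \<lceil>scale_factor\<rceil>)" by (rule real_nat_ceiling_ge)
  also have "\<dots> \<le> 2 ^ nat \<lceil>scale_factor\<rceil>"
    using less_exp[of "nat \<lceil>scale_factor\<rceil>"] by (metis less_imp_le of_nat_le_iff of_nat_numeral of_nat_power)
  also have "\<dots> \<le> real n ^ nat \<lceil>scale_factor\<rceil>" using n by (intro power_mono) auto
  finally have "scale_factor * real n ^ scale_exponent \<le> real n ^ nat \<lceil>scale_factor\<rceil> * real n ^ scale_exponent"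
    by (intro mult_right_mono) auto
  also have "\<dots> = real n ^ e" by (simp add: e_def power_add)
  finally show ?thesis using power_le by (simp add: z_def)
qed

end

theorem theorem4p1:
  fixes b1 b2 \<rho> :: real and \<kappa> :: nat
  assumes "0 < b2" and "b2 < b1" and "b1 < 1"
    and "\<rho> = ln (1 / b1) / ln (1 / b2)"
  shows "\<exists>c0 > 0. \<forall>c1 \<ge> c0. \<exists>build query. \<exists>C > 0.
    \<forall>(n :: nat) (d :: nat) (w :: nat) (ps :: nat set list).
      n \<ge> 2 \<and> c0 * log 2 (real n) \<le> real w \<and> real w \<le> c1 * log 2 (real n) \<and> d \<le> n ^ \<kappa> \<and>
      length ps = n \<and> distinct ps \<and> (\<forall>x \<in> set ps. x \<subseteq> {1..d}) \<longrightarrow>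
      solves_similarity_search w d b1 b2 ps build query
        (nat \<lfloor>C * (real n powr (1 + \<rho>) * log 2 (real n) + real (\<Sum>x \<in> set ps. card x))\<rfloor>)
        (\<lambda>k. nat \<lfloor>C * real (max 1 k) * real n powr \<rho> * log 2 (real n)\<rfloor>)"
proof -
  interpret similarity_constants b1 b2 \<rho> \<kappa>
    using assms by unfold_locales
  have "0 < word_factor" by (simp add: word_factor_def)
  moreover have "0 < space_factor + time_factor" using space_factor_ge time_factor_nonneg by linarith
  moreover have "solves_similarity_search w d b1 b2 ps (build_prog cap_factor) query_prog
      (nat \<lfloor>(space_factor + time_factor) * (real n powr (1 + \<rho>) * log 2 (real n) + real (\<Sum>x \<in> set ps. card x))\<rfloor>)
      (\<lambda>k. nat \<lfloor>(space_factor + time_factor) * real (max 1 k) * real n powr \<rho> * log 2 (real n)\<rfloor>)"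
    if "2 \<le> n" "word_factor * log 2 (real n) \<le> real w" "d \<le> n ^ \<kappa>"
      "length ps = n" "distinct ps" "\<forall>x\<in>set ps. x \<subseteq> {1..d}" for n d w ps
  proof -
    interpret long_word_instance b1 b2 \<rho> \<kappa> n d w ps
      using that scale_le_if_long_words by unfold_locales
    show ?thesis by (rule solves)
  qed
  ultimately show ?thesis by blast
qed

end
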